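(* Let $1<p<\infty$. (i) Let $w$ be a weight on $\mathbb{R}_-$. Then $M^+_-$ is bounded on $L^p_w(\mathbb{R}_-)$ if and only if $w\in A^+_p(\mathbb{R}_-)$, and $M^-_-$ is bounded on $L^p_w(\mathbb{R}_-)$ if and only if $w\in A^-_p(\mathbb{R}_-)$. (ii) Let $w$ be a weight on $\mathbb{R}_+$. Then $M^+_+$ is bounded on $L^p_w(\mathbb{R}_+)$ if and only if $w\in A^+_p(\mathbb{R}_+)$, and $M^-_+$ is bounded on $L^p_w(\mathbb{R}_+)$ if and only if $w\in A^-_p(\mathbb{R}_+)$.
   Context: $\mathbb{R}_-=(-\infty,0]$, $\mathbb{R}_+=[0,\infty)$. A weight on $\mathbb{R}_\pm$ is a measurable function $w:\mathbb{R}_\pm\to[0,\infty)$ with $w>0$ a.e. $L^p_w(\mathbb{R}_\pm)$ is the $L^p$-space with respect to the measure $w\,dt$ on $\mathbb{R}_\pm$. For $p\in(1,\infty)$, $p'=p/(p-1)$. One-sided maximal operators: $M^-f(t)=\sup_{h>0}\frac1h\int_{t-h}^t|f|\,ds$ and $M^+f(t)=\sup_{h>0}\frac1h\int_t^{t+h}|f|\,ds$ ($t\in\mathbb{R}$). For $f$ on $\mathbb{R}_-$ (extended by $0$ to $\mathbb{R}$), $M^\pm_-f:=\chi_{\mathbb{R}_-}M^\pm f$; for $f$ on $\mathbb{R}_+$ (extended by $0$ to $\mathbb{R}$), $M^\pm_+f:=\chi_{\mathbb{R}_+}M^\pm f$. The formulas define $[0,\infty]$-valued functions for all measurable $f$.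 Classes of weights: let $J$ be $\mathbb{R}_-$ or $\mathbb{R}_+$, and let suprema run over $a<b<c$ in $J$ (i.e. $a<b<c\le0$ if $J=\mathbb{R}_-$ and $0\le a<b<c$ if $J=\mathbb{R}_+$). Then $w\in A_p^+(J)$ if $[w]_{A_p^+(J)}:=\sup\frac1{(c-a)^p}\int_a^bw\,dt\big(\int_b^cw^{1-p'}dt\big)^{p-1}<\infty$, and $w\in A_p^-(J)$ if $[w]_{A_p^-(J)}:=\sup\frac1{(c-a)^p}\int_b^cw\,dt\big(\int_a^bw^{1-p'}dt\big)^{p-1}<\infty$. *)

theory Defs
  imports "HOL-Analysis.Analysis"
begin

text \<open>Measurability is Lebesgue measurability throughout. A function on a set \<open>J\<close> is
  represented by a function on \<open>real\<close> whose values outside \<open>J\<close> are irrelevant.\<close>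

abbreviation real_minus :: "real set" where "real_minus \<equiv> {..0}"

abbreviation real_plus :: "real set" where "real_plus \<equiv> {0..}"

text \<open>\<open>x\<^sup>r\<close> for \<open>x \<in> [0,\<infinity>]\<close> and an exponent \<open>r > 0\<close> (the only case used), so \<open>\<infinity>\<^sup>r = \<infinity>\<close>.\<close>

definition ennreal_powr :: "ennreal \<Rightarrow> real \<Rightarrow> ennreal" where
  "ennreal_powr x r = (if x = \<infinity> then \<infinity> else ennreal (enn2real x powr r))"

definition weight_on :: "real set \<Rightarrow> (real \<Rightarrow> real) \<Rightarrow> bool" where
  "weight_on J w \<longleftrightarrow> w \<in> borel_measurable (lebesgue_on J) \<and> (\<forall>t\<in>J. 0 \<le> w t) \<and>
     (AE t in lebesgue_on J. 0 < w t)"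

definition weighted_measure :: "real set \<Rightarrow> (real \<Rightarrow> real) \<Rightarrow> real measure" where
  "weighted_measure J w = density (lebesgue_on J) (\<lambda>t. ennreal (w t))"

text \<open>The norm is defined for \<open>[0,\<infinity>]\<close>-valued functions, since maximal functions may
  take the value \<open>\<infinity>\<close>; for a scalar function \<open>f\<close> it is applied to \<open>|f|\<close>.\<close>

definition Lp_norm :: "real \<Rightarrow> real measure \<Rightarrow> (real \<Rightarrow> ennreal) \<Rightarrow> ennreal" where
  "Lp_norm p M g = ennreal_powr (\<integral>\<^sup>+ t. ennreal_powr (g t) p \<partial>M) (1 / p)"

definition Lp_functions :: "real \<Rightarrow> real measure \<Rightarrow> (real \<Rightarrow> complex) set" where
  "Lp_functions p M = {f \<in> borel_measurable M. Lp_norm p M (\<lambda>t. ennreal (norm (f t))) < \<infinity>}"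

definition maximal_minus :: "(real \<Rightarrow> complex) \<Rightarrow> real \<Rightarrow> ennreal" where
  "maximal_minus f t =
     (SUP h\<in>{0<..}. ennreal (1 / h) * (\<integral>\<^sup>+ s\<in>{t - h..t}. ennreal (norm (f s)) \<partial>lebesgue))"

definition maximal_plus :: "(real \<Rightarrow> complex) \<Rightarrow> real \<Rightarrow> ennreal" where
  "maximal_plus f t =
     (SUP h\<in>{0<..}. ennreal (1 / h) * (\<integral>\<^sup>+ s\<in>{t..t + h}. ennreal (norm (f s)) \<partial>lebesgue))"

definition extend_zero :: "real set \<Rightarrow> (real \<Rightarrow> complex) \<Rightarrow> real \<Rightarrow> complex" where
  "extend_zero J f t = (if t \<in> J then f t else 0)"

definition maximal_minus_on :: "real set \<Rightarrow> (real \<Rightarrow> complex) \<Rightarrow> real \<Rightarrow> ennreal" where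
  "maximal_minus_on J f t = indicator J t * maximal_minus (extend_zero J f) t"

definition maximal_plus_on :: "real set \<Rightarrow> (real \<Rightarrow> complex) \<Rightarrow> real \<Rightarrow> ennreal" where
  "maximal_plus_on J f t = indicator J t * maximal_plus (extend_zero J f) t"

definition bounded_on_Lp ::
    "real \<Rightarrow> real measure \<Rightarrow> ((real \<Rightarrow> complex) \<Rightarrow> real \<Rightarrow> ennreal) \<Rightarrow> bool" where
  "bounded_on_Lp p M T \<longleftrightarrow>
     (\<exists>C::real. \<forall>f\<in>Lp_functions p M. T f \<in> borel_measurable M \<and>
        Lp_norm p M (T f) \<le> ennreal C * Lp_norm p M (\<lambda>t. ennreal (norm (f t))))"

definition conjugate_exponent :: "real \<Rightarrow> real" where
  "conjugate_exponent p = p / (p - 1)"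

text \<open>The points where \<open>w = 0\<close>, at which \<open>powr\<close> with a negative exponent yields \<open>0\<close> instead
  of \<open>\<infinity>\<close>, form a null set for a weight \<open>w\<close>. For the same reason both integrals below are
  positive, so that the convention \<open>0 \<cdot> \<infinity> = 0\<close> plays no role.\<close>

definition Ap_plus_const :: "real \<Rightarrow> real set \<Rightarrow> (real \<Rightarrow> real) \<Rightarrow> ennreal" where
  "Ap_plus_const p J w =
     (SUP (a, b, c) \<in> {(a, b, c). a \<in> J \<and> b \<in> J \<and> c \<in> J \<and> a < b \<and> b < c}.
        ennreal (1 / (c - a) powr p) * (\<integral>\<^sup>+ t\<in>{a..b}. ennreal (w t) \<partial>lebesgue) *
        ennreal_powr
          (\<integral>\<^sup>+ t\<in>{b..c}. ennreal (w t powr (1 - conjugate_exponent p)) \<partial>lebesgue) (p - 1))"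

definition Ap_minus_const :: "real \<Rightarrow> real set \<Rightarrow> (real \<Rightarrow> real) \<Rightarrow> ennreal" where
  "Ap_minus_const p J w =
     (SUP (a, b, c) \<in> {(a, b, c). a \<in> J \<and> b \<in> J \<and> c \<in> J \<and> a < b \<and> b < c}.
        ennreal (1 / (c - a) powr p) * (\<integral>\<^sup>+ t\<in>{b..c}. ennreal (w t) \<partial>lebesgue) *
        ennreal_powr
          (\<integral>\<^sup>+ t\<in>{a..b}. ennreal (w t powr (1 - conjugate_exponent p)) \<partial>lebesgue) (p - 1))"

definition Ap_plus :: "real \<Rightarrow> real set \<Rightarrow> (real \<Rightarrow> real) set" where
  "Ap_plus p J = {w. weight_on J w \<and> Ap_plus_const p J w < \<infinity>}"

definition Ap_minus :: "real \<Rightarrow> real set \<Rightarrow> (real \<Rightarrow> real) set" where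
  "Ap_minus p J = {w. weight_on J w \<and> Ap_minus_const p J w < \<infinity>}"

end

theory Submission
  imports Defs
begin

text \<open>The statement holds on every closed interval \<open>J\<close>, and the left maximal
operator reduces to the right one by reflection at the origin, so consider the right maximal
operator. Write \<open>r = p - 1\<close>, let \<open>W\<close> be the weight \<open>w\<close>
extended by zero, and let \<open>S\<close> be the dual weight \<open>w\<^bsup>- 1/r\<^esup>\<close>
extended by zero.

Necessity of the Muckenhoupt condition follows from testing on truncations of \<open>S\<close> on
\<open>(b, c)\<close>, whose maximal function is bounded below on \<open>(a, b)\<close>
(\<open>Ap_plus_if_maximal_plus_bounded\<close>).

For sufficiency, the rising sun lemma describes each component \<open>(a, b)\<close> of a level set
of the maximal function: every right part \<open>(x, b)\<close> carries an average of at least the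
level. A weighted weak type inequality at the same exponent follows by cutting \<open>(a, b)\<close>
at points that successively halve the remaining integral and applying the condition to adjacent
pieces (\<open>weak_type\<close>). The strong type inequality then follows by interpolation,
provided that the condition holds for some smaller exponent (\<open>strong_type\<close>).

The self-improvement of the condition rests on a one-sided reverse Hoelder inequality. The rising
sun lemma applied to \<open>S\<close> on \<open>(t, d)\<close> shows that the integral of
\<open>S\<close> over the set where \<open>S > l\<close> is at most \<open>4 l\<close> times the
measure of the set where \<open>S > b l\<close>, for all levels \<open>l\<close> above the value of
the maximal function of \<open>S\<close> at \<open>t\<close> (\<open>level_estimate\<close>).
Integration over \<open>l\<close> bounds the integral of \<open>S\<^bsup>1 + e\<^esup>\<close> for
some \<open>e > 0\<close> (\<open>reverse_holder_from_levels\<close>). Choosing \<open>t\<close>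
well in a gap between two intervals gives the condition for a smaller exponent on intervals that are
separated by a gap (\<open>exists_gap_improvement\<close>), and a dyadic decomposition around the
common end point removes the gap (\<open>two_weight_of_gap\<close>).\<close>

section \<open>Integrals over sets and components of open sets\<close>

text \<open>The integral of \<open>g\<close> over \<open>A\<close>, as an extended nonnegative
number. Negative values of \<open>g\<close> are truncated to \<open>0\<close>. Borel functions and
Lebesgue--Borel measure suffice here, since Lebesgue measurable data agree almost everywhere with
Borel data.\<close>

definition mass :: "(real \<Rightarrow> real) \<Rightarrow> real set \<Rightarrow> ennreal" where
  "mass g A = (\<integral>\<^sup>+x\<in>A. ennreal (g x) \<partial>lborel)"

lemma mass_eq_emeasure:
  assumes "g \<in> borel_measurable borel" "A \<in> sets borel"
  shows "mass g A = emeasure (density lborel (\<lambda>x. ennreal (g x))) A"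
  using assms by (simp add: mass_def emeasure_density)

lemma mass_mono_set: "A \<subseteq> B \<Longrightarrow> mass g A \<le> mass g B"
  unfolding mass_def by (intro nn_integral_mono) (auto split: split_indicator)

lemma mass_mono: "(\<And>x. x \<in> A \<Longrightarrow> g x \<le> h x) \<Longrightarrow> mass g A \<le> mass h A"
  unfolding mass_def by (intro nn_integral_mono) (auto split: split_indicator intro: ennreal_leI)

lemma mass_cong: "(\<And>x. x \<in> A \<Longrightarrow> g x = h x) \<Longrightarrow> mass g A = mass h A"
  by (intro antisym mass_mono) auto

lemma mass_empty [simp]: "mass g {} = 0"
  by (simp add: mass_def)

lemma mass_eq_0: "(\<And>x. x \<in> A \<Longrightarrow> g x = 0) \<Longrightarrow> mass g A = 0"
  using mass_cong[of A g "\<lambda>_. 0"] by (simp add: mass_def)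

lemma mass_Un_disjoint:
  assumes "g \<in> borel_measurable borel" "A \<in> sets borel" "B \<in> sets borel" "A \<inter> B = {}"
  shows "mass g (A \<union> B) = mass g A + mass g B"
  using assms by (simp add: mass_eq_emeasure plus_emeasure)

lemma mass_indicator: "mass (\<lambda>x. g x * indicator B x) A = mass g (A \<inter> B)"
  unfolding mass_def by (intro nn_integral_cong) (auto split: split_indicator)

lemma mass_closed_open: "mass g {a..b} = mass g {a<..<b}" "mass g {a<..b} = mass g {a<..<b}"
    "mass g {a..<b} = mass g {a<..<b}"
proof -
  have *: "AE x in lborel. x \<noteq> a \<and> x \<noteq> b"
    using AE_lborel_singleton[of a] AE_lborel_singleton[of b] by eventually_elim auto
  show "mass g {a..b} = mass g {a<..<b}" unfolding mass_def
    by (rule nn_integral_cong_AE, use * in eventually_elim) (auto split: split_indicator)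
  show "mass g {a<..b} = mass g {a<..<b}" unfolding mass_def
    by (rule nn_integral_cong_AE, use * in eventually_elim) (auto split: split_indicator)
  show "mass g {a..<b} = mass g {a<..<b}" unfolding mass_def
    by (rule nn_integral_cong_AE, use * in eventually_elim) (auto split: split_indicator)
qed

lemma mass_split:
  assumes "g \<in> borel_measurable borel" "a \<le> b" "b \<le> c"
  shows "mass g {a<..<c} = mass g {a<..<b} + mass g {b<..<c}"
proof (cases "a < b \<and> b < c")
  case True
  then have "{a<..<c} = {a<..<b} \<union> {b..<c}" "{a<..<b} \<inter> {b..<c} = {}" by auto
  then show ?thesis
    using assms(1) mass_Un_disjoint[of g "{a<..<b}" "{b..<c}"] by (simp add: mass_closed_open(3))
next
  case False
  then have "a = b \<or> b = c" using assms by auto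
  then show ?thesis by auto
qed

lemma mass_const: "0 \<le> c \<Longrightarrow> a \<le> b \<Longrightarrow> mass (\<lambda>_. c) {a<..<b} = ennreal (c * (b - a))"
  by (simp add: mass_def nn_integral_cmult_indicator ennreal_mult')

lemma mass_cmult:
  assumes "g \<in> borel_measurable borel" "A \<in> sets borel" "0 \<le> c"
  shows "mass (\<lambda>x. c * g x) A = ennreal c * mass g A"
  using assms by (simp add: mass_def ennreal_mult' mult.assoc nn_integral_cmult)

lemma mass_add:
  assumes "g \<in> borel_measurable borel" "h \<in> borel_measurable borel" "A \<in> sets borel"
    "\<And>x. 0 \<le> g x" "\<And>x. 0 \<le> h x"
  shows "mass (\<lambda>x. g x + h x) A = mass g A + mass h A"
  using assms by (simp add: mass_def ennreal_plus distrib_right nn_integral_add)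

lemma mass_approx_left:
  assumes "g \<in> borel_measurable borel" "v < mass g {a<..<b}"
  shows "\<exists>a'. a < a' \<and> a' < b \<and> v < mass g {a'<..<b}"
proof -
  have ab: "a < b" using assms(2) by (cases "a < b") auto
  let ?A = "\<lambda>n::nat. {a + (b-a) / (real n + 2)<..<b}"
  have inc: "incseq ?A"
  proof (rule monoI)
    fix m n :: nat assume "m \<le> n"
    then have "(b-a) / (real n + 2) \<le> (b-a) / (real m + 2)" using ab by (intro divide_left_mono) auto
    then show "?A m \<subseteq> ?A n" by auto
  qed
  have un: "(\<Union>n. ?A n) = {a<..<b}"
  proof safe
    fix x n assume "x \<in> ?A n"
    moreover have "(b-a) / (real n + 2) > 0" using ab by simp
    ultimately show "x \<in> {a<..<b}" by auto
  next
    fix x assume x: "x \<in> {a<..<b}"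
    obtain n :: nat where "(b-a)/(x-a) < real n" using reals_Archimedean2 by blast
    then have "(b-a) < real n * (x - a)" using x by (simp add: divide_simps)
    also have "\<dots> \<le> (real n + 2) * (x-a)" using x by (intro mult_right_mono) auto
    finally have "(b-a) / (real n + 2) < x - a" by (simp add: divide_simps mult.commute)
    then show "x \<in> (\<Union>n. ?A n)" using x by (auto intro!: exI[of _ n])
  qed
  have "(SUP n. mass g (?A n)) = mass g {a<..<b}"
    using SUP_emeasure_incseq[of ?A "density lborel (\<lambda>x. ennreal (g x))"] inc assms(1) un
    by (simp add: mass_eq_emeasure image_subset_iff)
  then have "v < (SUP n. mass g (?A n))" using assms(2) by simp
  then obtain n where "v < mass g (?A n)" unfolding less_SUP_iff by blast
  moreover have "a + (b-a) / (real n + 2) < b"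
  proof -
    have "(b-a) / (real n + 2) < b - a" using ab by (simp add: divide_less_eq)
    then show ?thesis by simp
  qed
  ultimately show ?thesis using ab by (intro exI[of _ "a + (b-a) / (real n + 2)"]) auto
qed

lemma mass_reflect:
  assumes "g \<in> borel_measurable borel" "A \<in> sets borel"
  shows "mass (\<lambda>x. g (- x)) (uminus ` A) = mass g A"
proof -
  have "mass g A = (\<integral>\<^sup>+x. ennreal (g (-x)) * indicator A (-x) \<partial>lborel)"
    unfolding mass_def
    using nn_integral_real_affine[of "\<lambda>x. ennreal (g x) * indicator A x" "-1" 0] assms by simp
  also have "\<dots> = mass (\<lambda>x. g (- x)) (uminus ` A)"
    unfolding mass_def by (intro nn_integral_cong) (auto split: split_indicator intro: rev_image_eqI)
  finally show ?thesis ..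
qed

lemma mass_approx_right:
  assumes "g \<in> borel_measurable borel" "v < mass g {a<..<b}"
  shows "\<exists>b'. a < b' \<and> b' < b \<and> v < mass g {a<..<b'}"
proof -
  have g: "(\<lambda>x. g (- x)) \<in> borel_measurable borel" using assms(1) by measurable
  have im: "uminus ` {s<..<t} = {-t<..<-s}" for s t :: real
    by (simp add: image_uminus_greaterThanLessThan)
  have *: "mass (\<lambda>x. g (- x)) {-t<..<-s} = mass g {s<..<t}" for s t
    using mass_reflect[OF assms(1), of "{s<..<t}"] by (simp add: im)
  obtain a' where "-b < a'" "a' < -a" "v < mass (\<lambda>x. g (- x)) {a'<..<-a}"
    using mass_approx_left[OF g, of v "-b" "-a"] assms(2) * by auto
  then show ?thesis using *[of "-a'" a] by (intro exI[of _ "-a'"]) auto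
qed

lemma open_component_interval:
  fixes U :: "real set"
  assumes "open U" "C \<in> components U"
    and bdd: "\<And>x. x \<in> U \<Longrightarrow> (\<exists>y>x. y \<notin> U) \<and> (\<exists>y<x. y \<notin> U)"
  obtains a b where "a < b" "C = {a<..<b}" "a \<notin> U" "b \<notin> U"
proof -
  have oC: "open C" using assms open_components by blast
  have cC: "connected C" "C \<subseteq> U" "C \<noteq> {}"
    using in_components_connected[OF assms(2)] in_components_subset[OF assms(2)]
      in_components_nonempty[OF assms(2)] by auto
  then obtain x where x: "x \<in> C" by blast
  obtain y z where yz: "x < y" "y \<notin> U" "z < x" "z \<notin> U" using bdd[of x] x cC by auto
  have iv: "u \<in> C" if "s \<in> C" "t \<in> C" "s \<le> u" "u \<le> t" for s t u
    using cC(1) that by (meson connectedD_interval)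
  have up: "s < y" if "s \<in> C" for s
    using iv[OF x that, of y] yz cC(2) by force
  have lo: "z < s" if "s \<in> C" for s
    using iv[OF that x, of z] yz cC(2) by force
  have ba: "bdd_above C" "bdd_below C" using up lo by (meson bdd_aboveI bdd_belowI less_imp_le)+
  have bd: "Inf C < s \<and> s < Sup C" if s: "s \<in> C" for s
  proof -
    obtain e where e: "e > 0" "ball s e \<subseteq> C" using oC s open_contains_ball by blast
    have "s - e/2 \<in> C" "s + e/2 \<in> C" using e by (auto simp: subset_iff dist_real_def)
    then show ?thesis using cInf_lower[OF _ ba(2), of "s - e/2"] cSup_upper[OF _ ba(1), of "s+e/2"] e by auto
  qed
  have C: "C = {Inf C<..<Sup C}"
  proof
    show "C \<subseteq> {Inf C<..<Sup C}" using bd by auto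
    show "{Inf C<..<Sup C} \<subseteq> C"
    proof
      fix u assume u: "u \<in> {Inf C<..<Sup C}"
      obtain s where "s \<in> C" "s < u" using u cInf_lessD[OF cC(3)] by auto
      moreover obtain t where "t \<in> C" "u < t" using u less_cSupD[OF cC(3)] by auto
      ultimately show "u \<in> C" using iv[of s t u] by auto
    qed
  qed
  have max: "T \<subseteq> C" if "connected T" "T \<subseteq> U" "x \<in> T" for T
    using components_maximal[OF assms(2) that(1,2)] x that(3) by auto
  have "Sup C \<notin> U"
  proof
    assume S: "Sup C \<in> U"
    have "{x..Sup C} \<subseteq> U"
    proof
      fix t assume "t \<in> {x..Sup C}"
      then show "t \<in> U" using S C cC(2) bd[OF x] by (cases "t = Sup C") auto
    qed
    then have "Sup C \<in> C" using max[of "{x..Sup C}"] bd[OF x] by auto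
    then show False using bd by blast
  qed
  moreover have "Inf C \<notin> U"
  proof
    assume S: "Inf C \<in> U"
    have "{Inf C..x} \<subseteq> U"
    proof
      fix t assume "t \<in> {Inf C..x}"
      then show "t \<in> U" using S C cC(2) bd[OF x] by (cases "t = Inf C") auto
    qed
    then have "Inf C \<in> C" using max[of "{Inf C..x}"] bd[OF x] by auto
    then show False using bd by blast
  qed
  ultimately show ?thesis using that[of "Inf C" "Sup C"] C bd[OF x] by auto
qed

text \<open>An inequality between the integrals of two functions over an open set follows from the
same inequality on each component. All components are bounded under the assumption on
\<open>U\<close>.\<close>

lemma mass_le_by_components:
  fixes U :: "real set"
  assumes "open U" and [measurable]: "g \<in> borel_measurable borel" "h \<in> borel_measurable borel"
    and bdd: "\<And>x. x \<in> U \<Longrightarrow> (\<exists>y>x. y \<notin> U) \<and> (\<exists>y<x. y \<notin> U)"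
    and comp: "\<And>a b. a < b \<Longrightarrow> {a<..<b} \<subseteq> U \<Longrightarrow> a \<notin> U \<Longrightarrow> b \<notin> U \<Longrightarrow>
      mass g {a<..<b} \<le> K * mass h {a<..<b}"
  shows "mass g U \<le> K * mass h U"
proof -
  have dj: "disjoint (components U)"
    using pairwise_disjoint_components[of U] by (simp add: disjoint_def pairwise_def disjnt_def)
  have cnt: "countable (components U)"
    by (rule countable_disjoint_open_subsets) (use assms(1) dj open_components in auto)
  have op: "C \<in> sets borel" if "C \<in> components U" for C using open_components[OF assms(1) that] by simp
  have eq: "mass k U = (\<integral>\<^sup>+C. mass k C \<partial>count_space (components U))"
    if k: "k \<in> borel_measurable borel" for k
  proof -
    have "mass k U = emeasure (density lborel (\<lambda>x. ennreal (k x))) (\<Union>C\<in>components U. C)"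
      using assms(1) k Union_components[of U] by (simp add: mass_eq_emeasure)
    also have "\<dots> = (\<integral>\<^sup>+C. emeasure (density lborel (\<lambda>x. ennreal (k x))) C \<partial>count_space (components U))"
      by (rule emeasure_UN_countable)
         (use op cnt dj in \<open>auto simp: disjoint_family_on_def disjoint_def\<close>)
    also have "\<dots> = (\<integral>\<^sup>+C. mass k C \<partial>count_space (components U))"
      by (intro nn_integral_cong) (use op k in \<open>auto simp: mass_eq_emeasure\<close>)
    finally show ?thesis .
  qed
  have "mass g U = (\<integral>\<^sup>+C. mass g C \<partial>count_space (components U))" by (rule eq) simp
  also have "\<dots> \<le> (\<integral>\<^sup>+C. K * mass h C \<partial>count_space (components U))"
  proof (intro nn_integral_mono)
    fix C assume "C \<in> space (count_space (components U))"
    then have C: "C \<in> components U" by simp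
    obtain a b where ab: "a < b" "C = {a<..<b}" "a \<notin> U" "b \<notin> U"
      using open_component_interval[OF assms(1) C bdd] by blast
    then show "mass g C \<le> K * mass h C" using comp in_components_subset[OF C] by auto
  qed
  also have "\<dots> = K * mass h U" using eq[of h] by (simp add: nn_integral_cmult)
  finally show ?thesis .
qed

section \<open>The rising sun lemma\<close>

text \<open>The level set of the right maximal function: \<open>x\<close> belongs to \<open>exceed f
l\<close> if some interval that starts at \<open>x\<close> carries an average of \<open>f\<close>
above \<open>l\<close>.\<close>

definition exceed :: "(real \<Rightarrow> real) \<Rightarrow> real \<Rightarrow> real set" where
  "exceed f l = {x. \<exists>y>x. ennreal (l * (y - x)) < mass f {x<..<y}}"

lemma not_exceedD: "x \<notin> exceed f l \<Longrightarrow> x \<le> y \<Longrightarrow> mass f {x<..<y} \<le> ennreal (l * (y - x))"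
  unfolding exceed_def by (cases "x < y") (auto simp: not_less[symmetric])

lemma open_exceed:
  assumes f: "f \<in> borel_measurable borel" and l: "0 \<le> l"
  shows "open (exceed f l)"
proof (subst open_subopen, rule ballI)
  fix x assume "x \<in> exceed f l"
  then obtain y where y: "x < y" "ennreal (l * (y - x)) < mass f {x<..<y}"
    by (auto simp: exceed_def)
  obtain x1 where x1: "x < x1" "x1 < y" "ennreal (l * (y - x)) < mass f {x1<..<y}"
    using mass_approx_left[OF f y(2)] by auto
  obtain r where r: "ennreal (l * (y - x)) < r" "r < mass f {x1<..<y}"
    using dense[OF x1(3)] by auto
  then have "r < top" using top.not_eq_extremum by fastforce
  then obtain r' where r': "r = ennreal r'" "0 \<le> r'" by (cases r) auto
  have lr: "l * (y - x) < r'" using r(1) r' l y(1) by (simp add: ennreal_less_iff)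
  \<comment> \<open>the slack \<open>r' - l (y - x)\<close> allows the left end to move left by \<open>d\<close>\<close>
  define d where "d = (r' - l * (y - x)) / (l + 1)"
  have d: "d > 0" using lr l by (simp add: d_def)
  have "l * d \<le> (l + 1) * d" using d by simp
  also have "\<dots> = r' - l * (y - x)" using l by (simp add: d_def)
  finally have ld: "l * (y - x + d) \<le> r'" by (simp add: algebra_simps)
  show "\<exists>T. open T \<and> x \<in> T \<and> T \<subseteq> exceed f l"
  proof (intro exI[of _ "{x - d<..<x1}"] conjI)
    show "open {x - d<..<x1}" "x \<in> {x - d<..<x1}" using d x1 by auto
    show "{x - d<..<x1} \<subseteq> exceed f l"
    proof (rule subsetI)
      fix z assume z: "z \<in> {x - d<..<x1}"
      have "l * (y - z) \<le> l * (y - x + d)" using z l by (intro mult_left_mono) auto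
      then have "ennreal (l * (y - z)) \<le> r" using ld r' by (auto intro: ennreal_leI)
      also have "\<dots> < mass f {x1<..<y}" by (rule r)
      also have "\<dots> \<le> mass f {z<..<y}" using z by (intro mass_mono_set) auto
      finally show "z \<in> exceed f l" using z x1 by (auto simp: exceed_def intro!: exI[of _ y])
    qed
  qed
qed

lemma exceed_measurable [measurable]:
  "f \<in> borel_measurable borel \<Longrightarrow> 0 \<le> l \<Longrightarrow> exceed f l \<in> sets borel"
  by (intro borel_open open_exceed)

text \<open>For each \<open>x\<close> the largest \<open>s\<close> for which the average of
\<open>f\<close> over \<open>(x, s)\<close> is at least \<open>l\<close> exists and lies outside the
level set, since otherwise the interval could be prolonged.\<close>

lemma exceed_right_end:
  assumes f: "f \<in> borel_measurable borel" and l: "0 < l" and fin: "mass f UNIV < \<infinity>"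
  obtains s where "x \<le> s" "s \<notin> exceed f l" "ennreal (l * (s - x)) \<le> mass f {x<..<s}"
proof -
  let ?Y = "{y. x \<le> y \<and> ennreal (l * (y - x)) \<le> mass f {x<..<y}}"
  obtain M where M: "mass f UNIV = ennreal M" "0 \<le> M" using fin by (cases "mass f UNIV") auto
  have yb: "y \<le> x + M / l" if y: "y \<in> ?Y" for y
  proof -
    have "ennreal (l * (y - x)) \<le> mass f {x<..<y}" using y by simp
    also have "\<dots> \<le> ennreal M" using mass_mono_set[of "{x<..<y}" UNIV f] M by simp
    finally have "ennreal (l * (y - x)) \<le> ennreal M" .
    then have "l * (y - x) \<le> M" using M by simp
    then have "y - x \<le> M / l" using l by (simp add: pos_le_divide_eq mult.commute)
    then show ?thesis by simp
  qed
  have xY: "x \<in> ?Y" by simp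
  have bd: "bdd_above ?Y" using yb by (rule bdd_aboveI)
  define s where "s = Sup ?Y"
  have xs: "x \<le> s" unfolding s_def by (rule cSup_upper[OF xY bd])
  have sY: "ennreal (l * (s - x)) \<le> mass f {x<..<s}"
  proof (rule ccontr)
    assume c: "\<not> ?thesis"
    then obtain m where m: "mass f {x<..<s} = ennreal m" "0 \<le> m" 
      by (cases "mass f {x<..<s}") auto
    have "m < l * (s - x)" using c m l xs by (simp add: not_le ennreal_less_iff)
    then have "x + m / l < s" using l by (simp add: field_simps)
    then obtain y where y: "y \<in> ?Y" "x + m / l < y"
      using less_cSup_iff[of ?Y "x + m/l"] xY bd unfolding s_def by blast
    have "y \<le> s" unfolding s_def by (rule cSup_upper[OF y(1) bd])
    then have "{x<..<y} \<subseteq> {x<..<s}" by auto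
    then have "mass f {x<..<y} \<le> ennreal m"
      using mass_mono_set[of "{x<..<y}" "{x<..<s}" f] m(1) by metis
    moreover have "ennreal (l * (y - x)) \<le> mass f {x<..<y}" using y(1) by simp
    ultimately have "ennreal (l * (y - x)) \<le> ennreal m" by (rule order_trans[rotated])
    then have "l * (y - x) \<le> m" using m by simp
    then show False using y(2) l by (simp add: field_simps)
  qed
  have "s \<notin> exceed f l"
  proof
    assume "s \<in> exceed f l"
    then obtain z where z: "s < z" "ennreal (l * (z - s)) < mass f {s<..<z}" by (auto simp: exceed_def)
    have "ennreal (l * (z - x)) = ennreal (l * (s - x)) + ennreal (l * (z - s))"
      using l xs z by (subst ennreal_plus[symmetric]) (auto simp: algebra_simps)
    also have "\<dots> \<le> mass f {x<..<s} + mass f {s<..<z}"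
      using sY z by (intro add_mono) auto
    also have "\<dots> = mass f {x<..<z}" using mass_split[OF f, of x s z] xs z by simp
    finally have "z \<in> ?Y" using xs z by simp
    then have "z \<le> s" unfolding s_def by (intro cSup_upper bd)
    then show False using z by simp
  qed
  then show ?thesis using that xs sY by blast
qed

lemma exceed_bounded:
  assumes f: "f \<in> borel_measurable borel" and l: "0 < l" and fin: "mass f UNIV < \<infinity>"
    and x: "x \<in> exceed f l"
  shows "(\<exists>y>x. y \<notin> exceed f l) \<and> (\<exists>y<x. y \<notin> exceed f l)"
proof
  show "\<exists>y>x. y \<notin> exceed f l"
    using exceed_right_end[OF f l fin, of x] x by (metis le_less)
  show "\<exists>y<x. y \<notin> exceed f l"
  proof (rule ccontr)
    assume "\<not> ?thesis"
    then have all: "y \<in> exceed f l" if "y \<le> x" for y using x that by (cases "y = x") auto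
    obtain M where M: "mass f UNIV = ennreal M" "0 \<le> M" using fin by (cases "mass f UNIV") auto
    define y where "y = x - M / l - 1"
    obtain s where s: "y \<le> s" "s \<notin> exceed f l" "ennreal (l * (s - y)) \<le> mass f {y<..<s}"
      using exceed_right_end[OF f l fin] by blast
    have "x < s" using all[of s] s(2) by (meson not_le)
    note s(3)
    also have "mass f {y<..<s} \<le> ennreal M" using mass_mono_set[of "{y<..<s}" UNIV f] M by simp
    finally have "ennreal (l * (s - y)) \<le> ennreal M" .
    then have "l * (s - y) \<le> M" using M by simp
    moreover have "l * (x - y) < l * (s - y)" using \<open>x < s\<close> l by simp
    moreover have "l * (x - y) = M + l" using l by (simp add: y_def algebra_simps)
    ultimately show False using l by simp
  qed
qed

text \<open>Every interval that is contained in the level set and ends at a point outside it carries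
an average of at least \<open>l\<close>. In particular this holds for each right part \<open>(x,
b)\<close> of a component \<open>(a, b)\<close>.\<close>

lemma rising_sun:
  assumes f: "f \<in> borel_measurable borel" and l: "0 < l" and fin: "mass f UNIV < \<infinity>"
    and ab: "a \<le> b" "{a<..<b} \<subseteq> exceed f l" "b \<notin> exceed f l"
  shows "ennreal (l * (b - a)) \<le> mass f {a<..<b}"
proof -
  have *: "ennreal (l * (b - x)) \<le> mass f {a<..<b}" if x: "a < x" "x < b" for x
  proof -
    obtain s where s: "x \<le> s" "s \<notin> exceed f l" "ennreal (l * (s - x)) \<le> mass f {x<..<s}"
      using exceed_right_end[OF f l fin] by blast
    have bs: "b \<le> s"
    proof (rule ccontr)
      assume "\<not> ?thesis"
      then have "s \<in> {a<..<b}" using x s by auto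
      then show False using ab s by blast
    qed
    have "ennreal (l * (b - x)) + ennreal (l * (s - b)) = ennreal (l * (s - x))"
      using l x bs by (subst ennreal_plus[symmetric]) (auto simp: algebra_simps)
    also have "\<dots> \<le> mass f {x<..<b} + mass f {b<..<s}"
      using s(3) mass_split[OF f, of x b s] x bs by simp
    also have "\<dots> \<le> mass f {x<..<b} + ennreal (l * (s - b))"
      using not_exceedD[OF ab(3) bs] by (intro add_mono) auto
    finally have "ennreal (l * (b - x)) \<le> mass f {x<..<b}"
      by (simp add: add.commute[of _ "ennreal (l * (s - b))"] ennreal_add_left_cancel_le)
    also have "\<dots> \<le> mass f {a<..<b}" using x by (intro mass_mono_set) auto
    finally show ?thesis .
  qed
  show ?thesis
  proof (rule ccontr)
    assume c: "\<not> ?thesis"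
    then obtain m where m: "mass f {a<..<b} = ennreal m" "0 \<le> m" 
      by (cases "mass f {a<..<b}") auto
    have m2: "m < l * (b - a)" using c m l ab by (simp add: not_le ennreal_less_iff)
    then have lt: "a < b - m / l" using l by (simp add: field_simps)
    obtain x where x: "a < x" "x < b - m / l" using dense[OF lt] by blast
    have "x < b" using x(2) m l by (smt (verit) divide_nonneg_pos)
    then have "l * (b - x) \<le> m" using *[OF x(1)] m by simp
    then show False using x(2) l by (simp add: field_simps)
  qed
qed

lemma exceed_weak_type_1:
  assumes f[measurable]: "f \<in> borel_measurable borel" and l: "0 < l" and fin: "mass f UNIV < \<infinity>"
  shows "ennreal l * emeasure lborel (exceed f l) \<le> mass f UNIV"
proof -
  have "ennreal l * emeasure lborel (exceed f l) = mass (\<lambda>_. l) (exceed f l)"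
    using l by (simp add: mass_def nn_integral_cmult_indicator exceed_measurable)
  also have "\<dots> \<le> 1 * mass f (exceed f l)"
  proof (rule mass_le_by_components)
    show "open (exceed f l)" using open_exceed[OF f] l by simp
    fix a b assume "a < b" "{a<..<b} \<subseteq> exceed f l" "b \<notin> exceed f l"
    then show "mass (\<lambda>_. l) {a<..<b} \<le> 1 * mass f {a<..<b}"
      using rising_sun[OF f l fin, of a b] l by (simp add: mass_const)
  qed (use exceed_bounded[OF f l fin] in auto)
  also have "\<dots> \<le> mass f UNIV" by (simp add: mass_mono_set)
  finally show ?thesis .
qed

lemma finite_measure_open_bounded:
  fixes V :: "real set"
  assumes V: "open V" "emeasure lborel V < \<infinity>"
  shows "(\<exists>y>x. y \<notin> V) \<and> (\<exists>y<x. y \<notin> V)"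
proof -
  obtain m where m: "emeasure lborel V = ennreal m" "0 \<le> m" using V(2) by (cases "emeasure lborel V") auto
  have no: "\<not> {a<..<a + m + 1} \<subseteq> V" for a
  proof
    assume "{a<..<a + m + 1} \<subseteq> V"
    then have "emeasure lborel {a<..<a + m + 1} \<le> emeasure lborel V"
      using V(1) by (intro emeasure_mono) auto
    then show False using m by simp
  qed
  have "\<exists>y>x. y \<notin> V" using no[of x] by (metis greaterThanLessThan_iff subsetI)
  moreover have "\<exists>y<x. y \<notin> V" using no[of "x - m - 1"] by (auto simp: subset_iff)
  ultimately show ?thesis by simp
qed

text \<open>The part of the Lebesgue differentiation theorem that is needed later: \<open>f \<le>
l\<close> almost everywhere off the level set. If \<open>f\<close> exceeded \<open>l' > l\<close> on
a set \<open>E\<close> of positive measure outside the level set, then \<open>E\<close> could be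
covered by an open set of nearly the same measure. In each component of this cover the integral of
\<open>f\<close> over \<open>E\<close> is at most \<open>l\<close> times the length, because the
leftmost point of \<open>E\<close> there lies outside the level set.\<close>

lemma exceed_AE:
  assumes f[measurable]: "f \<in> borel_measurable borel" and l: "0 < l" and fin: "mass f UNIV < \<infinity>"
  shows "AE x in lborel. x \<notin> exceed f l \<longrightarrow> f x \<le> l"
proof -
  let ?U = "exceed f l"
  have U[measurable]: "?U \<in> sets borel" using l by (intro exceed_measurable f) auto
  have null: "emeasure lborel (- ?U \<inter> {x. f x > l'}) = 0" if l': "l < l'" for l'
  proof -
    define E where "E = - ?U \<inter> {x. f x > l'}"
    have E[measurable]: "E \<in> sets borel" unfolding E_def by measurable
    have "ennreal l' * emeasure lborel E = mass (\<lambda>_. l') E"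
      using l l' by (simp add: mass_def nn_integral_cmult_indicator)
    also have "\<dots> \<le> mass f E" by (intro mass_mono) (auto simp: E_def)
    finally have El: "ennreal l' * emeasure lborel E \<le> mass f E" .
    also have "mass f E \<le> mass f UNIV" by (simp add: mass_mono_set)
    finally have "ennreal l' * emeasure lborel E < \<infinity>" using fin by (metis le_less_trans)
    then have "emeasure lborel E < \<infinity>" using l l'
      by (auto simp: ennreal_mult_less_top)
    then obtain e where e: "emeasure lborel E = ennreal e" "0 \<le> e" by (cases "emeasure lborel E") auto
    have main: "l' * e \<le> l * (e + d)" if d: "0 < d" for d
    proof -
      obtain V where V: "open V" "E \<subseteq> V" "emeasure lborel (V - E) < ennreal d"
        using outer_regular_lborel[of E d] d by (auto simp: E)
      have [measurable]: "V \<in> sets borel" using V by simp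
      have "emeasure lborel V = emeasure lborel (E \<union> (V - E))" using V(2) by (simp add: Un_absorb1)
      also have "\<dots> = emeasure lborel E + emeasure lborel (V - E)" by (subst plus_emeasure) auto
      also have "\<dots> \<le> ennreal e + ennreal d" using V(3) e by (intro add_mono) auto
      finally have Vle: "emeasure lborel V \<le> ennreal (e + d)" using e d by simp
      then have Vf: "emeasure lborel V < \<infinity>" using ennreal_less_top le_less_trans by fastforce
      have "mass f E = mass (\<lambda>x. f x * indicator E x) V"
        using V(2) by (simp add: mass_indicator Int_absorb1)
      also have "\<dots> \<le> ennreal l * mass (\<lambda>_. 1) V"
      proof (rule mass_le_by_components[OF V(1)])
        fix a b assume ab: "a < b" "{a<..<b} \<subseteq> V" "a \<notin> V" "b \<notin> V"
        show "mass (\<lambda>x. f x * indicator E x) {a<..<b} \<le> ennreal l * mass (\<lambda>_. 1) {a<..<b}"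
        proof (cases "{a<..<b} \<inter> E = {}")
          case True
          then show ?thesis by (simp add: mass_indicator)
        next
          case False
          let ?E = "{a<..<b} \<inter> E"
          define c where "c = Inf ?E"
          have bb: "bdd_below ?E" by (rule bdd_belowI[of _ a]) auto
          have ac: "a \<le> c" unfolding c_def using False by (intro cInf_greatest) auto
          have cb: "c < b" using False cInf_lower[OF _ bb] unfolding c_def by force
          have "c \<in> closure ?E" unfolding c_def using closure_contains_Inf[OF False bb] .
          moreover have "closure ?E \<subseteq> - ?U"
            using open_exceed[OF f, of l] l by (intro closure_minimal) (auto simp: E_def)
          ultimately have cU: "c \<notin> ?U" by auto
          have "mass (\<lambda>x. f x * indicator E x) {a<..<b} \<le> mass f {c..<b}"
            unfolding mass_indicator
            by (intro mass_mono_set) (auto simp: c_def intro!: cInf_lower bb)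
          also have "\<dots> = mass f {c<..<b}" by (simp add: mass_closed_open)
          also have "\<dots> \<le> ennreal (l * (b - c))" using not_exceedD[OF cU] cb by simp
          also have "\<dots> \<le> ennreal (l * (b - a))" using ac l by (intro ennreal_leI) auto
          also have "\<dots> = ennreal l * mass (\<lambda>_. 1) {a<..<b}"
            using ab l by (simp add: mass_const ennreal_mult')
          finally show ?thesis .
        qed
      qed (use finite_measure_open_bounded[OF V(1) Vf] in auto)
      also have "\<dots> = ennreal l * emeasure lborel V" by (simp add: mass_def)
      also have "\<dots> \<le> ennreal l * ennreal (e + d)" using Vle by (intro mult_left_mono) auto
      finally have "ennreal l' * ennreal e \<le> ennreal l * ennreal (e + d)" using El e by (metis order_trans)
      then show ?thesis using e d l l' by (simp add: ennreal_mult[symmetric] del: ennreal_plus)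
    qed
    have "e = 0"
    proof (rule ccontr)
      assume "e \<noteq> 0"
      then have e0: "e > 0" using e by simp
      define P where "P = (l' - l) * e"
      have P: "P > 0" "l' * e = l * e + P" using e0 l' by (auto simp: P_def algebra_simps)
      have "l' * e \<le> l * (e + P / (2 * l))" using main[of "P / (2 * l)"] P l by simp
      also have "\<dots> = l * e + P / 2" using l by (simp add: distrib_left)
      finally show False using P by simp
    qed
    then show ?thesis using e by (simp add: E_def)
  qed
  have "AE x in lborel. \<forall>n::nat. x \<notin> - ?U \<inter> {x. f x > l + 1 / (real n + 1)}"
    unfolding AE_all_countable
  proof
    fix n :: nat
    have "- ?U \<inter> {x. f x > l + 1 / (real n + 1)} \<in> null_sets lborel"
      using null[of "l + 1 / (real n + 1)"] by (intro null_setsI) auto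
    then show "AE x in lborel. x \<notin> - ?U \<inter> {x. f x > l + 1 / (real n + 1)}" by (rule AE_not_in)
  qed
  then show ?thesis
  proof eventually_elim
    case (elim x)
    show ?case
    proof (rule impI, rule field_le_epsilon)
      fix d :: real assume x: "x \<notin> ?U" and d: "0 < d"
      obtain n where n: "1 / (real n + 1) < d" using nat_approx_posE[OF d] by (metis of_nat_Suc add.commute)
      then show "f x \<le> l + d" using elim[rule_format, of n] x by auto
    qed
  qed
qed

section \<open>A reverse Hoelder inequality from level set estimates\<close>

lemma mass_powr:
  assumes "0 < s" "0 < a" "a \<le> b"
  shows "mass (\<lambda>x. s * x powr (s - 1)) {a<..<b} = ennreal (b powr s - a powr s)"
proof -
  have "mass (\<lambda>x. s * x powr (s - 1)) {a<..<b} = mass (\<lambda>x. s * x powr (s - 1)) {a..b}"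
    by (simp add: mass_closed_open)
  also have "\<dots> = ennreal (b powr s - a powr s)"
    unfolding mass_def
    by (rule nn_integral_FTC_Icc) (use assms in \<open>auto intro!: derivative_eq_intros
        simp: has_real_derivative_iff_has_vector_derivative[symmetric]\<close>)
  finally show ?thesis .
qed

lemma mass_powr_0:
  assumes "0 < s" "0 < b"
  shows "mass (\<lambda>x. s * x powr (s - 1)) {0<..<b} = ennreal (b powr s)"
proof (rule antisym)
  show "mass (\<lambda>x. s * x powr (s - 1)) {0<..<b} \<le> ennreal (b powr s)"
  proof (rule ccontr)
    assume "\<not> ?thesis"
    then obtain a where a: "0 < a" "a < b" "ennreal (b powr s) < mass (\<lambda>x. s * x powr (s - 1)) {a<..<b}"
      using mass_approx_left[of "\<lambda>x. s * x powr (s - 1)" "ennreal (b powr s)" 0 b] by (auto simp: not_le)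
    then show False using mass_powr[of s a b] assms by (simp add: ennreal_less_iff)
  qed
  show "ennreal (b powr s) \<le> mass (\<lambda>x. s * x powr (s - 1)) {0<..<b}"
  proof (rule ennreal_le_epsilon)
    fix e :: real assume e: "0 < e"
    define a where "a = min b (e powr (1/s))"
    have a: "0 < a" "a \<le> b" using e assms by (auto simp: a_def)
    have "a powr s \<le> (e powr (1/s)) powr s" using a assms by (intro powr_mono2) (auto simp: a_def)
    also have "\<dots> = e" using e assms by (simp add: powr_powr)
    finally have "ennreal (b powr s) \<le> ennreal ((b powr s - a powr s) + e)"
      by (intro ennreal_leI) simp
    also have "\<dots> = mass (\<lambda>x. s * x powr (s - 1)) {a<..<b} + ennreal e"
      using mass_powr[OF assms(1) a] e a assms by (subst ennreal_plus) (auto intro!: powr_mono2)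
    also have "\<dots> \<le> mass (\<lambda>x. s * x powr (s - 1)) {0<..<b} + ennreal e"
      using a by (intro add_mono mass_mono_set) auto
    finally show "ennreal (b powr s) \<le> mass (\<lambda>x. s * x powr (s - 1)) {0<..<b} + ennreal e" .
  qed
qed

text \<open>Integrating the level estimates against \<open>d l\<^bsup>d - 1\<^esup>\<close> bounds
the integral of \<open>f\<^bsup>1 + d\<^esup>\<close> by \<open>l0\<^bsup>d\<^esup>\<close> times
the integral of \<open>f\<close>, plus \<open>4 d b\<^bsup>- 1 - d\<^esup>\<close> times itself. The
choice of \<open>d\<close> makes the last factor at most \<open>1/2\<close>. Truncating one factor
at height \<open>N\<close> makes the absorbed term finite.\<close>

lemma reverse_holder_from_levels:
  assumes f[measurable]: "f \<in> borel_measurable borel" and f0: "\<And>x. 0 \<le> f x"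
    and fin: "mass f UNIV < \<infinity>" and l0: "0 < l0" and b: "0 < b" "b \<le> 1"
    and d: "d = b\<^sup>2 / 8"
    and lev: "\<And>l. l0 \<le> l \<Longrightarrow> mass f {x. l < f x} \<le> ennreal (4 * l) * emeasure lborel {x. b * l < f x}"
  shows "mass (\<lambda>x. f x powr (1 + d)) UNIV \<le> ennreal (2 * l0 powr d) * mass f UNIV"
proof -
  have d0: "0 < d" unfolding d using b by simp
  have d1: "d \<le> 1" using b d power_le_one[of b 2] by simp
  obtain X where X: "mass f UNIV = ennreal X" "0 \<le> X" using fin by (cases "mass f UNIV") auto
  have trunc: "mass (\<lambda>x. f x * min (f x) N powr d) UNIV \<le> ennreal (2 * l0 powr d * X)" if N: "l0 < N" for N
  proof -
    let ?H = "mass (\<lambda>x. f x * min (f x) N powr d) UNIV"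
    have pw: "ennreal (f x * min (f x) N powr d) \<le>
        ennreal (l0 powr d * f x) +
        (\<integral>\<^sup>+l. (if l0 < l \<and> l < N \<and> l < f x then ennreal (f x * (d * l powr (d - 1))) else 0) \<partial>lborel)" for x
    proof (cases "l0 < f x")
      case True
      then have "(\<integral>\<^sup>+l. (if l0 < l \<and> l < N \<and> l < f x then ennreal (f x * (d * l powr (d - 1))) else 0) \<partial>lborel)
        = (\<integral>\<^sup>+l. ennreal (f x) * (ennreal (d * l powr (d - 1)) * indicator {l0<..<min (f x) N} l) \<partial>lborel)"
        using f0 by (intro nn_integral_cong) (auto simp: ennreal_mult' split: split_indicator)
      also have "\<dots> = ennreal (f x) * mass (\<lambda>l. d * l powr (d - 1)) {l0<..<min (f x) N}"
        unfolding mass_def by (rule nn_integral_cmult) measurable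
      also have "\<dots> = ennreal (f x * (min (f x) N powr d - l0 powr d))"
        using f0 True N d0 l0 by (subst mass_powr) (auto simp: ennreal_mult')
      finally have eq: "(\<integral>\<^sup>+l. (if l0 < l \<and> l < N \<and> l < f x then ennreal (f x * (d * l powr (d - 1))) else 0) \<partial>lborel)
        = ennreal (f x * (min (f x) N powr d - l0 powr d))" .
      have "l0 powr d \<le> min (f x) N powr d" using True N l0 d0 by (intro powr_mono2) auto
      then have "ennreal (l0 powr d * f x) + ennreal (f x * (min (f x) N powr d - l0 powr d))
          = ennreal (f x * min (f x) N powr d)"
        using f0[of x] by (subst ennreal_plus[symmetric])
          (auto simp: right_diff_distrib mult.commute intro!: mult_left_mono)
      then show ?thesis unfolding eq by simp
    next
      case False
      have "min (f x) N powr d \<le> l0 powr d" using False N f0[of x] d0 by (intro powr_mono2) auto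
      then have "ennreal (f x * min (f x) N powr d) \<le> ennreal (l0 powr d * f x)"
        using f0[of x] by (intro ennreal_leI) (simp add: mult.commute mult_left_mono)
      then show ?thesis by (simp add: add_increasing2)
    qed
    have "?H \<le> (\<integral>\<^sup>+x. ennreal (l0 powr d * f x) +
        (\<integral>\<^sup>+l. (if l0 < l \<and> l < N \<and> l < f x then ennreal (f x * (d * l powr (d - 1))) else 0) \<partial>lborel) \<partial>lborel)"
      unfolding mass_def using pw by (intro nn_integral_mono) simp
    also have "\<dots> = mass (\<lambda>x. l0 powr d * f x) UNIV +
        (\<integral>\<^sup>+x. \<integral>\<^sup>+l. (if l0 < l \<and> l < N \<and> l < f x then ennreal (f x * (d * l powr (d - 1))) else 0) \<partial>lborel \<partial>lborel)"
      by (subst nn_integral_add) (auto simp: mass_def)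
    also have "(\<integral>\<^sup>+x. \<integral>\<^sup>+l. (if l0 < l \<and> l < N \<and> l < f x then ennreal (f x * (d * l powr (d - 1))) else 0) \<partial>lborel \<partial>lborel)
       = (\<integral>\<^sup>+l. \<integral>\<^sup>+x. (if l0 < l \<and> l < N \<and> l < f x then ennreal (f x * (d * l powr (d - 1))) else 0) \<partial>lborel \<partial>lborel)"
      by (rule lborel_pair.Fubini'[symmetric]) measurable
    also have "\<dots> \<le> (\<integral>\<^sup>+l. \<integral>\<^sup>+x. (if l0 < l \<and> l < N \<and> b * l < f x then ennreal (4 * d * l powr d) else 0) \<partial>lborel \<partial>lborel)"
    proof (rule nn_integral_mono)
      fix l
      show "(\<integral>\<^sup>+x. (if l0 < l \<and> l < N \<and> l < f x then ennreal (f x * (d * l powr (d - 1))) else 0) \<partial>lborel)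
        \<le> (\<integral>\<^sup>+x. (if l0 < l \<and> l < N \<and> b * l < f x then ennreal (4 * d * l powr d) else 0) \<partial>lborel)"
      proof (cases "l0 < l \<and> l < N")
        case True
        have "(\<integral>\<^sup>+x. (if l0 < l \<and> l < N \<and> l < f x then ennreal (f x * (d * l powr (d - 1))) else 0) \<partial>lborel)
          = (\<integral>\<^sup>+x. ennreal (d * l powr (d - 1)) * (ennreal (f x) * indicator {x. l < f x} x) \<partial>lborel)"
          using f0 True d0 by (intro nn_integral_cong) (auto simp: ennreal_mult' mult.commute split: split_indicator)
        also have "\<dots> = ennreal (d * l powr (d - 1)) * mass f {x. l < f x}"
          unfolding mass_def by (rule nn_integral_cmult) measurable
        also have "\<dots> \<le> ennreal (d * l powr (d - 1)) * (ennreal (4 * l) * emeasure lborel {x. b * l < f x})"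
          using lev[of l] True by (intro mult_left_mono) auto
        also have "\<dots> = ennreal (4 * d * l powr d) * emeasure lborel {x. b * l < f x}"
        proof -
          have eq: "d * l powr (d - 1) * (4 * l) = 4 * d * l powr d"
            using True l0 powr_mult_base[of l "d - 1"] by (simp add: mult.commute)
          then have "ennreal (d * l powr (d - 1)) * ennreal (4 * l) = ennreal (4 * d * l powr d)"
            unfolding eq[symmetric] using d0 by (intro ennreal_mult'[symmetric]) simp
          then show ?thesis by (simp only: mult.assoc[symmetric])
        qed
        also have "\<dots> = (\<integral>\<^sup>+x. ennreal (4 * d * l powr d) * indicator {x. b * l < f x} x \<partial>lborel)"
          by (subst nn_integral_cmult_indicator) auto
        also have "\<dots> = (\<integral>\<^sup>+x. (if l0 < l \<and> l < N \<and> b * l < f x then ennreal (4 * d * l powr d) else 0) \<partial>lborel)"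
          using True by (intro nn_integral_cong) (auto split: split_indicator)
        finally show ?thesis .
      next
        case False
        then show ?thesis by (intro nn_integral_mono) auto
      qed
    qed
    also have "\<dots> = (\<integral>\<^sup>+x. \<integral>\<^sup>+l. (if l0 < l \<and> l < N \<and> b * l < f x then ennreal (4 * d * l powr d) else 0) \<partial>lborel \<partial>lborel)"
      by (rule lborel_pair.Fubini') measurable
    also have "\<dots> \<le> (\<integral>\<^sup>+x. ennreal (1/2) * ennreal (f x * min (f x) N powr d) \<partial>lborel)"
    proof (intro nn_integral_mono)
      fix x
      let ?m = "min N (f x / b)"
      show "(\<integral>\<^sup>+l. (if l0 < l \<and> l < N \<and> b * l < f x then ennreal (4 * d * l powr d) else 0) \<partial>lborel)
        \<le> ennreal (1/2) * ennreal (f x * min (f x) N powr d)"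
      proof (cases "l0 < ?m")
        case True
        have "(\<integral>\<^sup>+l. (if l0 < l \<and> l < N \<and> b * l < f x then ennreal (4 * d * l powr d) else 0) \<partial>lborel)
          \<le> mass (\<lambda>l. (4 * d) * ((1 + d) * l powr ((1 + d) - 1))) {l0<..<?m}"
          unfolding mass_def
        proof (intro nn_integral_mono)
          fix l
          have "4 * d * l powr d \<le> 4 * d * ((1 + d) * l powr d)"
            using d0 by (intro mult_left_mono) (auto simp: distrib_right)
          then show "(if l0 < l \<and> l < N \<and> b * l < f x then ennreal (4 * d * l powr d) else 0)
            \<le> ennreal ((4 * d) * ((1 + d) * l powr ((1 + d) - 1))) * indicator {l0<..<?m} l"
            using b by (auto simp: field_simps intro!: ennreal_leI split: split_indicator)
        qed
        also have "\<dots> = ennreal (4 * d) * ennreal (?m powr (1 + d) - l0 powr (1 + d))"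
        proof -
          have eq: "mass (\<lambda>l. (1 + d) * l powr ((1 + d) - 1)) {l0<..<?m}
              = ennreal (?m powr (1 + d) - l0 powr (1 + d))"
            by (rule mass_powr) (use d0 l0 True in auto)
          show ?thesis unfolding eq[symmetric] by (rule mass_cmult) (use d0 in auto)
        qed
        also have "\<dots> \<le> ennreal (4 * d) * ennreal (?m powr (1 + d))"
          by (intro mult_left_mono ennreal_leI) auto
        also have "\<dots> = ennreal (4 * d * ?m powr (1 + d))" using d0 by (simp add: ennreal_mult')
        also have "\<dots> \<le> ennreal (1/2 * (f x * min (f x) N powr d))"
        proof (rule ennreal_leI)
          have fx: "0 < f x" using True l0 b f0[of x] by (cases "f x = 0") (auto simp: less_le)
          have N0: "0 < N" using N l0 by simp
          have "N \<le> N / b" using b N0 by (simp add: le_divide_eq mult_left_le)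
          then have "?m \<le> min (f x) N / b" by (cases "f x \<le> N") (auto simp: min_absorb1 min_absorb2)
          then have "?m powr (1 + d) \<le> (min (f x) N / b) powr (1 + d)"
            using True l0 d0 by (intro powr_mono2) auto
          also have "\<dots> = min (f x) N powr (1 + d) / b powr (1 + d)" using fx N0 b by (simp add: powr_divide)
          also have "\<dots> \<le> min (f x) N powr (1 + d) / b powr 2"
            using b d1 by (intro divide_left_mono powr_mono') (auto)
          also have "min (f x) N powr (1 + d) = min (f x) N * min (f x) N powr d"
            using fx N0 by (simp add: powr_add)
          also have "\<dots> \<le> f x * min (f x) N powr d" by (intro mult_right_mono) auto
          finally have "?m powr (1 + d) \<le> f x * min (f x) N powr d / b\<^sup>2" 
            using b by (simp add: divide_right_mono)
          then have "4 * d * ?m powr (1 + d) \<le> 4 * d * (f x * min (f x) N powr d / b\<^sup>2)"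
            using d0 by (intro mult_left_mono) auto
          also have "\<dots> = 1/2 * (f x * min (f x) N powr d)" using b by (simp add: d)
          finally show "4 * d * ?m powr (1 + d) \<le> 1/2 * (f x * min (f x) N powr d)" .
        qed
        also have "\<dots> = ennreal (1/2) * ennreal (f x * min (f x) N powr d)" by (rule ennreal_mult') simp
        finally show ?thesis .
      next
        case False
        have "\<not> (l0 < l \<and> l < N \<and> b * l < f x)" for l
        proof
          assume l: "l0 < l \<and> l < N \<and> b * l < f x"
          then have "l < f x / b" using b by (simp add: pos_less_divide_eq mult.commute)
          then show False using False l by simp
        qed
        then have "(\<integral>\<^sup>+l. (if l0 < l \<and> l < N \<and> b * l < f x then ennreal (4 * d * l powr d) else 0) \<partial>lborel)
          = (\<integral>\<^sup>+l. 0 \<partial>(lborel :: real measure))" by (intro nn_integral_cong) auto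
        then show ?thesis by simp
      qed
    qed
    also have "\<dots> = ennreal (1/2) * ?H"
      unfolding mass_def by (subst nn_integral_cmult) auto
    finally have Hle: "?H \<le> ennreal (l0 powr d) * ennreal X + ennreal (1/2) * ?H"
      using X f by (simp add: mass_cmult add_mono)
    have "?H \<le> mass (\<lambda>x. N powr d * f x) UNIV"
    proof (rule mass_mono)
      fix x
      have "min (f x) N powr d \<le> N powr d" using f0[of x] N l0 d0 by (intro powr_mono2) auto
      then show "f x * min (f x) N powr d \<le> N powr d * f x"
        using f0[of x] by (simp add: mult.commute mult_left_mono)
    qed
    also have "\<dots> = ennreal (N powr d) * ennreal X" using f X by (simp add: mass_cmult)
    finally have "?H < \<infinity>" by (simp add: ennreal_mult'[symmetric] le_less_trans)
    then obtain h where h: "?H = ennreal h" "0 \<le> h" by (cases ?H) auto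
    have "ennreal (l0 powr d * X) = ennreal (l0 powr d) * ennreal X"
      by (rule ennreal_mult') (rule powr_ge_zero)
    moreover have "ennreal (1/2 * h) = ennreal (1/2) * ennreal h" by (rule ennreal_mult') simp
    moreover have "ennreal (l0 powr d * X + 1/2 * h) = ennreal (l0 powr d * X) + ennreal (1/2 * h)"
      by (rule ennreal_plus) (use h X in auto)
    ultimately have "ennreal h \<le> ennreal (l0 powr d * X + 1/2 * h)"
      using Hle unfolding h(1) by (simp only:)
    then have "h \<le> l0 powr d * X + 1/2 * h" using h X by (subst (asm) ennreal_le_iff) auto
    then show ?thesis using h by (auto intro!: ennreal_leI)
  qed
  let ?F = "\<lambda>n::nat. \<lambda>x. ennreal (f x * min (f x) (real n) powr d)"
  have inc: "incseq ?F"
    by (intro monoI le_funI ennreal_leI mult_left_mono powr_mono2) (use f0 d0 in auto)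
  have "(SUP n. ?F n x) = ennreal (f x powr (1 + d))" for x
  proof (rule antisym)
    show "(SUP n. ?F n x) \<le> ennreal (f x powr (1 + d))"
    proof (intro SUP_least ennreal_leI)
      fix n
      have "f x * min (f x) (real n) powr d \<le> f x * f x powr d"
        using f0[of x] d0 by (intro mult_left_mono powr_mono2) auto
      also have "\<dots> = f x powr (1 + d)" using f0[of x] by (cases "f x = 0") (auto simp: powr_add)
      finally show "f x * min (f x) (real n) powr d \<le> f x powr (1 + d)" .
    qed
    obtain n :: nat where n: "f x \<le> real n" using real_arch_simple by blast
    have "f x * f x powr d = f x powr (1 + d)" using f0[of x] by (cases "f x = 0") (auto simp: powr_add)
    then have eq: "?F n x = ennreal (f x powr (1 + d))" using n by (simp only: min_absorb1)
    have "?F n x \<le> (SUP n. ?F n x)" by (rule SUP_upper) simp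
    then show "ennreal (f x powr (1 + d)) \<le> (SUP n. ?F n x)" by (simp only: eq)
  qed
  then have "mass (\<lambda>x. f x powr (1 + d)) UNIV = (\<integral>\<^sup>+x. (SUP n. ?F n x) \<partial>lborel)"
    by (simp add: mass_def)
  also have "\<dots> = (SUP n. \<integral>\<^sup>+x. ?F n x \<partial>lborel)"
    by (rule nn_integral_monotone_convergence_SUP[OF inc]) measurable
  also have "\<dots> \<le> ennreal (2 * l0 powr d * X)"
  proof (rule SUP_least)
    fix n :: nat
    obtain m :: nat where m: "l0 < real m" using reals_Archimedean2 by blast
    have "(\<integral>\<^sup>+x. ?F n x \<partial>lborel) \<le> (\<integral>\<^sup>+x. ?F (max n m) x \<partial>lborel)"
      using monoD[OF inc, of n "max n m"] by (intro nn_integral_mono) (auto simp: le_fun_def)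
    also have "\<dots> \<le> ennreal (2 * l0 powr d * X)"
      using trunc[of "real (max n m)"] m by (simp add: mass_def)
    finally show "(\<integral>\<^sup>+x. ?F n x \<partial>lborel) \<le> ennreal (2 * l0 powr d * X)" .
  qed
  finally show ?thesis using X by (simp add: ennreal_mult')
qed

section \<open>The one-sided Muckenhoupt condition and its self-improvement\<close>

text \<open>The one-sided Muckenhoupt condition with exponent \<open>r = p - 1\<close> and constant
\<open>A\<close> for a pair of weights \<open>W\<close> (on the left) and \<open>S\<close> (on the
right). It is stated through real lower bounds \<open>u\<close> and \<open>v\<close> of the two
integrals, which covers infinite integrals with the convention \<open>0 \<cdot> \<infinity> =
0\<close>.\<close>

definition two_weight :: "real \<Rightarrow> real \<Rightarrow> (real \<Rightarrow> real) \<Rightarrow> (real \<Rightarrow> real) \<Rightarrow> bool" where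
  "two_weight r A W S \<longleftrightarrow> (\<forall>a b c u v. a < b \<longrightarrow> b < c \<longrightarrow> 0 \<le> u \<longrightarrow> 0 \<le> v \<longrightarrow>
     ennreal u \<le> mass W {a<..<b} \<longrightarrow> ennreal v \<le> mass S {b<..<c} \<longrightarrow>
     u * v powr r \<le> A * (c - a) powr (1 + r))"

text \<open>The same condition, required only when the two intervals are separated by a gap of at
least a quarter of the total length.\<close>

definition two_weight_gap :: "real \<Rightarrow> real \<Rightarrow> (real \<Rightarrow> real) \<Rightarrow> (real \<Rightarrow> real) \<Rightarrow> bool" where
  "two_weight_gap r A W S \<longleftrightarrow> (\<forall>a b c d u v. a < b \<longrightarrow> b < c \<longrightarrow> c < d \<longrightarrow> d - a \<le> 4 * (c - b) \<longrightarrow>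
     0 \<le> u \<longrightarrow> 0 \<le> v \<longrightarrow>
     ennreal u \<le> mass W {a<..<b} \<longrightarrow> ennreal v \<le> mass S {c<..<d} \<longrightarrow>
     u * v powr r \<le> A * (d - a) powr (1 + r))"

lemma two_weightD:
  "two_weight r A W S \<Longrightarrow> a < b \<Longrightarrow> b < c \<Longrightarrow> 0 \<le> u \<Longrightarrow> 0 \<le> v \<Longrightarrow>
     ennreal u \<le> mass W {a<..<b} \<Longrightarrow> ennreal v \<le> mass S {b<..<c} \<Longrightarrow>
     u * v powr r \<le> A * (c - a) powr (1 + r)"
  unfolding two_weight_def by blast

lemma two_weight_const_nonneg: "two_weight r A W S \<Longrightarrow> 0 \<le> A"
  using two_weightD[of r A W S 0 1 2 0 0] by (simp add: zero_le_mult_iff)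

lemma two_weight_finite:
  assumes "two_weight r A W S" "0 < r" "a < b" "b < c" "0 < u" "ennreal u \<le> mass W {a<..<b}"
  shows "mass S {b<..<c} < \<infinity>"
proof (rule ccontr)
  assume "\<not> ?thesis"
  then have top: "mass S {b<..<c} = \<infinity>" by (simp add: less_top[symmetric])
  define K where "K = A * (c - a) powr (1 + r)"
  have K: "0 \<le> K" using two_weight_const_nonneg[OF assms(1)] by (simp add: K_def)
  define v where "v = ((K + 1) / u) powr (1 / r)"
  have "u * v powr r \<le> K"
    unfolding K_def by (rule two_weightD[OF assms(1)]) (use assms top in \<open>auto simp: v_def\<close>)
  moreover have "v powr r = (K + 1) / u" using assms K by (simp add: v_def powr_powr)
  ultimately show False using assms by simp
qed

text \<open>A positive weight \<open>w\<close> on an interval \<open>J\<close> that satisfies the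
one-sided Muckenhoupt condition for the exponent \<open>1 + r\<close>. Both weights are extended by
zero to the real line; the values of \<open>w\<close> outside \<open>J\<close> play no role.\<close>

locale one_sided_weight =
  fixes J :: "real set" and w :: "real \<Rightarrow> real" and r A :: real
  assumes J[measurable]: "J \<in> sets borel" and iv: "is_interval J"
    and w[measurable]: "w \<in> borel_measurable borel" and wpos: "\<And>x. 0 < w x"
    and r: "0 < r"
    and A: "two_weight r A (\<lambda>x. w x * indicator J x) (\<lambda>x. w x powr (-1/r) * indicator J x)"
begin

text \<open>The weight \<open>W\<close> and the dual weight \<open>S\<close>, both extended by
zero.\<close>

abbreviation W :: "real \<Rightarrow> real" where "W \<equiv> \<lambda>x. w x * indicator J x"
abbreviation S :: "real \<Rightarrow> real" where "S \<equiv> \<lambda>x. w x powr (-1/r) * indicator J x"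

lemma A0: "0 \<le> A" using two_weight_const_nonneg[OF A] .

text \<open>On a component \<open>(a, c)\<close> of the level set the average of \<open>f\<close>
equals \<open>l\<close>, and the right half carries at least half of the integral. By the
Muckenhoupt condition for the two halves, the set in the left half on which \<open>f \<le> b
l\<close>, that is, on which \<open>w\<close> is large, has at most half of the measure of that
half. Hence \<open>f > b l\<close> on at least a quarter of the component.\<close>

lemma level_estimate:
  fixes t d b l
  defines "f \<equiv> (\<lambda>x. S x * indicator {t<..<d} x)"
  assumes t: "t \<in> J" and fin: "mass f UNIV < \<infinity>" and l: "0 < l" and tl: "t \<notin> exceed f l"
    and b: "0 < b" "A * (2 * b) powr r \<le> 1/4"
  shows "mass f {x. l < f x} \<le> ennreal (4 * l) * emeasure lborel {x. b * l < f x}"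
proof -
  have f[measurable]: "f \<in> borel_measurable borel" unfolding f_def by measurable
  have f0: "0 \<le> f x" for x unfolding f_def by (auto split: split_indicator)
  let ?U = "exceed f l"
  have oU: "open ?U" using open_exceed[OF f] l by simp
  \<comment> \<open>since \<open>t\<close> is outside the level set and \<open>f\<close> vanishes off \<open>J\<close>, the level set lies to the right of \<open>t\<close> and inside \<open>J\<close>\<close>
  have UtdJ: "t < x \<and> x < d \<and> x \<in> J" if x: "x \<in> ?U" for x
  proof -
    obtain y where y: "x < y" "ennreal (l * (y - x)) < mass f {x<..<y}"
      using x by (auto simp: exceed_def)
    have tx: "t < x"
    proof (rule ccontr)
      assume "\<not> ?thesis"
      then have xt: "x \<le> t" by simp
      have "mass f {x<..<y} = mass f ({x<..<y} \<inter> {t<..<d})"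
        unfolding mass_indicator[symmetric] by (intro mass_cong) (auto simp: f_def split: split_indicator)
      also have "\<dots> \<le> mass f {t<..<max t y}" by (intro mass_mono_set) auto
      also have "\<dots> \<le> ennreal (l * (max t y - t))" by (rule not_exceedD[OF tl]) simp
      also have "\<dots> \<le> ennreal (l * (y - x))" using l xt y(1) by (intro ennreal_leI) auto
      finally show False using y by simp
    qed
    have "mass f {x<..<y} \<noteq> 0" using y(2) by (metis not_less_zero)
    then obtain z where z: "z \<in> {x<..<y}" "f z \<noteq> 0" using mass_eq_0[of "{x<..<y}" f] by blast
    then have "z \<in> J" "z < d" by (auto simp: f_def split: split_indicator_asm)
    then show ?thesis using tx z t mem_is_interval_1_I[OF iv, of t z x] by auto
  qed
  have "mass f {x. l < f x} \<le> mass f ?U"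
    unfolding mass_def
    by (rule nn_integral_mono_AE, use exceed_AE[OF f l fin] in eventually_elim) (auto split: split_indicator)
  also have "\<dots> \<le> ennreal (4 * l) * mass (indicator {x. b * l < f x}) ?U"
  proof (rule mass_le_by_components[OF oU f])
    fix a c assume ac: "a < c" "{a<..<c} \<subseteq> ?U" "a \<notin> ?U" "c \<notin> ?U"
    define m where "m = (a + c) / 2"
    have m: "a < m" "m < c" "c - m = (c - a)/2" "m - a = (c - a)/2" using ac by (auto simp: m_def field_simps)
    have up: "mass f {a<..<c} \<le> ennreal (l * (c - a))" using not_exceedD[OF ac(3)] ac(1) by simp
    have lo: "ennreal (l * (c - m)) \<le> mass f {m<..<c}"
      by (rule rising_sun[OF f l fin]) (use ac m in auto)
    let ?E = "{a<..<m} \<inter> {x. f x \<le> b * l}" and ?G = "{a<..<m} \<inter> {x. b * l < f x}"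
    have "emeasure lborel ?E \<le> emeasure lborel {a<..<m}" by (rule emeasure_mono) auto
    then have "emeasure lborel ?E < \<infinity>" using m by (auto simp: le_less_trans)
    then obtain e where e: "emeasure lborel ?E = ennreal e" "0 \<le> e" by (cases "emeasure lborel ?E") auto
    have "ennreal (e * (b * l) powr (-r)) = mass (\<lambda>_. (b * l) powr (-r)) ?E"
      using e by (simp add: mass_def nn_integral_cmult_indicator ennreal_mult' mult.commute)
    also have "\<dots> \<le> mass W ?E"
    proof (rule mass_mono)
      fix x assume x: "x \<in> ?E"
      then have "x \<in> ?U" using ac m by auto
      then have xx: "t < x" "x < d" "x \<in> J" using UtdJ by auto
      then have "w x powr (-1/r) \<le> b * l" using x by (simp add: f_def)
      then have "(w x powr (-1/r)) powr (-r) \<ge> (b * l) powr (-r)"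
        using r wpos[of x] by (intro powr_mono2') auto
      then show "(b * l) powr (-r) \<le> W x" using xx r wpos[of x] by (simp add: powr_powr)
    qed
    also have "\<dots> \<le> mass W {a<..<m}" by (intro mass_mono_set) auto
    finally have u: "ennreal (e * (b * l) powr (-r)) \<le> mass W {a<..<m}" .
    have v: "ennreal (l * (c - m)) \<le> mass S {m<..<c}"
      using lo mass_mono[of "{m<..<c}" f S] by (force simp: f_def split: split_indicator)
    have "e * (b * l) powr (-r) * (l * (c - m)) powr r \<le> A * (c - a) powr (1 + r)"
      by (rule two_weightD[OF A m(1,2) _ _ u v]) (use e l m in auto)
    moreover have "(b * l) powr (-r) * (l * (c - m)) powr r = (c - a) powr r / (2 * b) powr r"
    proof -
      have "l * (c - m) = (b * l) * ((c - a) / (2 * b))" using m(3) b(1) by simp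
      then have "(l * (c - m)) powr r = (b * l) powr r * ((c - a) powr r / (2 * b) powr r)"
        using b(1) l ac by (simp only: powr_mult powr_divide)
      moreover have "(b * l) powr (-r) * (b * l) powr r = 1" using b(1) l by (simp add: powr_minus)
      ultimately show ?thesis by (metis mult.assoc mult_1)
    qed
    moreover have "(c - a) powr (1 + r) = (c - a) * (c - a) powr r" using ac by (simp add: powr_add)
    ultimately have "e * ((c - a) powr r / (2 * b) powr r) \<le> A * ((c - a) * (c - a) powr r)"
      by (metis mult.assoc)
    moreover have "0 < (2 * b) powr r" using b(1) by simp
    ultimately have "e * (c - a) powr r \<le> (A * (2 * b) powr r) * (c - a) * (c - a) powr r"
      by (simp add: pos_divide_le_eq mult_ac)
    then have "e \<le> (A * (2 * b) powr r) * (c - a)" using ac by (simp add: mult_le_cancel_right)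
    also have "\<dots> \<le> 1/4 * (c - a)" using b ac by (intro mult_right_mono) auto
    finally have e4: "e \<le> (c - a) / 4" by simp
    have "?E \<union> ?G = {a<..<m}" by auto
    then have "ennreal ((c - a)/2) = emeasure lborel (?E \<union> ?G)" using m by simp
    also have "\<dots> = ennreal e + emeasure lborel ?G" using e by (subst plus_emeasure[symmetric]) auto
    also have "\<dots> \<le> ennreal ((c - a)/4) + emeasure lborel ?G" using e4 by (intro add_mono ennreal_leI) auto
    finally have "ennreal ((c - a)/4) + ennreal ((c - a)/4) \<le> ennreal ((c - a)/4) + emeasure lborel ?G"
      using ac by (subst ennreal_plus[symmetric]) auto
    then have G: "ennreal ((c - a)/4) \<le> emeasure lborel ?G"
      by (simp add: ennreal_add_left_cancel_le)
    have "mass f {a<..<c} \<le> ennreal (4 * l) * ennreal ((c - a)/4)"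
      using up l ac by (simp add: ennreal_mult'[symmetric])
    also have "\<dots> \<le> ennreal (4 * l) * emeasure lborel ?G" using G by (intro mult_left_mono) auto
    also have "emeasure lborel ?G \<le> mass (indicator {x. b * l < f x}) {a<..<c}"
    proof -
      have "emeasure lborel ?G = (\<integral>\<^sup>+x. indicator ?G x \<partial>lborel)" by simp
      also have "\<dots> \<le> mass (indicator {x. b * l < f x}) {a<..<c}"
        unfolding mass_def using m by (intro nn_integral_mono) (auto split: split_indicator)
      finally show ?thesis .
    qed
    finally show "mass f {a<..<c} \<le> ennreal (4 * l) * mass (indicator {x. b * l < f x}) {a<..<c}"
      by (simp add: mult_left_mono)
  qed (use exceed_bounded[OF f l fin] in auto)
  also have "mass (indicator {x. b * l < f x}) ?U \<le> emeasure lborel {x. b * l < f x}"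
  proof -
    have "mass (indicator {x. b * l < f x}) ?U \<le> (\<integral>\<^sup>+x. indicator {x. b * l < f x} x \<partial>lborel)"
      unfolding mass_def by (intro nn_integral_mono) (auto split: split_indicator)
    then show ?thesis by simp
  qed
  finally show ?thesis by (simp add: mult_left_mono)
qed

text \<open>The exponent \<open>1 + r\<close> can be lowered if a gap between the intervals is
allowed. The reverse Hoelder inequality holds on \<open>(t, x4)\<close> for each \<open>t\<close> at
which the maximal function of the dual weight is controlled. By the weak type \<open>(1,1)\<close>
inequality the gap contains a point \<open>t\<close> at which it is at most a multiple of the
average.\<close>

lemma exists_gap_improvement:
  obtains e B where "0 < e" "0 \<le> B"
    "two_weight_gap (r / (1 + e)) B W (\<lambda>x. w x powr (-1 / (r / (1 + e))) * indicator J x)"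
proof -
  define b where "b = min 1 ((1 / (4 * (A + 1))) powr (1/r) / 2)"
  have b: "0 < b" "b \<le> 1" using A0 by (auto simp: b_def)
  have bA: "A * (2 * b) powr r \<le> 1/4"
  proof -
    have "(2 * b) powr r \<le> ((1 / (4 * (A + 1))) powr (1/r)) powr r"
      using b r by (intro powr_mono2) (auto simp: b_def)
    also have "\<dots> = 1 / (4 * (A + 1))" using r A0 by (simp add: powr_powr)
    finally have "A * (2 * b) powr r \<le> A * (1 / (4 * (A + 1)))" using A0 by (intro mult_left_mono) auto
    also have "\<dots> \<le> 1/4" using A0 by (simp add: field_simps)
    finally show ?thesis .
  qed
  define e where "e = b\<^sup>2 / 8"
  have e: "0 < e" using b by (simp add: e_def)
  define r' where "r' = r / (1 + e)"
  have r': "0 < r'" "r' * (1 + e) = r" using r e by (auto simp: r'_def)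
  define B where "B = (2 * 8 powr e) powr r' * A"
  have B: "0 \<le> B" using A0 by (simp add: B_def)
  let ?T = "\<lambda>x. w x powr (-1 / r') * indicator J x"
  have TS: "?T x = S x powr (1 + e)" for x
  proof -
    have "(-1/r) * (1 + e) = -1/r'" using r r' by (simp add: field_simps)
    then show ?thesis using wpos[of x] by (auto simp: powr_powr split: split_indicator)
  qed
  have [measurable]: "?T \<in> borel_measurable borel" by measurable
  have "two_weight_gap r' B W ?T"
    unfolding two_weight_gap_def
  proof (intro allI impI)
    fix x1 x2 x3 x4 u v :: real
    assume x: "x1 < x2" "x2 < x3" "x3 < x4" "x4 - x1 \<le> 4 * (x3 - x2)" and u0: "0 \<le> u" and v0: "0 \<le> v"
      and u: "ennreal u \<le> mass W {x1<..<x2}" and v: "ennreal v \<le> mass ?T {x3<..<x4}"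
    show "u * v powr r' \<le> B * (x4 - x1) powr (1 + r')"
    proof (cases "u = 0 \<or> v = 0")
      case True
      then show ?thesis using B by auto
    next
      case False
      then have uv: "0 < u" "0 < v" using u0 v0 by auto
      have "mass W {x1<..<x2} \<noteq> 0" using u uv by auto
      then obtain y1 where "y1 \<in> {x1<..<x2}" "(W) y1 \<noteq> 0" using mass_eq_0[of "{x1<..<x2}" W] by blast
      then have y1: "y1 \<in> J" "x1 < y1" "y1 < x2" by (auto split: split_indicator_asm)
      have "mass ?T {x3<..<x4} \<noteq> 0" using v uv by auto
      then obtain y2 where "y2 \<in> {x3<..<x4}" "(?T) y2 \<noteq> 0" using mass_eq_0[of "{x3<..<x4}" ?T] by blast
      then have y2: "y2 \<in> J" "x3 < y2" "y2 < x4" by (auto split: split_indicator_asm)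
      have Jb: "y \<in> J" if "x2 \<le> y" "y \<le> x3" for y
        using mem_is_interval_1_I[OF iv y1(1) y2(1), of y] y1 y2 that by auto
      have Xf: "mass S {x2<..<x4} < \<infinity>" using two_weight_finite[OF A r, of x1 x2 x4 u] x uv u by auto
      then obtain X where X: "mass S {x2<..<x4} = ennreal X" "0 \<le> X"
        by (cases "mass S {x2<..<x4}") auto
      have "X \<noteq> 0"
      proof
        assume "X = 0"
        then have "mass S {x3<..<x4} = 0"
          using X mass_mono_set[of "{x3<..<x4}" "{x2<..<x4}" S] x by (auto simp: subset_iff)
        then have "AE z in lborel. ennreal (S z) * indicator {x3<..<x4} z = 0"
          unfolding mass_def by (subst (asm) nn_integral_0_iff_AE) auto
        then have "AE z in lborel. ennreal (?T z) * indicator {x3<..<x4} z = 0"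
          by eventually_elim (use wpos in \<open>auto split: split_indicator simp: less_le\<close>)
        then have "mass ?T {x3<..<x4} = 0"
          unfolding mass_def by (subst nn_integral_0_iff_AE) auto
        then show False using v uv by simp
      qed
      then have X0: "0 < X" using X by simp
      \<comment> \<open>at this level the level set has at most half the length of the gap\<close>
      define l0 where "l0 = 2 * X / (x3 - x2)"
      have l0: "0 < l0" using X0 x by (simp add: l0_def)
      let ?g = "\<lambda>z. S z * indicator {x2<..<x4} z"
      have g[measurable]: "?g \<in> borel_measurable borel" by measurable
      have gm: "mass ?g UNIV = ennreal X" using X by (subst mass_indicator) simp
      then have gf: "mass ?g UNIV < \<infinity>" by simp
      have "ennreal l0 * emeasure lborel (exceed ?g l0) \<le> ennreal X"
        using exceed_weak_type_1[OF g l0 gf] gm by simp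
      have "\<exists>t. t \<in> {x2<..<x3} \<and> t \<notin> exceed ?g l0"
      proof (rule ccontr)
        assume "\<not> ?thesis"
        then have "{x2<..<x3} \<subseteq> exceed ?g l0" by blast
        then have "emeasure lborel {x2<..<x3} \<le> emeasure lborel (exceed ?g l0)"
          using l0 by (intro emeasure_mono) (auto intro!: exceed_measurable g)
        then have "ennreal l0 * ennreal (x3 - x2) \<le> ennreal l0 * emeasure lborel (exceed ?g l0)"
          using x by (intro mult_left_mono) auto
        also have "\<dots> \<le> ennreal X" by fact
        finally have "l0 * (x3 - x2) \<le> X" using l0 x X by (simp add: ennreal_mult'[symmetric])
        then show False using X0 x by (simp add: l0_def)
      qed
      then obtain t where t: "x2 < t" "t < x3" "t \<notin> exceed ?g l0" by auto
      have tJ: "t \<in> J" using Jb t by auto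
      let ?f = "\<lambda>z. S z * indicator {t<..<x4} z"
      have f[measurable]: "?f \<in> borel_measurable borel" by measurable
      have fg: "?f z \<le> ?g z" for z using t by (auto split: split_indicator)
      have fX: "mass ?f UNIV \<le> ennreal X" using mass_mono[of UNIV ?f ?g] fg gm by simp
      then have ff: "mass ?f UNIV < \<infinity>" by (simp add: le_less_trans)
      have lev: "mass ?f {z. l < ?f z} \<le> ennreal (4 * l) * emeasure lborel {z. b * l < ?f z}"
        if l: "l0 \<le> l" for l
      proof (rule level_estimate[OF tJ ff _ _ b(1) bA])
        show "0 < l" using l l0 by simp
        show "t \<notin> exceed ?f l"
        proof
          assume "t \<in> exceed ?f l"
          then obtain y where y: "t < y" "ennreal (l * (y - t)) < mass ?f {t<..<y}" by (auto simp: exceed_def)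
          have "mass ?f {t<..<y} \<le> mass ?g {t<..<y}" using fg by (intro mass_mono)
          also have "\<dots> \<le> ennreal (l0 * (y - t))" using not_exceedD[OF t(3)] y(1) by simp
          also have "\<dots> \<le> ennreal (l * (y - t))" using l y(1) by (intro ennreal_leI mult_right_mono) auto
          finally show False using y(2) by simp
        qed
      qed
      have f0: "0 \<le> ?f z" for z by (auto split: split_indicator)
      have "ennreal v \<le> mass ?T {x3<..<x4}" by (rule v)
      also have "\<dots> \<le> mass (\<lambda>z. ?f z powr (1 + e)) UNIV"
        unfolding mass_def
      proof (rule nn_integral_mono)
        fix z
        show "ennreal (?T z) * indicator {x3<..<x4} z \<le> ennreal (?f z powr (1 + e)) * indicator UNIV z"
        proof (cases "z \<in> {x3<..<x4}")
          case True
          then have "?f z = S z" using t by simp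
          then show ?thesis using True TS[of z] by (simp only: indicator_UNIV indicator_simps mult_1_right order_refl)
        qed simp
      qed
      also have "\<dots> \<le> ennreal (2 * l0 powr e) * mass ?f UNIV"
        using reverse_holder_from_levels[OF f f0 ff l0 b e_def lev] by simp
      also have "\<dots> \<le> ennreal (2 * l0 powr e) * ennreal X" using fX by (intro mult_left_mono) auto
      also have "\<dots> = ennreal (2 * l0 powr e * X)" using X by (simp add: ennreal_mult')
      finally have vX: "v \<le> 2 * l0 powr e * X" using X0 l0 by simp
      define D where "D = x4 - x1"
      have D: "0 < D" using x by (simp add: D_def)
      have "l0 \<le> 8 * X / D"
      proof -
        have "X * D \<le> X * (4 * (x3 - x2))" using X0 x by (intro mult_left_mono) (auto simp: D_def)
        then show ?thesis using D x by (simp add: l0_def divide_simps) (simp add: algebra_simps)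
      qed
      then have "l0 powr e \<le> (8 * X / D) powr e" using l0 e by (intro powr_mono2) auto
      then have "2 * l0 powr e * X \<le> 2 * (8 * X / D) powr e * X" using X0 by simp
      also have "\<dots> = (2 * 8 powr e) * X powr (1 + e) / D powr e"
        using X0 D by (simp add: powr_mult powr_divide powr_add)
      finally have "v \<le> (2 * 8 powr e) * X powr (1 + e) / D powr e" using vX by simp
      then have "v powr r' \<le> ((2 * 8 powr e) * X powr (1 + e) / D powr e) powr r'"
        using uv r' by (intro powr_mono2) auto
      also have "\<dots> = (2 * 8 powr e) powr r' * X powr r / D powr (e * r')"
        using X0 D r' by (simp add: powr_mult powr_divide powr_powr mult.commute)
      finally have "u * v powr r' \<le> u * ((2 * 8 powr e) powr r' * X powr r / D powr (e * r'))"
        using uv by (intro mult_left_mono) auto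
      also have "\<dots> = (2 * 8 powr e) powr r' / D powr (e * r') * (u * X powr r)" by simp
      also have "\<dots> \<le> (2 * 8 powr e) powr r' / D powr (e * r') * (A * D powr (1 + r))"
        unfolding D_def
        by (intro mult_left_mono two_weightD[OF A x(1) _ _ _ u]) (use x X uv in auto)
      also have "\<dots> = B * (D powr (1 + r) / D powr (e * r'))" by (simp add: B_def)
      also have "D powr (1 + r) / D powr (e * r') = D powr (1 + r')"
      proof -
        have "1 + r - e * r' = 1 + r'" using r'(2) by (simp add: algebra_simps)
        then show ?thesis by (simp only: powr_diff[symmetric])
      qed
      finally show ?thesis by (simp add: D_def)
    qed
  qed
  then show ?thesis using that[OF e B] by (simp add: r'_def)
qed

end

section \<open>Removal of the gap\<close>

lemma ennreal_le_add_split: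
  assumes "ennreal u \<le> X + Y" "0 \<le> u"
  obtains u1 u2 where "0 \<le> u1" "0 \<le> u2" "u = u1 + u2" "ennreal u1 \<le> X" "ennreal u2 \<le> Y"
proof (cases "ennreal u \<le> X")
  case True
  then show ?thesis using that[of u 0] assms by simp
next
  case False
  then obtain x where x: "X = ennreal x" "0 \<le> x" by (cases X) auto
  have xu: "x < u" using False x assms by (simp add: not_le ennreal_less_iff)
  have "ennreal u = ennreal x + ennreal (u - x)" using x xu by (subst ennreal_plus[symmetric]) auto
  then have "ennreal (u - x) \<le> Y" using assms(1) x by (simp add: ennreal_add_left_cancel_le)
  then show ?thesis using that[of x "u - x"] x xu by simp
qed

lemma ennreal_mult_le_approx:
  assumes "\<And>u. 0 \<le> u \<Longrightarrow> ennreal u < M \<Longrightarrow> ennreal (a * u) \<le> c" "0 < a"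
  shows "ennreal a * M \<le> c"
proof -
  have "M \<le> c * ennreal (1 / a)"
  proof (rule dense_le)
    fix v assume v: "v < M"
    then obtain u where u: "v = ennreal u" "0 \<le> u" by (cases v) auto
    have "v = ennreal (a * u) * ennreal (1 / a)" using u assms(2) by (simp add: ennreal_mult'[symmetric])
    also have "\<dots> \<le> c * ennreal (1 / a)" using assms(1)[of u] u v by (intro mult_right_mono) auto
    finally show "v \<le> c * ennreal (1 / a)" .
  qed
  then have "ennreal a * M \<le> ennreal a * (c * ennreal (1 / a))" by (intro mult_left_mono) auto
  also have "\<dots> = (ennreal a * ennreal (1 / a)) * c" by (simp add: mult_ac)
  also have "ennreal a * ennreal (1 / a) = 1" using assms(2) by (simp add: ennreal_mult'[symmetric])
  finally show ?thesis by simp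
qed

text \<open>The factor \<open>2\<close> in front of the first term is what the geometric sum in the
removal of the gap tolerates.\<close>

lemma powr_add_le:
  assumes "0 < (r::real)"
  obtains C where "0 \<le> C" "\<And>x y. 0 \<le> x \<Longrightarrow> 0 \<le> y \<Longrightarrow> (x + y) powr r \<le> 2 * x powr r + C * y powr r"
proof -
  define k where "k = 2 powr (1/r) - (1::real)"
  have "1 < 2 powr (1/r)" using assms by (simp add: gr_one_powr)
  then have k: "0 < k" by (simp add: k_def)
  have k2: "(1 + k) powr r = 2" using assms by (simp add: k_def powr_powr)
  have "(x + y) powr r \<le> 2 * x powr r + (1 + 1/k) powr r * y powr r" if xy: "0 \<le> x" "0 \<le> y" for x y
  proof (cases "y \<le> k * x")
    case True
    then have "(x + y) powr r \<le> ((1 + k) * x) powr r"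
      using xy k assms by (intro powr_mono2) (auto simp: algebra_simps)
    also have "\<dots> = 2 * x powr r" using k xy by (simp add: powr_mult k2)
    finally show ?thesis by (simp add: add_increasing2)
  next
    case False
    then have "x \<le> y / k" using k by (simp add: field_simps)
    then have "(x + y) powr r \<le> ((1 + 1/k) * y) powr r"
      using xy k assms by (intro powr_mono2) (auto simp: algebra_simps)
    also have "\<dots> = (1 + 1/k) powr r * y powr r" using k xy by (simp add: powr_mult)
    finally show ?thesis by (simp add: add_increasing)
  qed
  then show ?thesis using that[of "(1 + 1/k) powr r"] by simp
qed

lemma two_weight_gapD:
  "two_weight_gap r A W S \<Longrightarrow> a < b \<Longrightarrow> b < c \<Longrightarrow> c < d \<Longrightarrow> d - a \<le> 4 * (c - b) \<Longrightarrow>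
     0 \<le> u \<Longrightarrow> 0 \<le> v \<Longrightarrow> ennreal u \<le> mass W {a<..<b} \<Longrightarrow> ennreal v \<le> mass S {c<..<d} \<Longrightarrow>
     u * v powr r \<le> A * (d - a) powr (1 + r)"
  unfolding two_weight_gap_def by blast

text \<open>The gap can be removed. Around \<open>b\<close>, with \<open>l\<close> the longer of the
two lengths, split the left interval at \<open>b - l/2\<close> and the right one at \<open>b +
l/2\<close>. Each product that involves an outer piece is estimated by the condition with a gap. The
inner product is the original problem at half the scale, and the scaling factor \<open>2\<^bsup>- 1
- r\<^esup>\<close> beats the loss of a factor \<open>2\<close>. The induction starts from an empty
left interval; this is why the left interval first stops at distance \<open>l /
2\<^bsup>n\<^esup>\<close> from \<open>b\<close>.\<close>

lemma two_weight_of_gap: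
  assumes gap: "two_weight_gap r A W T" and r: "0 < r" and A: "0 \<le> A"
    and W[measurable]: "W \<in> borel_measurable borel" and T[measurable]: "T \<in> borel_measurable borel"
  obtains B where "0 \<le> B" "two_weight r B W T"
proof -
  obtain C where C: "0 \<le> C" "\<And>x y. 0 \<le> x \<Longrightarrow> 0 \<le> y \<Longrightarrow> (x + y) powr r \<le> 2 * x powr r + C * y powr r"
    using powr_add_le[OF r] by blast
  have r2: "2 powr (- r) < 1" using r by (simp add: powr_less_one)
  define K where "K = (1 + C) * A * 2 powr (1 + r) / (1 - 2 powr (- r))"
  have K: "0 \<le> K" using C A r2 by (simp add: K_def)
  have Krec: "(1 + C) * (A * 2 powr (1 + r)) + K * 2 powr (- r) = K"
  proof -
    have "K * (1 - 2 powr (- r)) = (1 + C) * A * 2 powr (1 + r)" using r r2 by (simp add: K_def)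
    then show ?thesis by (simp add: right_diff_distrib mult.assoc)
  qed
  have step: "u * v powr r \<le> K * l powr (1 + r)"
    if "0 < l" "b - l \<le> a" "a < b" "b < c" "c \<le> b + l" "0 \<le> u" "0 \<le> v"
      "ennreal u \<le> mass W {a<..<b - l / 2 ^ n}" "ennreal v \<le> mass T {b<..<c}" for n l a c b u v
    using that
  proof (induction n arbitrary: l a c u v)
    case 0
    then have "u = 0" by simp
    then show ?case using K by simp
  next
    case (Suc n)
    note l = Suc.prems(1)
    define a' where "a' = max a (b - l / 2)"
    define c' where "c' = min c (b + l / 2)"
    have a': "b - l / 2 \<le> a'" "a' < b" "a \<le> a'" using Suc.prems l by (auto simp: a'_def)
    have c': "c' \<le> b + l / 2" "b < c'" "c' \<le> c" using Suc.prems l by (auto simp: c'_def)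
    have lq: "(c - a) powr (1 + r) \<le> 2 powr (1 + r) * l powr (1 + r)"
      using Suc.prems r by (subst powr_mult[symmetric]) (auto intro!: powr_mono2)
    obtain u1 u2 where u: "0 \<le> u1" "0 \<le> u2" "u = u1 + u2"
      "ennreal u1 \<le> mass W {a<..<a'}" "ennreal u2 \<le> mass W {a'<..<b - l / 2 ^ Suc n}"
    proof (cases "a' \<le> b - l / 2 ^ Suc n")
      case True
      then have "ennreal u \<le> mass W {a<..<a'} + mass W {a'<..<b - l / 2 ^ Suc n}"
        using mass_split[OF W a'(3) True] Suc.prems(8) by simp
      then show ?thesis using ennreal_le_add_split[OF _ Suc.prems(6)] that by blast
    next
      case False
      have "mass W {a<..<b - l / 2 ^ Suc n} \<le> mass W {a<..<a'}" using False by (intro mass_mono_set) auto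
      then show ?thesis using that[of u 0] Suc.prems by (auto intro: order_trans)
    qed
    obtain v1 v2 where v: "0 \<le> v1" "0 \<le> v2" "v = v1 + v2"
      "ennreal v1 \<le> mass T {b<..<c'}" "ennreal v2 \<le> mass T {c'<..<c}"
    proof (rule ennreal_le_add_split)
      show "ennreal v \<le> mass T {b<..<c'} + mass T {c'<..<c}"
        using Suc.prems mass_split[OF T, of b c' c] c' by simp
    qed (use Suc.prems in auto)
    have 1: "u1 * v powr r \<le> A * (2 powr (1 + r) * l powr (1 + r))"
    proof (cases "a < b - l / 2")
      case True
      then have "a' = b - l / 2" by (simp add: a'_def)
      then have "u1 * v powr r \<le> A * (c - a) powr (1 + r)"
        by (intro two_weight_gapD[OF gap True, of b]) (use Suc.prems u l in auto)
      also have "\<dots> \<le> A * (2 powr (1 + r) * l powr (1 + r))" using lq A by (intro mult_left_mono)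
      finally show ?thesis .
    next
      case False
      then have "a' = a" by (simp add: a'_def)
      then have "u1 = 0" using u by simp
      then show ?thesis using A by simp
    qed
    have u2b: "ennreal u2 \<le> mass W {a'<..<b}"
    proof (rule order_trans[OF u(5)], rule mass_mono_set)
      have "0 < l / 2 ^ Suc n" using l by simp
      then show "{a'<..<b - l / 2 ^ Suc n} \<subseteq> {a'<..<b}" unfolding greaterThanLessThan_subseteq_greaterThanLessThan by linarith
    qed
    have 2: "u2 * v2 powr r \<le> A * (2 powr (1 + r) * l powr (1 + r))"
    proof (cases "b + l / 2 < c")
      case True
      then have c'eq: "c' = b + l / 2" by (simp add: c'_def)
      then have "u2 * v2 powr r \<le> A * (c - a') powr (1 + r)"
        by (intro two_weight_gapD[OF gap a'(2), of c']) (use Suc.prems u2b u v l a' True in auto)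
      also have "\<dots> \<le> A * (c - a) powr (1 + r)"
        using A a' Suc.prems r by (intro mult_left_mono powr_mono2) auto
      also have "\<dots> \<le> A * (2 powr (1 + r) * l powr (1 + r))" using lq A by (intro mult_left_mono)
      finally show ?thesis .
    next
      case False
      then have "c' = c" by (simp add: c'_def)
      then have "v2 = 0" using v by simp
      then show ?thesis using A by simp
    qed
    have "u2 * v1 powr r \<le> K * (l / 2) powr (1 + r)"
      by (rule Suc.IH[of "l/2" a' c']) (use l a' c' u v in \<open>auto simp: field_simps\<close>)
    also have "(l / 2) powr (1 + r) = 2 powr (- r) / 2 * l powr (1 + r)"
      using l by (simp add: powr_divide powr_add powr_minus divide_simps)
    finally have 3: "2 * (u2 * v1 powr r) \<le> K * 2 powr (- r) * l powr (1 + r)" by simp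
    have "u * v powr r = u1 * v powr r + u2 * (v1 + v2) powr r" using u v by (simp add: distrib_right)
    also have "u2 * (v1 + v2) powr r \<le> u2 * (2 * v1 powr r + C * v2 powr r)"
      using C(2) u v by (intro mult_left_mono) auto
    also have "u1 * v powr r + u2 * (2 * v1 powr r + C * v2 powr r)
        = u1 * v powr r + 2 * (u2 * v1 powr r) + C * (u2 * v2 powr r)" by (simp add: algebra_simps)
    also have "\<dots> \<le> A * (2 powr (1 + r) * l powr (1 + r)) + K * 2 powr (- r) * l powr (1 + r)
        + C * (A * (2 powr (1 + r) * l powr (1 + r)))"
      using 1 2 3 C(1) by (intro add_mono mult_left_mono)
    also have "\<dots> = ((1 + C) * (A * 2 powr (1 + r)) + K * 2 powr (- r)) * l powr (1 + r)"
      by (simp add: algebra_simps)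
    also have "\<dots> = K * l powr (1 + r)" by (simp only: Krec)
    finally show ?case by simp
  qed
  have "two_weight r K W T"
    unfolding two_weight_def
  proof (intro allI impI)
    fix a b c u v :: real
    assume ab: "a < b" and bc: "b < c" and u0: "0 \<le> u" and v0: "0 \<le> v"
      and u: "ennreal u \<le> mass W {a<..<b}" and v: "ennreal v \<le> mass T {b<..<c}"
    define l where "l = max (b - a) (c - b)"
    have l: "0 < l" "b - l \<le> a" "c \<le> b + l" "l \<le> c - a" using ab bc by (auto simp: l_def)
    have K2: "K * l powr (1 + r) \<le> K * (c - a) powr (1 + r)"
      using l K r by (intro mult_left_mono powr_mono2) auto
    show "u * v powr r \<le> K * (c - a) powr (1 + r)"
    proof (rule ccontr)
      assume "\<not> ?thesis"
      then have c: "K * l powr (1 + r) < u * v powr r" using K2 by simp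
      have "0 \<le> K * l powr (1 + r)" using K by simp
      then have vp: "0 < v powr r" using c by (metis mult_zero_right not_less order_less_le powr_ge_zero)
      then have "K * l powr (1 + r) / v powr r < u" using c by (simp add: divide_less_eq)
      then obtain u' where u': "K * l powr (1 + r) / v powr r < u'" "u' < u" using dense by blast
      have u'0: "0 \<le> u'" using u'(1) K by (smt (verit) divide_nonneg_nonneg mult_nonneg_nonneg powr_ge_zero)
      have "ennreal u' < ennreal u" using u' u'0 by (simp add: ennreal_less_iff)
      then have "ennreal u' < mass W {a<..<b}" using u by simp
      then obtain b' where b': "a < b'" "b' < b" "ennreal u' < mass W {a<..<b'}"
        using mass_approx_right[OF W] by blast
      obtain n where n: "l / (b - b') < 2 ^ n" using real_arch_pow[of 2] by auto
      then have "l / 2 ^ n < b - b'" using b' by (simp add: field_simps)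
      then have "mass W {a<..<b'} \<le> mass W {a<..<b - l / 2 ^ n}" by (intro mass_mono_set) auto
      then have "u' * v powr r \<le> K * l powr (1 + r)"
        using b'(3) by (intro step[OF l(1,2) ab bc l(3) u'0 v0 _ v, of n]) auto
      then show False using u'(1) vp by (simp add: divide_less_eq)
    qed
  qed
  then show ?thesis using that K by blast
qed

text \<open>The right maximal function of a nonnegative real function. Averages are indexed by the
right end point of the interval.\<close>

definition right_maximal :: "(real \<Rightarrow> real) \<Rightarrow> real \<Rightarrow> ennreal" where
  "right_maximal f x = (SUP y\<in>{x<..}. ennreal (1 / (y - x)) * mass f {x<..<y})"

lemma ennreal_less_mult_inverse_iff:
  assumes "0 < a" "0 \<le> l"
  shows "ennreal l < ennreal (1 / a) * M \<longleftrightarrow> ennreal (l * a) < M"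
proof (cases M)
  case (real m)
  then show ?thesis using assms by (simp add: ennreal_mult'[symmetric] ennreal_less_iff field_simps)
next
  case top
  then show ?thesis using assms by (simp add: ennreal_mult_top)
qed

lemma less_right_maximal_iff: "0 \<le> l \<Longrightarrow> ennreal l < right_maximal f x \<longleftrightarrow> x \<in> exceed f l"
  by (auto simp: right_maximal_def exceed_def less_SUP_iff ennreal_less_mult_inverse_iff)

lemma right_maximal_measurable [measurable]:
  assumes "f \<in> borel_measurable borel"
  shows "right_maximal f \<in> borel_measurable borel"
proof (rule borel_measurableI_greater)
  fix v :: ennreal
  have "{x. v < right_maximal f x} \<in> sets borel"
  proof (cases v)
    case (real l)
    then show ?thesis using exceed_measurable[OF assms, of l] by (simp add: less_right_maximal_iff)
  qed simp
  then show "{x \<in> space borel. v < right_maximal f x} \<in> sets borel" by simp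
qed

section \<open>The weak type inequality\<close>

context one_sided_weight
begin

text \<open>Hoelder's inequality on \<open>(y, z)\<close> combined with the Muckenhoupt condition
for the adjacent intervals \<open>(x, y)\<close> and \<open>(y, z)\<close>. A form of Hoelder's
inequality with a worse constant comes from the pointwise bound \<open>f \<le> s S + s\<^bsup>-
r\<^esup> f\<^bsup>1 + r\<^esup> w\<close> on optimizing in \<open>s\<close>.\<close>

lemma adjacent_intervals_estimate:
  assumes f[measurable]: "f \<in> borel_measurable borel" and f0: "\<And>x. 0 \<le> f x"
    and fJ: "\<And>x. x \<notin> J \<Longrightarrow> f x = 0"
    and xyz: "x < y" "y < z" "z \<le> b" and l: "0 < l"
    and X: "mass f {y<..<z} = ennreal X" "0 < X" "l * (b - x) \<le> 4 * X"
  shows "ennreal (l powr (1 + r)) * mass W {x<..<y}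
    \<le> ennreal (8 powr (1 + r) * (A + 1)) * mass (\<lambda>x. f x powr (1 + r) * w x) {y<..<z}"
proof (cases "mass (\<lambda>x. f x powr (1 + r) * w x) {y<..<z}")
  case top
  then show ?thesis using A0 by (simp add: ennreal_mult_top)
next
  case (real Z)
  have hol: "X \<le> s * Y + s powr (-r) * Z" if s: "0 < s" and Y: "mass S {y<..<z} = ennreal Y" "0 \<le> Y" for s Y
  proof -
    have "ennreal X \<le> mass (\<lambda>x. s * S x + s powr (-r) * (f x powr (1 + r) * w x)) {y<..<z}"
      unfolding X(1)[symmetric]
    proof (rule mass_mono)
      fix x
      show "f x \<le> s * S x + s powr (-r) * (f x powr (1 + r) * w x)"
      proof (cases "x \<in> J \<and> s * S x < f x")
        case True
        have "w x powr (-1/r) = S x" using True by simp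
        then have Sr: "S x powr r * w x = 1" using wpos[of x] r
          by (metis (no_types, lifting) divide_minus_left minus_mult_left mult.commute nonzero_mult_div_cancel_left
              order_less_imp_not_less powr_powr powr_minus powr_one less_imp_le left_inverse mult_1 times_divide_eq_left)
        have fp: "0 < f x" using True s by (smt (verit) mult_nonneg_nonneg powr_ge_zero indicator_pos_le)
        have "s powr r \<le> (f x) powr r * w x"
        proof -
          have "s powr r = (s * S x) powr r * w x" using s Sr True by (simp add: powr_mult mult.assoc)
          also have "\<dots> \<le> f x powr r * w x"
            using True s r wpos[of x] by (intro mult_right_mono powr_mono2) auto
          finally show ?thesis .
        qed
        then have "f x * s powr r \<le> f x * (f x powr r * w x)" using fp by (intro mult_left_mono) auto
        also have "\<dots> = f x powr (1 + r) * w x" using fp by (simp add: powr_add)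
        finally have "f x \<le> s powr (-r) * (f x powr (1 + r) * w x)"
          using s by (simp add: powr_minus field_simps)
        then show ?thesis using s by (auto intro: add_increasing)
      next
        case False
        have "0 \<le> s powr (-r) * (f x powr (1 + r) * w x)" using wpos[of x] by simp
        then show ?thesis using False fJ[of x] s by (cases "x \<in> J") auto
      qed
    qed
    also have "\<dots> = ennreal s * ennreal Y + ennreal (s powr (-r)) * ennreal Z"
      using s wpos Y real by (subst mass_add) (auto simp: mass_cmult less_imp_le)
    also have "\<dots> = ennreal (s * Y + s powr (-r) * Z)"
      using s Y real by (simp add: ennreal_mult')
    finally show ?thesis using X real s Y by (subst (asm) ennreal_le_iff) auto
  qed
  have "ennreal (l powr (1 + r) * u) \<le> ennreal (8 powr (1 + r) * (A + 1) * Z)"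
    if u: "0 \<le> u" "ennreal u < mass W {x<..<y}" for u
  proof (cases "u = 0")
    case True
    then show ?thesis by simp
  next
    case False
    then have u0: "0 < u" using u by simp
    have uW: "ennreal u \<le> mass W {x<..<y}" using u by simp
    have "mass S {y<..<z} < \<infinity>" using two_weight_finite[OF A r xyz(1,2) u0 uW] .
    then obtain Y where Y: "mass S {y<..<z} = ennreal Y" "0 \<le> Y" by (cases "mass S {y<..<z}") auto
    have Z0: "0 < Z"
    proof (rule ccontr)
      assume "\<not> 0 < Z"
      then have "Z = 0" using real by simp
      then have "X \<le> X / (2 * (Y + 1)) * Y" using hol[OF _ Y, of "X / (2 * (Y + 1))"] X Y by simp
      then have "X * (2 * (Y + 1)) \<le> X * Y" using Y by (simp add: field_simps)
      then have "2 * (Y + 1) \<le> Y" using X(2) by (simp add: mult_le_cancel_left_pos del: distrib_left_numeral)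
      then show False using Y by simp
    qed
    \<comment> \<open>with this \<open>s\<close> the second term of the Hoelder bound is \<open>X / 2\<close>\<close>
    define s where "s = (2 * Z / X) powr (1 / r)"
    have s: "0 < s" "s powr (-r) = X / (2 * Z)" "s powr r = 2 * Z / X"
      using Z0 X r by (auto simp: s_def powr_powr powr_minus)
    have "X \<le> s * Y + X / 2" using hol[OF s(1) Y] s Z0 by simp
    then have "X / 2 \<le> s * Y" by simp
    then have "(X / 2) powr r \<le> (s * Y) powr r" using X r by (intro powr_mono2) auto
    also have "\<dots> = 2 * Z / X * Y powr r" using s Y by (simp add: powr_mult)
    finally have "X powr r / 2 powr r * X \<le> 2 * Z * Y powr r" using X by (simp add: powr_divide field_simps)
    then have "X powr (1 + r) \<le> 2 * 2 powr r * Z * Y powr r" using X by (simp add: powr_add field_simps)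
    then have XZ: "X powr (1 + r) \<le> 2 powr (1 + r) * Z * Y powr r" by (simp add: powr_add)
    have bx: "0 < b - x" using xyz by simp
    have "u * Y powr r \<le> A * (z - x) powr (1 + r)"
      by (rule two_weightD[OF A xyz(1,2)]) (use u uW Y in auto)
    also have "\<dots> \<le> A * (b - x) powr (1 + r)"
      using A0 xyz r by (intro mult_left_mono powr_mono2) auto
    finally have uY: "u * Y powr r \<le> A * (b - x) powr (1 + r)" .
    have "(l * (b - x)) powr (1 + r) * u \<le> (4 * X) powr (1 + r) * u"
      using X l bx r u by (intro mult_right_mono powr_mono2) auto
    also have "\<dots> = 4 powr (1 + r) * u * X powr (1 + r)" using X by (simp add: powr_mult)
    also have "\<dots> \<le> 4 powr (1 + r) * u * (2 powr (1 + r) * Z * Y powr r)"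
      using XZ u by (intro mult_left_mono) auto
    also have "\<dots> = (4 powr (1 + r) * 2 powr (1 + r)) * Z * (u * Y powr r)" by (simp add: mult_ac)
    also have "\<dots> = 8 powr (1 + r) * Z * (u * Y powr r)" by (simp add: powr_mult[symmetric])
    also have "\<dots> \<le> 8 powr (1 + r) * Z * (A * (b - x) powr (1 + r))"
      using Z0 uY by (intro mult_left_mono) auto
    finally have "l powr (1 + r) * u * (b - x) powr (1 + r) \<le> 8 powr (1 + r) * Z * A * (b - x) powr (1 + r)"
      using l bx by (simp add: powr_mult mult_ac)
    then have "l powr (1 + r) * u \<le> 8 powr (1 + r) * Z * A" using bx by (simp add: mult_le_cancel_right)
    also have "\<dots> \<le> 8 powr (1 + r) * (A + 1) * Z" using Z0 by (simp add: distrib_left distrib_right)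
    finally show ?thesis by (rule ennreal_leI)
  qed
  then have "ennreal (l powr (1 + r)) * mass W {x<..<y} \<le> ennreal (8 powr (1 + r) * (A + 1) * Z)"
    using l by (intro ennreal_mult_le_approx) auto
  also have "\<dots> = ennreal (8 powr (1 + r) * (A + 1)) * ennreal Z" using A0 by (intro ennreal_mult') simp
  finally show ?thesis using real by simp
qed

text \<open>On a component \<open>(a, b)\<close> of the level set choose points \<open>x n\<close>
from which the remaining integral of \<open>f\<close> up to \<open>b\<close> is \<open>2\<^bsup>-
n\<^esup>\<close> times the total. By the rising sun lemma the integral over \<open>(x (n + 1), x (n
+ 2))\<close> is at least \<open>l/4\<close> times \<open>b - x n\<close>. Thus the weight of each
interval \<open>(x n, x (n + 1))\<close> is bounded by the integral over the next one, and these
bounds add up. Boundedness of \<open>f\<close> makes the integral Lipschitz in its end point, so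
that the points exist.\<close>

lemma weak_type_bounded:
  assumes f[measurable]: "f \<in> borel_measurable borel" and f0: "\<And>x. 0 \<le> f x"
    and fJ: "\<And>x. x \<notin> J \<Longrightarrow> f x = 0" and fin: "mass f UNIV < \<infinity>"
    and bd: "\<And>x. f x \<le> N" and l: "0 < l"
  shows "ennreal (l powr (1 + r)) * mass W (exceed f l)
    \<le> ennreal (8 powr (1 + r) * (A + 1)) * mass (\<lambda>x. f x powr (1 + r) * w x) UNIV"
proof -
  let ?K = "ennreal (8 powr (1 + r) * (A + 1))" and ?g = "\<lambda>x. f x powr (1 + r) * w x"
  have g[measurable]: "?g \<in> borel_measurable borel" by measurable
  have W: "W \<in> borel_measurable borel" by measurable
  have N0: "0 \<le> N" using bd f0 order_trans by blast
  have "mass (\<lambda>x. l powr (1 + r) * W x) (exceed f l) \<le> ?K * mass ?g (exceed f l)"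
  proof (rule mass_le_by_components)
    show "open (exceed f l)" using open_exceed[OF f] l by simp
    fix a b assume ab: "a < b" "{a<..<b} \<subseteq> exceed f l" "a \<notin> exceed f l" "b \<notin> exceed f l"
    define F where "F = (\<lambda>x. enn2real (mass f {x<..<b}))"
    have F: "mass f {x<..<b} = ennreal (F x)" "0 \<le> F x" for x
      using fin mass_mono_set[of "{x<..<b}" UNIV f] by (auto simp: F_def le_less_trans)
    have Fsplit: "mass f {x<..<y} = ennreal (F x - F y)" "F y \<le> F x" if "x \<le> y" "y \<le> b" for x y
    proof -
      have eq: "ennreal (F x) = mass f {x<..<y} + ennreal (F y)"
        using mass_split[OF f that] F by simp
      then have "mass f {x<..<y} < \<infinity>" by (metis ennreal_less_top ennreal_add_less_top infinity_ennreal_def)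
      then obtain m where m: "mass f {x<..<y} = ennreal m" "0 \<le> m" by (cases "mass f {x<..<y}") auto
      then have "ennreal (F x) = ennreal (m + F y)" using eq F by simp
      then have "F x = m + F y" using m F by (subst (asm) ennreal_inj) auto
      then show "mass f {x<..<y} = ennreal (F x - F y)" "F y \<le> F x" using m by auto
    qed
    have lip: "F x - F y \<le> N * (y - x)" if "x \<le> y" "y \<le> b" for x y
    proof -
      have "mass f {x<..<y} \<le> ennreal (N * (y - x))"
        using mass_mono[of "{x<..<y}" f "\<lambda>_. N"] bd mass_const[OF N0 that(1)] by simp
      then show ?thesis using Fsplit[OF that] N0 that by simp
    qed
    have contF: "continuous_on {a..b} F"
    proof -
      have "dist (F x) (F y) \<le> N * dist x y" if "x \<in> {a..b}" "y \<in> {a..b}" for x y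
        using lip[of x y] lip[of y x] Fsplit(2)[of x y] Fsplit(2)[of y x] that
        by (cases "x \<le> y") (auto simp: dist_real_def abs_real_def)
      then have "N-lipschitz_on {a..b} F" using N0 by (intro lipschitz_onI) auto
      then show ?thesis by (rule lipschitz_on_continuous_on)
    qed
    have Flow: "l * (b - x) \<le> F x" if "a \<le> x" "x \<le> b" for x
    proof -
      have "ennreal (l * (b - x)) \<le> ennreal (F x)"
        unfolding F(1)[symmetric] by (rule rising_sun[OF f l fin that(2)]) (use ab that in auto)
      then show ?thesis using F by simp
    qed
    have Fa: "0 < F a" using Flow[of a] ab l by (smt (verit) mult_pos_pos)
    have Fb: "F b = 0" by (simp add: F_def)
    have "\<exists>x. a \<le> x \<and> x \<le> b \<and> F x = F a / 2 ^ n \<and> (n = 0 \<longrightarrow> x = a)" for n :: nat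
    proof (cases n)
      case 0
      then show ?thesis using ab by (intro exI[of _ a]) auto
    next
      case (Suc m)
      have "F b \<le> F a / 2 ^ n" "F a / 2 ^ n \<le> F a"
        using Fa Fb by (auto simp: divide_le_eq)
      then show ?thesis using IVT2'[of F b "F a / 2 ^ n" a] contF ab Suc by auto
    qed
    then obtain x where x: "\<And>n. a \<le> x n" "\<And>n. x n \<le> b" "\<And>n. F (x n) = F a / 2 ^ n" "x 0 = a"
      by metis
    have xinc: "x n < x (Suc n)" for n
    proof (rule ccontr)
      assume "\<not> ?thesis"
      then have "F (x n) \<le> F (x (Suc n))" 
        using Fsplit(2)[of "x (Suc n)" "x n"] x(2)[of n] by simp
      then show False using Fa unfolding x(3) by (simp add: field_simps)
    qed
    have piece: "ennreal (l powr (1 + r)) * mass W {x n<..<x (Suc n)}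
      \<le> ?K * mass ?g {x (Suc n)<..<x (Suc (Suc n))}" for n
    proof (rule adjacent_intervals_estimate[OF f f0 fJ xinc xinc x(2) l])
      show "mass f {x (Suc n)<..<x (Suc (Suc n))} = ennreal (F a / 2 ^ n / 4)"
        using Fsplit(1)[of "x (Suc n)" "x (Suc (Suc n))"] xinc[of "Suc n"] x by (simp add: field_simps)
      show "0 < F a / 2 ^ n / 4" using Fa by simp
      show "l * (b - x n) \<le> 4 * (F a / 2 ^ n / 4)" using Flow[OF x(1,2), of n] x by simp
    qed
    have part: "ennreal (l powr (1 + r)) * mass W {a<..<x n} \<le> ?K * mass ?g {a<..<x (Suc n)}" for n
    proof (induction n)
      case 0
      then show ?case using x by simp
    next
      case (Suc n)
      have "ennreal (l powr (1 + r)) * mass W {a<..<x (Suc n)}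
        = ennreal (l powr (1 + r)) * mass W {a<..<x n} + ennreal (l powr (1 + r)) * mass W {x n<..<x (Suc n)}"
        using mass_split[OF W x(1)[of n], of "x (Suc n)"] xinc[of n] by (simp add: distrib_left)
      also have "\<dots> \<le> ?K * mass ?g {a<..<x (Suc n)} + ?K * mass ?g {x (Suc n)<..<x (Suc (Suc n))}"
        by (intro add_mono Suc piece)
      also have "\<dots> = ?K * mass ?g {a<..<x (Suc (Suc n))}"
        using mass_split[OF g x(1)[of "Suc n"], of "x (Suc (Suc n))"] xinc[of "Suc n"] by (simp add: distrib_left)
      finally show ?case .
    qed
    have "ennreal (l powr (1 + r)) * mass W {a<..<b} \<le> ?K * mass ?g {a<..<b}"
    proof (rule ennreal_mult_le_approx)
      fix u assume u: "0 \<le> u" "ennreal u < mass W {a<..<b}"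
      obtain b' where b': "a < b'" "b' < b" "ennreal u < mass W {a<..<b'}"
        using mass_approx_right[OF W u(2)] by blast
      have "0 < F b'" using Flow[of b'] b' l by (smt (verit) mult_pos_pos)
      obtain n where n: "F a / F b' < 2 ^ n" using real_arch_pow[of 2] by auto
      then have "F (x n) < F b'" using \<open>0 < F b'\<close> unfolding x(3) by (simp add: field_simps)
      then have "b' < x n" using Fsplit(2)[of "x n" b'] b' by force
      then have "mass W {a<..<b'} \<le> mass W {a<..<x n}" by (intro mass_mono_set) auto
      then have "ennreal u \<le> mass W {a<..<x n}" using b'(3) by simp
      then have "ennreal (l powr (1 + r)) * ennreal u \<le> ennreal (l powr (1 + r)) * mass W {a<..<x n}"
        by (rule mult_left_mono) simp
      also have "\<dots> \<le> ?K * mass ?g {a<..<x (Suc n)}" by (rule part)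
      also have "\<dots> \<le> ?K * mass ?g {a<..<b}"
        using x(2)[of "Suc n"] by (intro mult_left_mono mass_mono_set) auto
      finally show "ennreal (l powr (1 + r) * u) \<le> ?K * mass ?g {a<..<b}" by (simp add: ennreal_mult')
    qed (use l in simp)
    then show "mass (\<lambda>x. l powr (1 + r) * W x) {a<..<b} \<le> ?K * mass ?g {a<..<b}"
      by (simp add: mass_cmult)
  qed (use exceed_bounded[OF f l fin] in auto)
  also have "\<dots> \<le> ?K * mass ?g UNIV" by (intro mult_left_mono mass_mono_set) auto
  finally show ?thesis using exceed_measurable[OF f, of l] l by (simp add: mass_cmult)
qed

lemma weak_type:
  assumes f[measurable]: "f \<in> borel_measurable borel" and f0: "\<And>x. 0 \<le> f x"
    and fJ: "\<And>x. x \<notin> J \<Longrightarrow> f x = 0" and l: "0 < l"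
  shows "ennreal (l powr (1 + r)) * mass W (exceed f l)
    \<le> ennreal (8 powr (1 + r) * (A + 1)) * mass (\<lambda>x. f x powr (1 + r) * w x) UNIV"
proof -
  define h where "h = (\<lambda>n::nat. \<lambda>x. min (f x) (real n) * indicator {- real n<..<real n} x)"
  have h[measurable]: "h n \<in> borel_measurable borel" for n unfolding h_def by measurable
  have h0: "0 \<le> h n x" "h n x \<le> f x" "h n x \<le> real n" for n x
    using f0[of x] by (auto simp: h_def split: split_indicator)
  have hinc: "h m x \<le> h n x" if "m \<le> n" for m n x
    using f0[of x] that by (auto simp: h_def split: split_indicator)
  have sup: "(SUP n. ennreal (h n x)) = ennreal (f x)" for x
  proof (rule antisym)
    show "(SUP n. ennreal (h n x)) \<le> ennreal (f x)" using h0 by (intro SUP_least ennreal_leI)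
    obtain n :: nat where n: "f x < real n" "\<bar>x\<bar> < real n"
      using reals_Archimedean2[of "max (f x) \<bar>x\<bar>"] by auto
    then have "x \<in> {- real n<..<real n}" by auto
    then have "h n x = f x" using n by (simp add: h_def)
    moreover have "ennreal (h n x) \<le> (SUP n. ennreal (h n x))" by (rule SUP_upper) simp
    ultimately show "ennreal (f x) \<le> (SUP n. ennreal (h n x))" by simp
  qed
  have massSUP: "mass f B = (SUP n. mass (h n) B)" if B[measurable]: "B \<in> sets borel" for B
  proof -
    have "mass f B = (\<integral>\<^sup>+x. (SUP n. ennreal (h n x) * indicator B x) \<partial>lborel)"
      unfolding mass_def sup[symmetric] by (simp add: SUP_mult_right_ennreal)
    also have "\<dots> = (SUP n. \<integral>\<^sup>+x. ennreal (h n x) * indicator B x \<partial>lborel)"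
      by (rule nn_integral_monotone_convergence_SUP)
         (auto intro!: monoI le_funI mult_right_mono ennreal_leI hinc)
    finally show ?thesis by (simp add: mass_def)
  qed
  have exU: "exceed f l = (\<Union>n. exceed (h n) l)"
    by (auto simp: exceed_def massSUP less_SUP_iff)
  have exinc: "incseq (\<lambda>n. exceed (h n) l)"
  proof (rule monoI)
    fix m n :: nat assume mn: "m \<le> n"
    show "exceed (h m) l \<subseteq> exceed (h n) l"
    proof
      fix x assume "x \<in> exceed (h m) l"
      then obtain y where y: "x < y" "ennreal (l * (y - x)) < mass (h m) {x<..<y}" by (auto simp: exceed_def)
      note y(2)
      also have "mass (h m) {x<..<y} \<le> mass (h n) {x<..<y}" using hinc[OF mn] by (intro mass_mono)
      finally show "x \<in> exceed (h n) l" using y(1) by (auto simp: exceed_def)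
    qed
  qed
  have exm: "exceed (h n) l \<in> sets borel" for n using exceed_measurable[OF h] l by simp
  have Wm: "W \<in> borel_measurable borel" by measurable
  have "mass W (exceed f l) = (SUP n. mass W (exceed (h n) l))"
    using SUP_emeasure_incseq[of "\<lambda>n. exceed (h n) l" "density lborel (\<lambda>x. ennreal (W x))"] exinc exm Wm
    unfolding exU by (simp add: mass_eq_emeasure image_subset_iff)
  then have "ennreal (l powr (1 + r)) * mass W (exceed f l)
    = (SUP n. ennreal (l powr (1 + r)) * mass W (exceed (h n) l))"
    by (simp add: SUP_mult_left_ennreal)
  also have "\<dots> \<le> ennreal (8 powr (1 + r) * (A + 1)) * mass (\<lambda>x. f x powr (1 + r) * w x) UNIV"
  proof (rule SUP_least)
    fix n
    have "mass (h n) UNIV \<le> mass (\<lambda>x. real n * indicator {- real n<..<real n} x) UNIV"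
      by (intro mass_mono) (auto simp: h_def split: split_indicator)
    also have "\<dots> = mass (\<lambda>x. real n) {- real n<..<real n}" by (subst mass_indicator) simp
    also have "\<dots> < \<infinity>" by (subst mass_const) auto
    finally have "ennreal (l powr (1 + r)) * mass W (exceed (h n) l)
      \<le> ennreal (8 powr (1 + r) * (A + 1)) * mass (\<lambda>x. h n x powr (1 + r) * w x) UNIV"
      by (intro weak_type_bounded[where N = "real n"]) (use h0 l fJ in \<open>auto simp: h_def\<close>)
    also have "\<dots> \<le> ennreal (8 powr (1 + r) * (A + 1)) * mass (\<lambda>x. f x powr (1 + r) * w x) UNIV"
      using h0 r wpos by (intro mult_left_mono mass_mono mult_right_mono powr_mono2) (auto simp: less_imp_le)
    finally show "ennreal (l powr (1 + r)) * mass W (exceed (h n) l)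
      \<le> ennreal (8 powr (1 + r) * (A + 1)) * mass (\<lambda>x. f x powr (1 + r) * w x) UNIV" .
  qed
  finally show ?thesis .
qed

end

section \<open>The strong type inequality\<close>

lemma ennreal_powr_ennreal [simp]: "0 \<le> a \<Longrightarrow> ennreal_powr (ennreal a) r = ennreal (a powr r)"
  by (simp add: ennreal_powr_def)

lemma ennreal_powr_top [simp]: "ennreal_powr top r = top"
  by (simp add: ennreal_powr_def)

lemma ennreal_powr_0 [simp]: "ennreal_powr 0 r = 0"
  by (simp add: ennreal_powr_def)

lemma ennreal_powr_mono:
  assumes "0 < r" "x \<le> y"
  shows "ennreal_powr x r \<le> ennreal_powr y r"
proof (cases y)
  case (real b)
  then obtain a where "x = ennreal a" "0 \<le> a" using assms by (cases x) (auto simp: top_unique)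
  then show ?thesis using real assms by (auto intro!: ennreal_leI powr_mono2)
qed simp

lemma ennreal_powr_cmult:
  assumes "0 < r" "0 \<le> c"
  shows "ennreal_powr (ennreal c * x) r = ennreal (c powr r) * ennreal_powr x r"
proof (cases x)
  case (real a)
  then show ?thesis using assms by (simp add: ennreal_mult'[symmetric] powr_mult)
next
  case top
  then show ?thesis using assms by (cases "c = 0") (auto simp: ennreal_mult_top)
qed

lemma ennreal_powr_powr:
  assumes "0 < r" "0 < s"
  shows "ennreal_powr (ennreal_powr x r) s = ennreal_powr x (r * s)"
  by (cases x) (auto simp: powr_powr)

lemma ennreal_powr_one [simp]: "ennreal_powr x 1 = x"
  by (cases x) auto

lemma ennreal_powr_SUP:
  assumes "0 < r"
  shows "ennreal_powr (SUP i\<in>I. Y i) r = (SUP i\<in>I. ennreal_powr (Y i) r)"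
proof (rule antisym)
  let ?S = "SUP i\<in>I. ennreal_powr (Y i) r"
  have "(SUP i\<in>I. Y i) \<le> ennreal_powr ?S (1 / r)"
  proof (rule SUP_least)
    fix i assume i: "i \<in> I"
    have "Y i = ennreal_powr (ennreal_powr (Y i) r) (1 / r)"
      using assms by (subst ennreal_powr_powr) auto
    also have "\<dots> \<le> ennreal_powr ?S (1 / r)"
      using assms i by (intro ennreal_powr_mono SUP_upper) auto
    finally show "Y i \<le> ennreal_powr ?S (1 / r)" .
  qed
  then have "ennreal_powr (SUP i\<in>I. Y i) r \<le> ennreal_powr (ennreal_powr ?S (1 / r)) r"
    using assms by (intro ennreal_powr_mono) auto
  then show "ennreal_powr (SUP i\<in>I. Y i) r \<le> ?S" using assms by (subst (asm) ennreal_powr_powr) auto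
  show "?S \<le> ennreal_powr (SUP i\<in>I. Y i) r"
    using assms by (intro SUP_least ennreal_powr_mono SUP_upper) auto
qed

lemma measurable_ennreal_powr [measurable]:
  assumes [measurable]: "g \<in> borel_measurable M"
  shows "(\<lambda>x. ennreal_powr (g x) r) \<in> borel_measurable M"
  unfolding ennreal_powr_def by measurable

lemma ennreal_powr_le_layers:
  assumes p: "0 < p"
  shows "ennreal_powr y p
    \<le> (\<integral>\<^sup>+l. (if 0 < l \<and> ennreal l < y then ennreal (p * l powr (p - 1)) else 0) \<partial>lborel)"
proof -
  let ?I = "\<integral>\<^sup>+l. (if 0 < l \<and> ennreal l < y then ennreal (p * l powr (p - 1)) else 0) \<partial>lborel"
  have *: "ennreal (t powr p) \<le> ?I" if t: "0 < t" "ennreal t \<le> y" for t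
  proof -
    have "ennreal (t powr p) = mass (\<lambda>x. p * x powr (p - 1)) {0<..<t}" using mass_powr_0[OF p t(1)] by simp
    also have "\<dots> \<le> ?I"
      unfolding mass_def
    proof (rule nn_integral_mono)
      fix l
      have "ennreal l < y" if "0 < l" "l < t"
        using that t by (metis ennreal_lessI less_le_trans)
      then show "ennreal (p * l powr (p - 1)) * indicator {0<..<t} l
        \<le> (if 0 < l \<and> ennreal l < y then ennreal (p * l powr (p - 1)) else 0)"
        by (auto split: split_indicator)
    qed
    finally show ?thesis .
  qed
  show ?thesis
  proof (cases y)
    case (real t)
    then show ?thesis using *[of t] by (cases "t = 0") auto
  next
    case top
    have "?I = top"
    proof (rule ccontr)
      assume "?I \<noteq> top"
      then obtain m where m: "?I = ennreal m" "0 \<le> m" by (cases ?I) auto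
      have "ennreal (((m + 1) powr (1/p)) powr p) \<le> ?I" by (rule *) (use m top in auto)
      then show False using m p by (simp add: powr_powr)
    qed
    then show ?thesis by simp
  qed
qed

text \<open>Discarding the values of \<open>f\<close> below half the level loses at most half of
each average.\<close>

lemma exceed_half:
  assumes f[measurable]: "f \<in> borel_measurable borel" and f0: "\<And>x. 0 \<le> f x" and l: "0 < l"
  shows "exceed f l \<subseteq> exceed (\<lambda>x. f x * indicator {x. l / 2 < f x} x) (l / 2)"
proof
  let ?h = "\<lambda>x. f x * indicator {x. l / 2 < f x} x"
  fix x assume "x \<in> exceed f l"
  then obtain y where y: "x < y" "ennreal (l * (y - x)) < mass f {x<..<y}" by (auto simp: exceed_def)
  have "ennreal (l / 2 * (y - x)) + ennreal (l / 2 * (y - x)) = ennreal (l * (y - x))"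
    using l y(1) by (subst ennreal_plus[symmetric]) (auto simp: algebra_simps)
  also have "\<dots> < mass f {x<..<y}" by (rule y(2))
  also have "\<dots> \<le> mass (\<lambda>x. ?h x + l / 2) {x<..<y}"
    using l by (intro mass_mono) (auto split: split_indicator)
  also have "\<dots> = mass ?h {x<..<y} + ennreal (l / 2 * (y - x))"
    using f0 l y(1) by (subst mass_add) (auto simp: mass_const)
  finally have "ennreal (l / 2 * (y - x)) < mass ?h {x<..<y}"
    by (metis add_right_mono not_less)
  then show "x \<in> exceed ?h (l / 2)" using y(1) by (auto simp: exceed_def)
qed

context one_sided_weight
begin

text \<open>Marcinkiewicz interpolation between the weak type inequality at the exponent \<open>1 +
r\<close> and the trivial bound at infinity.\<close>

lemma strong_type:
  assumes f[measurable]: "f \<in> borel_measurable borel" and f0: "\<And>x. 0 \<le> f x"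
    and fJ: "\<And>x. x \<notin> J \<Longrightarrow> f x = 0" and p: "1 + r < p"
  shows "(\<integral>\<^sup>+x. ennreal_powr (right_maximal f x) p * ennreal (W x) \<partial>lborel)
    \<le> ennreal (p * (8 powr (1 + r) * (A + 1)) * 2 powr p / (p - (1 + r))) * mass (\<lambda>x. f x powr p * w x) UNIV"
proof -
  define q where "q = 1 + r"
  define K where "K = 8 powr q * (A + 1)"
  have q: "0 < q" "q < p" "1 + r = q" using r p by (auto simp: q_def)
  have p0: "0 < p" using q by simp
  have K: "0 < K" using A0 by (simp add: K_def)
  have W0: "0 \<le> W x" for x using wpos[of x] by (simp add: less_imp_le)
  have level: "mass W (exceed f l) \<le> ennreal (K * 2 powr q * l powr (- q)) * mass (\<lambda>x. f x powr q * w x) {x. l / 2 < f x}"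
    if l: "0 < l" for l
  proof -
    let ?h = "\<lambda>x. f x * indicator {x. l / 2 < f x} x"
    have "ennreal ((l / 2) powr q) * mass W (exceed f l) \<le> ennreal ((l / 2) powr q) * mass W (exceed ?h (l / 2))"
      using exceed_half[OF f f0 l] by (intro mult_left_mono mass_mono_set) auto
    also have "\<dots> \<le> ennreal K * mass (\<lambda>x. ?h x powr q * w x) UNIV"
      unfolding q_def K_def
      by (rule weak_type) (use f0 fJ l in \<open>auto split: split_indicator\<close>)
    also have "mass (\<lambda>x. ?h x powr q * w x) UNIV = mass (\<lambda>x. f x powr q * w x) {x. l / 2 < f x}"
      unfolding mass_def by (intro nn_integral_cong) (auto split: split_indicator)
    finally have le: "ennreal ((l / 2) powr q) * mass W (exceed f l)
      \<le> ennreal K * mass (\<lambda>x. f x powr q * w x) {x. l / 2 < f x}" .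
    have inv: "ennreal ((l / 2) powr (- q)) * ennreal ((l / 2) powr q) = 1"
      using l by (simp add: ennreal_mult'[symmetric] powr_minus)
    have const: "ennreal ((l / 2) powr (- q)) * ennreal K = ennreal (K * 2 powr q * l powr (- q))"
      using l K by (simp add: ennreal_mult'[symmetric] powr_minus powr_divide field_simps)
    have "mass W (exceed f l) = ennreal ((l / 2) powr (- q)) * (ennreal ((l / 2) powr q) * mass W (exceed f l))"
      by (simp only: mult.assoc[symmetric] inv mult_1)
    also have "\<dots> \<le> ennreal ((l / 2) powr (- q)) * (ennreal K * mass (\<lambda>x. f x powr q * w x) {x. l / 2 < f x})"
      by (intro mult_left_mono le) simp
    also have "\<dots> = ennreal (K * 2 powr q * l powr (- q)) * mass (\<lambda>x. f x powr q * w x) {x. l / 2 < f x}"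
      by (simp only: mult.assoc[symmetric] const)
    finally show ?thesis .
  qed
  let ?J1 = "\<lambda>x l. if 0 < l \<and> ennreal l < right_maximal f x then ennreal (p * l powr (p - 1)) * ennreal (W x) else 0"
  let ?J2 = "\<lambda>x l. if 0 < l \<and> l < 2 * f x then ennreal (p * K * 2 powr q * l powr (p - q - 1)) * ennreal (f x powr q * w x) else 0"
  have "(\<integral>\<^sup>+x. ennreal_powr (right_maximal f x) p * ennreal (W x) \<partial>lborel) \<le> (\<integral>\<^sup>+x. \<integral>\<^sup>+l. ?J1 x l \<partial>lborel \<partial>lborel)"
  proof (rule nn_integral_mono)
    fix x
    have "ennreal_powr (right_maximal f x) p * ennreal (W x)
      \<le> (\<integral>\<^sup>+l. (if 0 < l \<and> ennreal l < right_maximal f x then ennreal (p * l powr (p - 1)) else 0) \<partial>lborel) * ennreal (W x)"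
      by (intro mult_right_mono ennreal_powr_le_layers p0) simp
    also have "\<dots> = (\<integral>\<^sup>+l. (if 0 < l \<and> ennreal l < right_maximal f x then ennreal (p * l powr (p - 1)) else 0) * ennreal (W x) \<partial>lborel)"
      by (rule nn_integral_multc[symmetric]) measurable
    also have "\<dots> = (\<integral>\<^sup>+l. ?J1 x l \<partial>lborel)" by (intro nn_integral_cong) auto
    finally show "ennreal_powr (right_maximal f x) p * ennreal (W x) \<le> (\<integral>\<^sup>+l. ?J1 x l \<partial>lborel)" .
  qed
  also have "\<dots> = (\<integral>\<^sup>+l. \<integral>\<^sup>+x. ?J1 x l \<partial>lborel \<partial>lborel)"
    by (rule lborel_pair.Fubini'[symmetric]) measurable
  also have "\<dots> \<le> (\<integral>\<^sup>+l. \<integral>\<^sup>+x. ?J2 x l \<partial>lborel \<partial>lborel)"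
  proof (rule nn_integral_mono)
    fix l :: real
    show "(\<integral>\<^sup>+x. ?J1 x l \<partial>lborel) \<le> (\<integral>\<^sup>+x. ?J2 x l \<partial>lborel)"
    proof (cases "0 < l")
      case True
      have [measurable]: "exceed f l \<in> sets borel" using exceed_measurable[OF f] True by simp
      have "(\<integral>\<^sup>+x. ?J1 x l \<partial>lborel)
        = (\<integral>\<^sup>+x. ennreal (p * l powr (p - 1)) * (ennreal (W x) * indicator (exceed f l) x) \<partial>lborel)"
        using True by (intro nn_integral_cong) (auto simp: less_right_maximal_iff split: split_indicator)
      also have "\<dots> = ennreal (p * l powr (p - 1)) * mass W (exceed f l)"
        unfolding mass_def by (rule nn_integral_cmult) measurable
      also have "\<dots> \<le> ennreal (p * l powr (p - 1)) *
         (ennreal (K * 2 powr q * l powr (- q)) * mass (\<lambda>x. f x powr q * w x) {x. l / 2 < f x})"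
        using level[OF True] by (intro mult_left_mono) auto
      also have "\<dots> = (ennreal (p * l powr (p - 1)) * ennreal (K * 2 powr q * l powr (- q)))
         * mass (\<lambda>x. f x powr q * w x) {x. l / 2 < f x}" by (simp only: mult.assoc)
      also have "ennreal (p * l powr (p - 1)) * ennreal (K * 2 powr q * l powr (- q))
        = ennreal (p * K * 2 powr q * l powr (p - q - 1))"
      proof -
        have "l powr (p - 1) * l powr (- q) = l powr (p - q - 1)"
          by (simp add: powr_add[symmetric] algebra_simps)
        then have "p * l powr (p - 1) * (K * 2 powr q * l powr (- q)) = p * K * 2 powr q * l powr (p - q - 1)"
          by (metis mult.commute mult.left_commute)
        moreover have "ennreal (p * l powr (p - 1)) * ennreal (K * 2 powr q * l powr (- q))
          = ennreal (p * l powr (p - 1) * (K * 2 powr q * l powr (- q)))"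
          using p0 by (intro ennreal_mult'[symmetric]) simp
        ultimately show ?thesis by (simp only:)
      qed
      also have "ennreal (p * K * 2 powr q * l powr (p - q - 1)) * mass (\<lambda>x. f x powr q * w x) {x. l / 2 < f x}
        = (\<integral>\<^sup>+x. ennreal (p * K * 2 powr q * l powr (p - q - 1)) *
            (ennreal (f x powr q * w x) * indicator {x. l / 2 < f x} x) \<partial>lborel)"
        unfolding mass_def by (rule nn_integral_cmult[symmetric]) measurable
      also have "\<dots> = (\<integral>\<^sup>+x. ?J2 x l \<partial>lborel)"
        using True by (intro nn_integral_cong) (auto split: split_indicator)
      finally show ?thesis .
    next
      case False
      then show ?thesis by simp
    qed
  qed
  also have "\<dots> = (\<integral>\<^sup>+x. \<integral>\<^sup>+l. ?J2 x l \<partial>lborel \<partial>lborel)"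
    by (rule lborel_pair.Fubini') measurable
  also have "\<dots> = (\<integral>\<^sup>+x. ennreal (p * K * 2 powr p / (p - q)) * ennreal (f x powr p * w x) \<partial>lborel)"
  proof (rule nn_integral_cong)
    fix x
    let ?C = "p * K * 2 powr q / (p - q)"
    show "(\<integral>\<^sup>+l. ?J2 x l \<partial>lborel) = ennreal (p * K * 2 powr p / (p - q)) * ennreal (f x powr p * w x)"
    proof (cases "f x = 0")
      case True
      have "(\<integral>\<^sup>+l. ?J2 x l \<partial>lborel) = (\<integral>\<^sup>+l. 0 \<partial>(lborel :: real measure))"
        using True by (intro nn_integral_cong) auto
      then show ?thesis using True by simp
    next
      case False
      then have fx: "0 < f x" using f0[of x] by simp
      have C0: "0 \<le> ?C * (f x powr q * w x)" using p0 K q wpos[of x] by simp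
      have "(\<integral>\<^sup>+l. ?J2 x l \<partial>lborel)
        = (\<integral>\<^sup>+l. ennreal (?C * (f x powr q * w x)) * (ennreal ((p - q) * l powr (p - q - 1)) * indicator {0<..<2 * f x} l) \<partial>lborel)"
      proof (rule nn_integral_cong)
        fix l
        have "p * K * 2 powr q * l powr (p - q - 1) * (f x powr q * w x)
          = ?C * (f x powr q * w x) * ((p - q) * l powr (p - q - 1))" using q by (simp add: field_simps)
        moreover have "0 \<le> p * K * 2 powr q * l powr (p - q - 1)" using p0 K by simp
        ultimately have "ennreal (p * K * 2 powr q * l powr (p - q - 1)) * ennreal (f x powr q * w x)
          = ennreal (?C * (f x powr q * w x)) * ennreal ((p - q) * l powr (p - q - 1))"
          using C0 by (simp only: ennreal_mult'[symmetric])
        then show "?J2 x l = ennreal (?C * (f x powr q * w x)) * (ennreal ((p - q) * l powr (p - q - 1)) * indicator {0<..<2 * f x} l)"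
          by (auto split: split_indicator)
      qed
      also have "\<dots> = ennreal (?C * (f x powr q * w x)) * mass (\<lambda>l. (p - q) * l powr (p - q - 1)) {0<..<2 * f x}"
        unfolding mass_def by (rule nn_integral_cmult) measurable
      also have "\<dots> = ennreal (?C * (f x powr q * w x)) * ennreal ((2 * f x) powr (p - q))"
        using q fx by (subst mass_powr_0) auto
      also have "\<dots> = ennreal (?C * (f x powr q * w x) * (2 * f x) powr (p - q))"
        by (rule ennreal_mult'[symmetric]) (rule C0)
      also have "?C * (f x powr q * w x) * (2 * f x) powr (p - q) = p * K * 2 powr p / (p - q) * (f x powr p * w x)"
      proof -
        have "2 powr q * (2::real) powr (p - q) = 2 powr p" "f x powr q * f x powr (p - q) = f x powr p"
          by (simp_all add: powr_add[symmetric])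
        then show ?thesis using fx by (simp add: powr_mult) (metis mult.assoc mult.commute)
      qed
      also have "ennreal \<dots> = ennreal (p * K * 2 powr p / (p - q)) * ennreal (f x powr p * w x)"
        using p0 K q by (intro ennreal_mult') simp
      finally show ?thesis .
    qed
  qed
  also have "\<dots> = ennreal (p * K * 2 powr p / (p - q)) * mass (\<lambda>x. f x powr p * w x) UNIV"
    unfolding mass_def by (subst nn_integral_cmult) auto
  finally show ?thesis by (simp add: K_def q_def)
qed

end

text \<open>The weight satisfies the condition for a smaller exponent \<open>1 + r'\<close>, hence
the strong type inequality holds at the exponent \<open>1 + r\<close>.\<close>

lemma (in one_sided_weight) muckenhoupt_strong_type:
  obtains C where "0 \<le> C" "\<And>f. f \<in> borel_measurable borel \<Longrightarrow> (\<And>x. 0 \<le> f x) \<Longrightarrow> (\<And>x. x \<notin> J \<Longrightarrow> f x = 0) \<Longrightarrow>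
    (\<integral>\<^sup>+x. ennreal_powr (right_maximal f x) (1 + r) * ennreal (W x) \<partial>lborel) \<le> ennreal C * mass (\<lambda>x. f x powr (1 + r) * w x) UNIV"
proof -
  obtain e B where e: "0 < e" "0 \<le> B"
    "two_weight_gap (r / (1 + e)) B W (\<lambda>x. w x powr (-1 / (r / (1 + e))) * indicator J x)"
    using exists_gap_improvement by blast
  define r' where "r' = r / (1 + e)"
  have r': "0 < r'" "r' < r" using r e by (auto simp: r'_def divide_less_eq)
  obtain B' where B': "0 \<le> B'" "two_weight r' B' W (\<lambda>x. w x powr (-1 / r') * indicator J x)"
    using two_weight_of_gap[OF e(3)[folded r'_def] r'(1) e(2)] by (auto simp: measurable)
  interpret improved: one_sided_weight J w r' B'
    by unfold_locales (use J iv w wpos r' B' in auto)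
  let ?C = "(1 + r) * (8 powr (1 + r') * (B' + 1)) * 2 powr (1 + r) / (1 + r - (1 + r'))"
  have "0 \<le> ?C" using r r' B' by simp
  then show ?thesis by (rule that) (rule improved.strong_type, use r' in auto)
qed

section \<open>Boundedness of the right maximal operator\<close>

lemma space_weighted_measure [simp]: "space (weighted_measure J w) = J"
  by (simp add: weighted_measure_def)

lemma measurable_weighted_measure [simp]:
  "borel_measurable (weighted_measure J w) = borel_measurable (lebesgue_on J)"
  by (intro measurable_cong_sets) (simp_all add: weighted_measure_def)

lemma lebesgue_on_AE_borel:
  fixes g :: "real \<Rightarrow> real"
  assumes "g \<in> borel_measurable (lebesgue_on J)" "J \<in> sets borel"
  obtains h where "h \<in> borel_measurable borel" "AE x in lborel. x \<in> J \<longrightarrow> g x = h x"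
proof -
  have "(\<lambda>x. indicator J x *\<^sub>R g x) \<in> borel_measurable lebesgue"
    using assms by (subst (asm) borel_measurable_restrict_space_iff) auto
  then obtain h where h: "h \<in> borel_measurable lborel" "AE x in lborel. indicator J x *\<^sub>R g x = h x"
    using completion_ex_borel_measurable_real by blast
  have "AE x in lborel. x \<in> J \<longrightarrow> g x = h x" using h(2) by eventually_elim auto
  then show ?thesis using that h(1) by simp
qed

text \<open>A weight agrees almost everywhere on \<open>J\<close> with a Borel function that is
positive everywhere.\<close>

lemma weight_AE_borel:
  assumes w: "weight_on J w" and J: "J \<in> sets borel"
  obtains v where "v \<in> borel_measurable borel" "\<And>x. 0 < v x" "AE x in lborel. x \<in> J \<longrightarrow> w x = v x"
proof -
  obtain h where h[measurable]: "h \<in> borel_measurable borel" and ae: "AE x in lborel. x \<in> J \<longrightarrow> w x = h x"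
    using lebesgue_on_AE_borel[OF _ J] w unfolding weight_on_def by blast
  have "AE x in lebesgue_on J. 0 < w x" using w by (simp add: weight_on_def)
  then have "AE x in lebesgue. x \<in> J \<longrightarrow> 0 < w x" using J by (subst (asm) AE_restrict_space_iff) auto
  then have "AE x in lborel. x \<in> J \<longrightarrow> 0 < w x" by (simp add: AE_completion_iff)
  with ae have "AE x in lborel. x \<in> J \<longrightarrow> w x = (if 0 < h x then h x else 1)"
    by eventually_elim auto
  then show ?thesis using that[of "\<lambda>x. if 0 < h x then h x else 1"] by auto
qed

lemma nn_integral_weighted_measure:
  assumes w: "weight_on J w" and J: "J \<in> sets borel" and ae: "AE x in lborel. x \<in> J \<longrightarrow> w x = v x"
    and h: "h \<in> borel_measurable (lebesgue_on J)"
  shows "(\<integral>\<^sup>+x. h x \<partial>weighted_measure J w) = (\<integral>\<^sup>+x. h x * ennreal (v x * indicator J x) \<partial>lborel)"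
proof -
  have "w \<in> borel_measurable (lebesgue_on J)" using w by (simp add: weight_on_def)
  then have wm: "(\<lambda>x. ennreal (w x)) \<in> borel_measurable (lebesgue_on J)" by measurable
  have "(\<integral>\<^sup>+x. h x \<partial>weighted_measure J w) = (\<integral>\<^sup>+x. ennreal (w x) * h x \<partial>lebesgue_on J)"
    unfolding weighted_measure_def by (rule nn_integral_density[OF wm h])
  also have "\<dots> = (\<integral>\<^sup>+x. ennreal (w x) * h x * indicator J x \<partial>lborel)"
    using J by (subst nn_integral_restrict_space) (auto simp: nn_integral_completion)
  also have "\<dots> = (\<integral>\<^sup>+x. h x * ennreal (v x * indicator J x) \<partial>lborel)"
    by (rule nn_integral_cong_AE, use ae in eventually_elim) (auto simp: mult.commute split: split_indicator)
  finally show ?thesis .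
qed

lemma maximal_plus_eq_right_maximal:
  assumes "AE x in lborel. norm (F x) = g x"
  shows "maximal_plus F = right_maximal g"
proof
  fix t
  have eq: "(\<integral>\<^sup>+s\<in>{t..t + h}. ennreal (norm (F s)) \<partial>lebesgue) = mass g {t<..<t + h}" for h
    unfolding mass_closed_open(1)[symmetric] unfolding mass_def nn_integral_completion
    by (rule nn_integral_cong_AE, use assms in eventually_elim) simp
  have im: "{t<..} = (\<lambda>h. t + h) ` {0<..}"
    by (auto intro: image_eqI[of _ _ "x - t" for x])
  show "maximal_plus F t = right_maximal g t"
    unfolding maximal_plus_def right_maximal_def im eq by (simp add: image_image)
qed

lemma Lp_norm_le_iff:
  assumes p: "0 < p" and C: "0 \<le> C"
  shows "Lp_norm p M g \<le> ennreal C * Lp_norm p M h \<longleftrightarrow>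
    (\<integral>\<^sup>+x. ennreal_powr (g x) p \<partial>M) \<le> ennreal (C powr p) * (\<integral>\<^sup>+x. ennreal_powr (h x) p \<partial>M)"
    (is "_ \<longleftrightarrow> ?G \<le> _ * ?H")
proof -
  have inv: "ennreal_powr (ennreal_powr x (1 / p)) p = x" "ennreal_powr (ennreal_powr x p) (1 / p) = x" for x
    using p by (simp_all add: ennreal_powr_powr)
  have eq: "ennreal_powr (ennreal C * Lp_norm p M h) p = ennreal (C powr p) * ?H"
    using p C by (simp add: ennreal_powr_cmult Lp_norm_def inv)
  show ?thesis
  proof
    assume "Lp_norm p M g \<le> ennreal C * Lp_norm p M h"
    then have "ennreal_powr (Lp_norm p M g) p \<le> ennreal_powr (ennreal C * Lp_norm p M h) p"
      using p by (intro ennreal_powr_mono)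
    then show "?G \<le> ennreal (C powr p) * ?H" by (simp add: eq) (simp add: Lp_norm_def inv)
  next
    assume "?G \<le> ennreal (C powr p) * ?H"
    then have "ennreal_powr ?G (1 / p) \<le> ennreal_powr (ennreal_powr (ennreal C * Lp_norm p M h) p) (1 / p)"
      using p unfolding eq by (intro ennreal_powr_mono) auto
    then show "Lp_norm p M g \<le> ennreal C * Lp_norm p M h" by (simp only: inv) (simp add: Lp_norm_def)
  qed
qed

lemma one_minus_conjugate_exponent: "1 < p \<Longrightarrow> 1 - conjugate_exponent p = -1 / (p - 1)"
  by (simp add: conjugate_exponent_def field_simps)

lemma weight_integrals:
  assumes iv: "is_interval J" and ae: "AE x in lborel. x \<in> J \<longrightarrow> w x = v x" and ab: "a \<in> J" "b \<in> J"
    and p: "1 < p"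
  shows "(\<integral>\<^sup>+t\<in>{a..b}. ennreal (w t) \<partial>lebesgue) = mass (\<lambda>x. v x * indicator J x) {a<..<b}"
    and "(\<integral>\<^sup>+t\<in>{a..b}. ennreal (w t powr (1 - conjugate_exponent p)) \<partial>lebesgue)
      = mass (\<lambda>x. v x powr (-1 / (p - 1)) * indicator J x) {a<..<b}"
proof -
  have J: "x \<in> J" if "a \<le> x" "x \<le> b" for x using mem_is_interval_1_I[OF iv ab that] .
  show "(\<integral>\<^sup>+t\<in>{a..b}. ennreal (w t) \<partial>lebesgue) = mass (\<lambda>x. v x * indicator J x) {a<..<b}"
    unfolding mass_closed_open(1)[symmetric] unfolding mass_def nn_integral_completion
    by (rule nn_integral_cong_AE, use ae in eventually_elim) (use J in \<open>auto split: split_indicator\<close>)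
  show "(\<integral>\<^sup>+t\<in>{a..b}. ennreal (w t powr (1 - conjugate_exponent p)) \<partial>lebesgue)
      = mass (\<lambda>x. v x powr (-1 / (p - 1)) * indicator J x) {a<..<b}"
    unfolding mass_closed_open(1)[symmetric] unfolding mass_def nn_integral_completion one_minus_conjugate_exponent[OF p]
    by (rule nn_integral_cong_AE, use ae in eventually_elim) (use J in \<open>auto split: split_indicator\<close>)
qed

lemma closed_interval_trim:
  fixes J :: "real set"
  assumes "closed J" "b \<in> J" "a \<le> b"
  obtains a' where "a' \<in> J" "a \<le> a'" "\<And>x. x \<in> J \<Longrightarrow> a < x \<Longrightarrow> a' \<le> x"
proof -
  let ?S = "J \<inter> {a..}"
  have S: "closed ?S" "?S \<noteq> {}" "bdd_below ?S" using assms by (auto intro: bdd_belowI[of _ a])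
  have "Inf ?S \<in> ?S" by (rule closed_contains_Inf[OF S(2,3,1)])
  then show ?thesis by (intro that[of "Inf ?S"]) (auto intro!: cInf_lower S)
qed

lemma closed_interval_trim_right:
  fixes J :: "real set"
  assumes "closed J" "b \<in> J" "b \<le> c"
  obtains c' where "c' \<in> J" "c' \<le> c" "\<And>x. x \<in> J \<Longrightarrow> x < c \<Longrightarrow> x \<le> c'"
proof -
  let ?S = "J \<inter> {..c}"
  have S: "closed ?S" "?S \<noteq> {}" "bdd_above ?S" using assms by (auto intro: bdd_aboveI[of _ c])
  have "Sup ?S \<in> ?S" by (rule closed_contains_Sup[OF S(2,3,1)])
  then show ?thesis by (intro that[of "Sup ?S"]) (auto intro!: cSup_upper S)
qed

text \<open>The condition for intervals in \<open>J\<close> implies the condition on the real line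
for the weights extended by zero: intervals that overlap \<open>J\<close> only partly are cut down
to \<open>J\<close>, and closedness of \<open>J\<close> provides the end points.\<close>

lemma two_weight_of_Ap_plus:
  assumes iv: "is_interval J" and cl: "closed J" and p: "1 < p"
    and ae: "AE x in lborel. x \<in> J \<longrightarrow> w x = v x" and fin: "Ap_plus_const p J w < \<infinity>"
  shows "two_weight (p - 1) (enn2real (Ap_plus_const p J w)) (\<lambda>x. v x * indicator J x)
    (\<lambda>x. v x powr (-1 / (p - 1)) * indicator J x)"
  unfolding two_weight_def
proof (intro allI impI)
  let ?W = "\<lambda>x. v x * indicator J x" and ?S = "\<lambda>x. v x powr (-1 / (p - 1)) * indicator J x"
  define A where "A = enn2real (Ap_plus_const p J w)"
  have A: "Ap_plus_const p J w = ennreal A" "0 \<le> A" using fin by (auto simp: A_def)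
  fix a b c u y :: real
  assume abc: "a < b" "b < c" and u0: "0 \<le> u" and y0: "0 \<le> y"
    and u: "ennreal u \<le> mass ?W {a<..<b}" and y: "ennreal y \<le> mass ?S {b<..<c}"
  show "u * y powr (p - 1) \<le> enn2real (Ap_plus_const p J w) * (c - a) powr (1 + (p - 1))"
  proof (cases "u = 0 \<or> y = 0")
    case True
    then show ?thesis using A_def A by auto
  next
    case False
    then have "mass ?W {a<..<b} \<noteq> 0" using u u0 by auto
    then obtain s where "s \<in> {a<..<b}" "?W s \<noteq> 0" using mass_eq_0[of "{a<..<b}" ?W] by blast
    then have s: "s \<in> J" "a < s" "s < b" by (auto split: split_indicator_asm)
    have "mass ?S {b<..<c} \<noteq> 0" using False y y0 by auto
    then obtain t where "t \<in> {b<..<c}" "?S t \<noteq> 0" using mass_eq_0[of "{b<..<c}" ?S] by blast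
    then have t: "t \<in> J" "b < t" "t < c" by (auto split: split_indicator_asm)
    have b: "b \<in> J" using mem_is_interval_1_I[OF iv s(1) t(1), of b] s t by simp
    obtain a' where a': "a' \<in> J" "a \<le> a'" "\<And>x. x \<in> J \<Longrightarrow> a < x \<Longrightarrow> a' \<le> x"
      using closed_interval_trim[OF cl b, of a] abc by auto
    obtain c' where c': "c' \<in> J" "c' \<le> c" "\<And>x. x \<in> J \<Longrightarrow> x < c \<Longrightarrow> x \<le> c'"
      using closed_interval_trim_right[OF cl b, of c] abc by auto
    have ac: "a' < b" "b < c'" using a'(3)[OF s(1,2)] s c'(3)[OF t(1,3)] t by auto
    have "mass ?W {a<..<b} \<le> mass ?W {a'..<b}"
      unfolding mass_indicator using a'(3) by (intro mass_mono_set) auto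
    then have u': "ennreal u \<le> mass ?W {a'<..<b}" using u by (simp add: mass_closed_open)
    have "mass ?S {b<..<c} \<le> mass ?S {b<..c'}"
      unfolding mass_indicator using c'(3) by (intro mass_mono_set) auto
    then have y': "ennreal y \<le> mass ?S {b<..<c'}" using y by (simp add: mass_closed_open)
    have "ennreal (1 / (c' - a') powr p * u * y powr (p - 1))
      = ennreal (1 / (c' - a') powr p) * ennreal u * ennreal_powr (ennreal y) (p - 1)"
      using u0 y0 by (simp add: ennreal_mult'[symmetric])
    also have "\<dots> \<le> ennreal (1 / (c' - a') powr p) * mass ?W {a'<..<b} * ennreal_powr (mass ?S {b<..<c'}) (p - 1)"
      using u' y' p by (intro mult_mono ennreal_powr_mono) auto
    also have "\<dots> = ennreal (1 / (c' - a') powr p) * (\<integral>\<^sup>+ t\<in>{a'..b}. ennreal (w t) \<partial>lebesgue) *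
        ennreal_powr (\<integral>\<^sup>+ t\<in>{b..c'}. ennreal (w t powr (1 - conjugate_exponent p)) \<partial>lebesgue) (p - 1)"
      using weight_integrals(1)[OF iv ae a'(1) b p] weight_integrals(2)[OF iv ae b c'(1) p] by (simp only:)
    also have "\<dots> \<le> Ap_plus_const p J w"
      unfolding Ap_plus_const_def by (rule SUP_upper2[of "(a', b, c')"]) (use a' b c' ac in auto)
    finally have "1 / (c' - a') powr p * u * y powr (p - 1) \<le> A" using A by simp
    then have "u * y powr (p - 1) \<le> A * (c' - a') powr p" using ac by (simp add: field_simps)
    also have "\<dots> \<le> A * (c - a) powr p"
      using A a' c' ac p by (intro mult_left_mono powr_mono2) auto
    finally show ?thesis by (simp add: A_def)
  qed
qed

lemma maximal_plus_bounded_if_Ap_plus: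
  assumes iv: "is_interval J" and cl: "closed J" and p: "1 < p" and wt: "weight_on J w"
    and fin: "Ap_plus_const p J w < \<infinity>"
  shows "bounded_on_Lp p (weighted_measure J w) (maximal_plus_on J)"
proof -
  have J: "J \<in> sets borel" using cl by simp
  let ?M = "weighted_measure J w"
  obtain v where v[measurable]: "v \<in> borel_measurable borel" and vpos: "\<And>x. 0 < v x"
    and ae: "AE x in lborel. x \<in> J \<longrightarrow> w x = v x"
    using weight_AE_borel[OF wt J] by blast
  interpret one_sided_weight J v "p - 1" "enn2real (Ap_plus_const p J w)"
    by unfold_locales (use J iv vpos p two_weight_of_Ap_plus[OF iv cl p ae fin] in auto)
  obtain C where C: "0 \<le> C" and strong: "\<And>f. f \<in> borel_measurable borel \<Longrightarrow> (\<And>x. 0 \<le> f x) \<Longrightarrow>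
      (\<And>x. x \<notin> J \<Longrightarrow> f x = 0) \<Longrightarrow>
      (\<integral>\<^sup>+x. ennreal_powr (right_maximal f x) p * ennreal (v x * indicator J x) \<partial>lborel) \<le> ennreal C * mass (\<lambda>x. f x powr p * v x) UNIV"
    using muckenhoupt_strong_type by auto
  have "maximal_plus_on J f \<in> borel_measurable ?M \<and>
      Lp_norm p ?M (maximal_plus_on J f) \<le> ennreal (C powr (1 / p)) * Lp_norm p ?M (\<lambda>t. ennreal (norm (f t)))"
    if f: "f \<in> Lp_functions p ?M" for f
  proof -
    have fm: "f \<in> borel_measurable (lebesgue_on J)" using f by (simp add: Lp_functions_def)
    then have "(\<lambda>x. norm (f x)) \<in> borel_measurable (lebesgue_on J)" by measurable
    then obtain h where h[measurable]: "h \<in> borel_measurable borel"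
      and fh: "AE x in lborel. x \<in> J \<longrightarrow> norm (f x) = h x"
      using lebesgue_on_AE_borel[OF _ J] by blast
    define g where "g = (\<lambda>x. max 0 (h x) * indicator J x)"
    have g[measurable]: "g \<in> borel_measurable borel" unfolding g_def by measurable
    have g0: "0 \<le> g x" "x \<notin> J \<Longrightarrow> g x = 0" for x by (auto simp: g_def)
    have fg: "AE x in lborel. x \<in> J \<longrightarrow> norm (f x) = g x"
      using fh
    proof eventually_elim
      case (elim x)
      then have "x \<in> J \<Longrightarrow> 0 \<le> h x" by (metis norm_ge_zero)
      then show ?case using elim by (auto simp: g_def max_def)
    qed
    then have "AE x in lborel. norm (extend_zero J f x) = g x"
      by eventually_elim (auto simp: extend_zero_def g0)
    then have max: "maximal_plus (extend_zero J f) = right_maximal g" by (rule maximal_plus_eq_right_maximal)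
    have on: "maximal_plus_on J f = (\<lambda>t. indicator J t * right_maximal g t)"
      by (auto simp: maximal_plus_on_def max)
    have "(\<lambda>t. indicator J t * right_maximal g t) \<in> borel_measurable borel" by measurable
    then have Tm: "maximal_plus_on J f \<in> borel_measurable (lebesgue_on J)"
      unfolding on by (intro measurable_restrict_space1 measurable_completion) simp
    have "(\<integral>\<^sup>+t. ennreal_powr (maximal_plus_on J f t) p \<partial>?M)
      = (\<integral>\<^sup>+t. ennreal_powr (maximal_plus_on J f t) p * ennreal (v t * indicator J t) \<partial>lborel)"
      by (rule nn_integral_weighted_measure[OF wt J ae]) (use Tm in measurable)
    also have "\<dots> = (\<integral>\<^sup>+t. ennreal_powr (right_maximal g t) p * ennreal (v t * indicator J t) \<partial>lborel)"
      unfolding on by (intro nn_integral_cong) (auto split: split_indicator)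
    also have "\<dots> \<le> ennreal C * mass (\<lambda>x. g x powr p * v x) UNIV"
      by (rule strong[OF g]) (use g0 in auto)
    also have "mass (\<lambda>x. g x powr p * v x) UNIV
      = (\<integral>\<^sup>+t. ennreal_powr (ennreal (norm (f t))) p * ennreal (v t * indicator J t) \<partial>lborel)"
      unfolding mass_def
      by (rule nn_integral_cong_AE, use fg in eventually_elim)
         (use vpos g0 in \<open>auto simp: ennreal_mult' split: split_indicator\<close>)
    also have "\<dots> = (\<integral>\<^sup>+t. ennreal_powr (ennreal (norm (f t))) p \<partial>?M)"
      by (rule nn_integral_weighted_measure[OF wt J ae, symmetric]) (use fm in measurable)
    finally show ?thesis using Tm C p by (simp add: Lp_norm_le_iff powr_powr)
  qed
  then show ?thesis unfolding bounded_on_Lp_def by blast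
qed

text \<open>The test functions are the truncations of the dual weight \<open>S = w\<^bsup>- 1/(p -
1)\<^esup>\<close> to the part of \<open>(b, c)\<close> on which \<open>S \<le> n\<close>. They lie
in \<open>L\<^sup>p\<^sub>w\<close> since \<open>S\<^sup>p w = S\<close>, and their maximal function
is at least \<open>1/(c - a)\<close> times their integral on \<open>(a, b)\<close>.\<close>

lemma Ap_plus_if_maximal_plus_bounded:
  assumes iv: "is_interval J" and J: "J \<in> sets borel" and p: "1 < p" and w: "weight_on J w"
    and bd: "bounded_on_Lp p (weighted_measure J w) (maximal_plus_on J)"
  shows "Ap_plus_const p J w < \<infinity>"
proof -
  let ?M = "weighted_measure J w"
  obtain C0 where C0: "\<And>f. f \<in> Lp_functions p ?M \<Longrightarrow>
      Lp_norm p ?M (maximal_plus_on J f) \<le> ennreal C0 * Lp_norm p ?M (\<lambda>t. ennreal (norm (f t)))"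
    using bd unfolding bounded_on_Lp_def by blast
  define C where "C = max C0 0"
  have C: "0 \<le> C" "ennreal C0 \<le> ennreal C" by (auto simp: C_def intro: ennreal_leI)
  obtain v where v[measurable]: "v \<in> borel_measurable borel" and vpos: "\<And>x. 0 < v x"
    and ae: "AE x in lborel. x \<in> J \<longrightarrow> w x = v x"
    using weight_AE_borel[OF w J] by blast
  let ?W = "\<lambda>x. v x * indicator J x" and ?S = "\<lambda>x. v x powr (-1 / (p - 1)) * indicator J x"
  have W[measurable]: "?W \<in> borel_measurable borel" and S[measurable]: "?S \<in> borel_measurable borel"
    using J by measurable
  have main: "ennreal (1 / (c - a) powr p) * mass ?W {a<..<b} * ennreal_powr (mass ?S {b<..<c}) (p - 1)
     \<le> ennreal (C powr p)" if abc: "a \<in> J" "b \<in> J" "c \<in> J" "a < b" "b < c" for a b c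
  proof -
    have Jac: "x \<in> J" if "a \<le> x" "x \<le> c" for x using mem_is_interval_1_I[OF iv abc(1,3) that] .
    define s where "s = (\<lambda>n::nat. \<lambda>x. ?S x * indicator ({b<..<c} \<inter> {x. ?S x \<le> real n}) x)"
    have s[measurable]: "s n \<in> borel_measurable borel" for n unfolding s_def by measurable
    have s0: "0 \<le> s n x" "x \<notin> J \<Longrightarrow> s n x = 0" "x \<notin> {b<..<c} \<Longrightarrow> s n x = 0" for n x
      by (auto simp: s_def split: split_indicator)
    have each: "ennreal (1 / (c - a) powr p) * mass ?W {a<..<b} * ennreal_powr (mass (s n) UNIV) (p - 1)
       \<le> ennreal (C powr p)" for n
    proof -
      define f where "f = (\<lambda>x. complex_of_real (s n x))"
      have nf: "norm (f x) = s n x" for x using s0 by (simp add: f_def)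
      have "f \<in> borel_measurable borel" unfolding f_def by measurable
      then have fm: "f \<in> borel_measurable (lebesgue_on J)"
        by (intro measurable_restrict_space1 measurable_completion) simp
      have "mass (s n) UNIV = mass (s n) {b<..<c}"
        unfolding mass_def using s0 by (intro nn_integral_cong) (auto split: split_indicator)
      also have "\<dots> \<le> mass (\<lambda>_. real n) {b<..<c}"
        by (intro mass_mono) (auto simp: s_def split: split_indicator)
      also have "\<dots> < \<infinity>" using abc by (simp add: mass_const)
      finally obtain y where y: "mass (s n) UNIV = ennreal y" "0 \<le> y" by (cases "mass (s n) UNIV") auto
      have If: "(\<integral>\<^sup>+t. ennreal_powr (ennreal (norm (f t))) p \<partial>?M) = ennreal y"
      proof -
        have "(\<integral>\<^sup>+t. ennreal_powr (ennreal (norm (f t))) p \<partial>?M)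
          = (\<integral>\<^sup>+t. ennreal_powr (ennreal (norm (f t))) p * ennreal (?W t) \<partial>lborel)"
          by (rule nn_integral_weighted_measure[OF w J ae]) (use fm in measurable)
        also have "\<dots> = (\<integral>\<^sup>+t. ennreal (s n t) \<partial>lborel)"
        proof (rule nn_integral_cong)
          fix t
          have "s n t powr p * ?W t = s n t"
          proof (cases "s n t = 0")
            case False
            then have st: "s n t = v t powr (-1 / (p - 1))" "t \<in> J" by (auto simp: s_def split: split_indicator_asm)
            \<comment> \<open>\<open>S\<^sup>p w = S\<close>\<close>
            have "-1 / (p - 1) * p + 1 = -1 / (p - 1)" using p by (simp add: field_simps)
            then have "v t powr (-1 / (p - 1) * p) * v t powr 1 = v t powr (-1 / (p - 1))"
              by (simp only: powr_add[symmetric])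
            then show ?thesis using st vpos[of t] by (simp add: powr_powr)
          qed simp
          then show "ennreal_powr (ennreal (norm (f t))) p * ennreal (?W t) = ennreal (s n t)"
            using s0 by (simp add: nf ennreal_mult'[symmetric])
        qed
        also have "\<dots> = ennreal y" using y by (simp add: mass_def)
        finally show ?thesis .
      qed
      have "Lp_norm p ?M (\<lambda>t. ennreal (norm (f t))) = ennreal (y powr (1 / p))"
        unfolding Lp_norm_def If using y by simp
      then have fL: "f \<in> Lp_functions p ?M" using fm by (simp add: Lp_functions_def)
      have "Lp_norm p ?M (maximal_plus_on J f) \<le> ennreal C * Lp_norm p ?M (\<lambda>t. ennreal (norm (f t)))"
        using C0[OF fL] mult_right_mono[OF C(2)] by (rule order_trans) simp
      then have T: "(\<integral>\<^sup>+t. ennreal_powr (maximal_plus_on J f t) p \<partial>?M) \<le> ennreal (C powr p) * ennreal y"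
        using p C(1) Lp_norm_le_iff[of p C ?M] unfolding If[symmetric] by simp
      have max: "maximal_plus (extend_zero J f) = right_maximal (s n)"
        by (rule maximal_plus_eq_right_maximal) (use s0 in \<open>auto simp: extend_zero_def nf\<close>)
      have on: "maximal_plus_on J f = (\<lambda>t. indicator J t * right_maximal (s n) t)"
        by (auto simp: maximal_plus_on_def max)
      have "(\<lambda>t. indicator J t * right_maximal (s n) t) \<in> borel_measurable borel" using J by measurable
      then have Tm: "maximal_plus_on J f \<in> borel_measurable (lebesgue_on J)"
        unfolding on by (intro measurable_restrict_space1 measurable_completion) simp
      have low: "ennreal (y / (c - a)) \<le> maximal_plus_on J f t" if t: "a < t" "t < b" for t
      proof -
        have "ennreal (y / (c - a)) \<le> ennreal (1 / (c - t) * y)"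
          using t abc y by (intro ennreal_leI) (simp add: frac_le)
        also have "\<dots> = ennreal (1 / (c - t)) * mass (s n) UNIV" unfolding y(1) using t abc by (intro ennreal_mult') simp
        also have "mass (s n) UNIV \<le> mass (s n) {t<..<c}"
          unfolding mass_def using s0 t by (intro nn_integral_mono) (auto split: split_indicator)
        also have "ennreal (1 / (c - t)) * mass (s n) {t<..<c} \<le> right_maximal (s n) t"
          unfolding right_maximal_def by (rule SUP_upper) (use t abc in auto)
        finally show ?thesis using Jac[of t] t abc by (simp add: on mult_left_mono)
      qed
      have "ennreal ((y / (c - a)) powr p) * mass ?W {a<..<b}
        = (\<integral>\<^sup>+t. ennreal ((y / (c - a)) powr p) * (ennreal (?W t) * indicator {a<..<b} t) \<partial>lborel)"
        unfolding mass_def by (rule nn_integral_cmult[symmetric]) measurable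
      also have "\<dots> \<le> (\<integral>\<^sup>+t. ennreal_powr (maximal_plus_on J f t) p * ennreal (?W t) \<partial>lborel)"
      proof (rule nn_integral_mono)
        fix t
        show "ennreal ((y / (c - a)) powr p) * (ennreal (?W t) * indicator {a<..<b} t)
          \<le> ennreal_powr (maximal_plus_on J f t) p * ennreal (?W t)"
        proof (cases "t \<in> {a<..<b}")
          case True
          have "ennreal ((y / (c - a)) powr p) = ennreal_powr (ennreal (y / (c - a))) p"
            using y abc by simp
          also have "\<dots> \<le> ennreal_powr (maximal_plus_on J f t) p"
            using low[of t] True p by (intro ennreal_powr_mono) auto
          finally have "ennreal ((y / (c - a)) powr p) * ennreal (?W t)
            \<le> ennreal_powr (maximal_plus_on J f t) p * ennreal (?W t)" by (rule mult_right_mono) simp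
          then show ?thesis using True by simp
        qed simp
      qed
      also have "\<dots> = (\<integral>\<^sup>+t. ennreal_powr (maximal_plus_on J f t) p \<partial>?M)"
        by (rule nn_integral_weighted_measure[OF w J ae, symmetric]) (use Tm in measurable)
      also have "\<dots> \<le> ennreal (C powr p) * ennreal y" by (rule T)
      finally have est: "ennreal ((y / (c - a)) powr p) * mass ?W {a<..<b} \<le> ennreal (C powr p) * ennreal y" .
      show ?thesis
      proof (cases "y = 0")
        case True
        then show ?thesis by (simp add: y)
      next
        case False
        then have y0: "0 < y" using y by simp
        have "1 / (c - a) powr p * y powr (p - 1) = 1 / y * (y / (c - a)) powr p"
          using y0 abc by (simp add: powr_divide powr_diff)
        then have const: "ennreal (1 / (c - a) powr p) * ennreal (y powr (p - 1))
          = ennreal (1 / y) * ennreal ((y / (c - a)) powr p)"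
          using y0 by (simp only: ennreal_mult''[symmetric] powr_ge_zero)
        have "ennreal (1 / (c - a) powr p) * mass ?W {a<..<b} * ennreal_powr (mass (s n) UNIV) (p - 1)
          = ennreal (1 / (c - a) powr p) * ennreal (y powr (p - 1)) * mass ?W {a<..<b}"
          using y by (simp add: mult_ac)
        also have "\<dots> = ennreal (1 / y) * (ennreal ((y / (c - a)) powr p) * mass ?W {a<..<b})"
          unfolding const by (simp only: mult.assoc)
        also have "\<dots> \<le> ennreal (1 / y) * (ennreal (C powr p) * ennreal y)"
          using est by (rule mult_left_mono) simp
        also have "\<dots> = ennreal (C powr p)" using y0 by (simp add: ennreal_mult'[symmetric])
        finally show ?thesis .
      qed
    qed
    have inc: "incseq (\<lambda>n x. ennreal (s n x))"
      by (intro monoI le_funI ennreal_leI) (auto simp: s_def split: split_indicator)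
    have sup: "(SUP n. ennreal (s n x)) = ennreal (?S x) * indicator {b<..<c} x" for x
    proof (rule antisym)
      show "(SUP n. ennreal (s n x)) \<le> ennreal (?S x) * indicator {b<..<c} x"
        by (rule SUP_least) (auto simp: s_def split: split_indicator)
      obtain n :: nat where n: "?S x \<le> real n" using real_arch_simple by blast
      have "ennreal (?S x) * indicator {b<..<c} x = ennreal (s n x)"
        using n by (auto simp: s_def split: split_indicator)
      also have "\<dots> \<le> (SUP n. ennreal (s n x))" by (rule SUP_upper) simp
      finally show "ennreal (?S x) * indicator {b<..<c} x \<le> (SUP n. ennreal (s n x))" .
    qed
    have "mass ?S {b<..<c} = (SUP n. mass (s n) UNIV)"
      unfolding mass_def sup[symmetric]
      using nn_integral_monotone_convergence_SUP[OF inc, of lborel] by simp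
    then have "ennreal (1 / (c - a) powr p) * mass ?W {a<..<b} * ennreal_powr (mass ?S {b<..<c}) (p - 1)
      = (SUP n. ennreal (1 / (c - a) powr p) * mass ?W {a<..<b} * ennreal_powr (mass (s n) UNIV) (p - 1))"
      using p by (simp add: ennreal_powr_SUP SUP_mult_left_ennreal)
    also have "\<dots> \<le> ennreal (C powr p)" by (intro SUP_least each)
    finally show ?thesis .
  qed
  have "Ap_plus_const p J w \<le> ennreal (C powr p)"
    unfolding Ap_plus_const_def
  proof (rule SUP_least, clarify)
    fix a b c assume abc: "a \<in> J" "b \<in> J" "c \<in> J" "a < b" "b < c"
    show "ennreal (1 / (c - a) powr p) * (\<integral>\<^sup>+ t\<in>{a..b}. ennreal (w t) \<partial>lebesgue) *
      ennreal_powr (\<integral>\<^sup>+ t\<in>{b..c}. ennreal (w t powr (1 - conjugate_exponent p)) \<partial>lebesgue) (p - 1)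
      \<le> ennreal (C powr p)"
      using main[OF abc] weight_integrals(1)[OF iv ae abc(1,2) p] weight_integrals(2)[OF iv ae abc(2,3) p]
      by (simp only:)
  qed
  then show ?thesis by (simp add: le_less_trans)
qed

theorem maximal_plus_bounded_iff:
  assumes "is_interval J" "closed J" "1 < p" "weight_on J w"
  shows "bounded_on_Lp p (weighted_measure J w) (maximal_plus_on J) \<longleftrightarrow> w \<in> Ap_plus p J"
  using maximal_plus_bounded_if_Ap_plus Ap_plus_if_maximal_plus_bounded assms
  by (auto simp: Ap_plus_def)

section \<open>Reflection and the left maximal operator\<close>

lemma AE_lborel_reflect:
  assumes "AE x::real in lborel. P x"
  shows "AE x in lborel. P (- x)"
proof -
  obtain N where N: "\<And>x. x \<in> space lborel - N \<Longrightarrow> P x" "N \<in> null_sets lborel"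
    using AE_E3[OF assms] by blast
  have [measurable]: "N \<in> sets borel" using N(2) by auto
  have "emeasure lborel (uminus -` N) = emeasure (distr lborel borel uminus) N"
    by (subst emeasure_distr) auto
  then have "uminus -` N \<in> null_sets lborel"
    using N(2) measurable_sets[of uminus borel borel N] by (intro null_setsI) (auto simp: lborel_distr_uminus)
  then have "AE x in lborel. x \<notin> uminus -` N" by (rule AE_not_in)
  then show ?thesis by eventually_elim (use N(1) in auto)
qed

lemma measurable_reflect:
  assumes "h \<in> borel_measurable (lebesgue_on J)"
  shows "(\<lambda>x::real. h (- x)) \<in> borel_measurable (lebesgue_on (uminus ` J))"
proof -
  have "(*\<^sub>R) (-1) = (uminus :: real \<Rightarrow> real)" by auto
  then have "uminus \<in> lebesgue \<rightarrow>\<^sub>M (lebesgue :: real measure)"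
    using lebesgue_measurable_scaling[of "-1", where 'a = real] by simp
  then have "uminus \<in> lebesgue_on (uminus ` J) \<rightarrow>\<^sub>M lebesgue_on J"
    by (rule measurable_restrict_space3) auto
  then show ?thesis using assms by (rule measurable_compose)
qed

lemma uminus_image_uminus [simp]: "uminus ` uminus ` (J :: real set) = J"
  by (simp add: image_image)

lemma borel_reflect:
  assumes "J \<in> sets borel"
  shows "uminus ` (J :: real set) \<in> sets borel"
proof -
  have "uminus ` J = uminus -` J" by (force intro: image_eqI[of _ _ "- x" for x])
  then show ?thesis using measurable_sets[of "uminus :: real \<Rightarrow> real" borel borel J] assms by simp
qed

lemma weight_on_reflect:
  assumes w: "weight_on J w" and J: "J \<in> sets borel"
  shows "weight_on (uminus ` J) (\<lambda>x. w (- x))"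
proof -
  have "AE x in lebesgue_on J. 0 < w x" using w by (simp add: weight_on_def)
  then have "AE x in lebesgue. x \<in> J \<longrightarrow> 0 < w x" using J by (subst (asm) AE_restrict_space_iff) auto
  then have "AE x in lborel. x \<in> J \<longrightarrow> 0 < w x" by (simp add: AE_completion_iff)
  then have "AE x in lborel. - x \<in> J \<longrightarrow> 0 < w (- x)" by (rule AE_lborel_reflect)
  then have "AE x in lebesgue. x \<in> uminus ` J \<longrightarrow> 0 < w (- x)"
    unfolding AE_completion_iff by eventually_elim auto
  then have "AE x in lebesgue_on (uminus ` J). 0 < w (- x)"
    using borel_reflect[OF J] by (subst AE_restrict_space_iff) auto
  then show ?thesis using w measurable_reflect by (auto simp: weight_on_def)
qed

lemma nn_integral_reflect:
  assumes w: "weight_on J w" and J: "J \<in> sets borel" and h: "h \<in> borel_measurable (lebesgue_on J)"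
  shows "(\<integral>\<^sup>+x. h (- x) \<partial>weighted_measure (uminus ` J) (\<lambda>x. w (- x))) = (\<integral>\<^sup>+x. h x \<partial>weighted_measure J w)"
proof -
  obtain v where v[measurable]: "v \<in> borel_measurable borel"
    and ae: "AE x in lborel. x \<in> J \<longrightarrow> w x = v x"
    using weight_AE_borel[OF w J] by blast
  have ae': "AE x in lborel. x \<in> uminus ` J \<longrightarrow> w (- x) = v (- x)"
    using AE_lborel_reflect[OF ae] by eventually_elim auto
  have "(\<lambda>x. h x * indicator J x) \<in> borel_measurable lebesgue"
    using h J by (subst (asm) borel_measurable_restrict_space_iff_ennreal) auto
  moreover have "(\<lambda>x. ennreal (v x)) \<in> borel_measurable lebesgue"
    by (intro measurable_completion) measurable
  ultimately have "(\<lambda>x. (h x * indicator J x) * ennreal (v x)) \<in> borel_measurable lebesgue"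
    by measurable
  moreover have "(\<lambda>x. (h x * indicator J x) * ennreal (v x)) = (\<lambda>x. h x * ennreal (v x * indicator J x))"
    by (auto split: split_indicator)
  ultimately have m: "(\<lambda>x. h x * ennreal (v x * indicator J x)) \<in> borel_measurable lebesgue" by simp
  have "(\<integral>\<^sup>+x. h (- x) \<partial>weighted_measure (uminus ` J) (\<lambda>x. w (- x)))
    = (\<integral>\<^sup>+x. h (- x) * ennreal (v (- x) * indicator (uminus ` J) x) \<partial>lborel)"
    by (rule nn_integral_weighted_measure[OF weight_on_reflect[OF w J] borel_reflect[OF J] ae' measurable_reflect[OF h]])
  also have "\<dots> = (\<integral>\<^sup>+x. h (- x) * ennreal (v (- x) * indicator J (- x)) \<partial>lborel)"
    by (intro nn_integral_cong) (auto split: split_indicator intro: rev_image_eqI)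
  also have "\<dots> = (\<integral>\<^sup>+x. h x * ennreal (v x * indicator J x) \<partial>lborel)"
    using nn_integral_real_affine_lebesgue[OF m, of "-1" 0] by (simp add: nn_integral_completion)
  also have "\<dots> = (\<integral>\<^sup>+x. h x \<partial>weighted_measure J w)"
    by (rule nn_integral_weighted_measure[OF w J ae h, symmetric])
  finally show ?thesis .
qed

lemma Lp_norm_reflect:
  assumes w: "weight_on J w" and J: "J \<in> sets borel" and h[measurable]: "h \<in> borel_measurable (lebesgue_on J)"
  shows "Lp_norm p (weighted_measure (uminus ` J) (\<lambda>x. w (- x))) (\<lambda>x. h (- x)) = Lp_norm p (weighted_measure J w) h"
  unfolding Lp_norm_def
  by (subst nn_integral_reflect[OF w J, of "\<lambda>x. ennreal_powr (h x) p"]) auto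

lemma Lp_functions_reflect:
  assumes w: "weight_on J w" and J: "J \<in> sets borel" and f: "f \<in> Lp_functions p (weighted_measure J w)"
  shows "(\<lambda>x. f (- x)) \<in> Lp_functions p (weighted_measure (uminus ` J) (\<lambda>x. w (- x)))"
proof -
  have fm[measurable]: "f \<in> borel_measurable (lebesgue_on J)" using f by (simp add: Lp_functions_def)
  have "(\<lambda>x. ennreal (norm (f x))) \<in> borel_measurable (lebesgue_on J)" by measurable
  from Lp_norm_reflect[OF w J this, of p] show ?thesis
    using f measurable_reflect[OF fm] by (simp add: Lp_functions_def)
qed

text \<open>Boundedness of an operator on \<open>J\<close> passes to the operator conjugated with
\<open>x \<mapsto> - x\<close> on the reflected interval. Only functions in the Lebesgue space are
compared, so that all integrands are measurable.\<close>

lemma bounded_on_Lp_reflect: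
  assumes w: "weight_on J w" and J: "J \<in> sets borel"
    and T: "\<And>f. f \<in> Lp_functions p (weighted_measure (uminus ` J) (\<lambda>x. w (- x))) \<Longrightarrow>
      T' f = (\<lambda>t. T (\<lambda>s. f (- s)) (- t))"
    and bd: "bounded_on_Lp p (weighted_measure J w) T"
  shows "bounded_on_Lp p (weighted_measure (uminus ` J) (\<lambda>x. w (- x))) T'"
proof -
  let ?M = "weighted_measure J w" and ?M' = "weighted_measure (uminus ` J) (\<lambda>x. w (- x))"
  obtain C :: real where C: "\<And>f. f \<in> Lp_functions p ?M \<Longrightarrow> T f \<in> borel_measurable ?M"
      "\<And>f. f \<in> Lp_functions p ?M \<Longrightarrow> Lp_norm p ?M (T f) \<le> ennreal C * Lp_norm p ?M (\<lambda>t. ennreal (norm (f t)))"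
    using bd unfolding bounded_on_Lp_def by blast
  show ?thesis
    unfolding bounded_on_Lp_def
  proof (intro exI[of _ C] ballI conjI)
    fix f assume f: "f \<in> Lp_functions p ?M'"
    let ?g = "\<lambda>s. f (- s)"
    have g: "?g \<in> Lp_functions p ?M"
      using Lp_functions_reflect[OF weight_on_reflect[OF w J] borel_reflect[OF J] f] by simp
    then have g0: "?g \<in> borel_measurable (lebesgue_on J)" by (simp add: Lp_functions_def)
    have gm: "(\<lambda>x. ennreal (norm (?g x))) \<in> borel_measurable (lebesgue_on J)"
      using measurable_compose[OF g0, of "\<lambda>z. ennreal (norm z)" borel] by simp
    have Tm: "T ?g \<in> borel_measurable (lebesgue_on J)" using C(1)[OF g] by simp
    show "T' f \<in> borel_measurable ?M'" using measurable_reflect[OF Tm] by (simp add: T[OF f])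
    show "Lp_norm p ?M' (T' f) \<le> ennreal C * Lp_norm p ?M' (\<lambda>t. ennreal (norm (f t)))"
      using C(2)[OF g] Lp_norm_reflect[OF w J Tm, of p] Lp_norm_reflect[OF w J gm, of p] by (simp add: T[OF f])
  qed
qed

lemma set_nn_integral_reflect:
  fixes g :: "real \<Rightarrow> ennreal"
  assumes g: "g \<in> borel_measurable (lebesgue_on J)" and J: "J \<in> sets borel" and ab: "{a..b} \<subseteq> J"
  shows "(\<integral>\<^sup>+t\<in>{a..b}. g t \<partial>lebesgue) = (\<integral>\<^sup>+t\<in>{- b..- a}. g (- t) \<partial>lebesgue)"
proof -
  have "(\<lambda>x. g x * indicator J x) \<in> borel_measurable lebesgue"
    using g J by (subst (asm) borel_measurable_restrict_space_iff_ennreal) auto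
  then have "(\<lambda>x. (g x * indicator J x) * indicator {a..b} x) \<in> borel_measurable lebesgue"
    by (rule borel_measurable_times_ennreal) (intro borel_measurable_indicator, simp)
  moreover have "(\<lambda>x. (g x * indicator J x) * indicator {a..b} x) = (\<lambda>x. g x * indicator {a..b} x)"
    using ab by (intro ext) (auto split: split_indicator)
  ultimately have m: "(\<lambda>x. g x * indicator {a..b} x) \<in> borel_measurable lebesgue" by simp
  have "(\<integral>\<^sup>+t\<in>{a..b}. g t \<partial>lebesgue) = (\<integral>\<^sup>+t. g (- t) * indicator {a..b} (- t) \<partial>lebesgue)"
    using nn_integral_real_affine_lebesgue[OF m, of "-1" 0] by simp
  also have "\<dots> = (\<integral>\<^sup>+t\<in>{- b..- a}. g (- t) \<partial>lebesgue)"
    by (intro nn_integral_cong) (auto split: split_indicator)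
  finally show ?thesis .
qed

lemma maximal_minus_on_reflect:
  assumes f: "f \<in> borel_measurable (lebesgue_on J)" and J: "J \<in> sets borel"
  shows "maximal_minus_on J f t = maximal_plus_on (uminus ` J) (\<lambda>s. f (- s)) (- t)"
proof -
  have "(\<lambda>x. indicator J x *\<^sub>R f x) \<in> borel_measurable lebesgue"
    using f J by (subst (asm) borel_measurable_restrict_space_iff) auto
  moreover have "(\<lambda>x. indicator J x *\<^sub>R f x) = extend_zero J f" by (auto simp: extend_zero_def)
  ultimately have "extend_zero J f \<in> borel_measurable lebesgue" by simp
  then have "(\<lambda>s. ennreal (norm (extend_zero J f s))) \<in> borel_measurable lebesgue"
    using measurable_compose[of "extend_zero J f" lebesgue borel "\<lambda>z. ennreal (norm z)" borel] by simp
  then have m: "(\<lambda>s. ennreal (norm (extend_zero J f s))) \<in> borel_measurable (lebesgue_on UNIV)"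
    by (rule measurable_restrict_space1)
  have ext: "extend_zero (uminus ` J) (\<lambda>s. f (- s)) = (\<lambda>s. extend_zero J f (- s))"
    by (force simp: extend_zero_def)
  have int: "(\<integral>\<^sup>+ s\<in>{t - h..t}. ennreal (norm (extend_zero J f s)) \<partial>lebesgue)
    = (\<integral>\<^sup>+ s\<in>{- t..- t + h}. ennreal (norm (extend_zero J f (- s))) \<partial>lebesgue)" for h
    using set_nn_integral_reflect[OF m, of "t - h" t] by simp
  have ind: "(indicator J t :: ennreal) = indicator (uminus ` J) (- t)"
    by (auto split: split_indicator)
  show ?thesis
    unfolding maximal_minus_on_def maximal_plus_on_def maximal_minus_def maximal_plus_def ext int ind ..
qed

lemma Ap_minus_const_reflect:
  assumes iv: "is_interval J" and w: "weight_on J w" and J: "J \<in> sets borel"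
  shows "Ap_minus_const p J w = Ap_plus_const p (uminus ` J) (\<lambda>x. w (- x))"
proof -
  let ?S = "{(a, b, c). a \<in> J \<and> b \<in> J \<and> c \<in> J \<and> a < b \<and> b < c}"
  let ?S' = "{(a, b, c). a \<in> uminus ` J \<and> b \<in> uminus ` J \<and> c \<in> uminus ` J \<and> a < b \<and> b < (c::real)}"
  have im: "?S' = (\<lambda>(a, b, c). (- c, - b, - a)) ` ?S"
  proof
    show "?S' \<subseteq> (\<lambda>(a, b, c). (- c, - b, - a)) ` ?S"
    proof clarify
      fix a b c assume "a \<in> J" "b \<in> J" "c \<in> J" "- a < - b" "- b < - c"
      then show "(- a, - b, - c) \<in> (\<lambda>(a, b, c). (- c, - b, - a)) ` ?S"
        by (intro image_eqI[of _ _ "(c, b, a)"]) auto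
    qed
  qed auto
  have wm[measurable]: "w \<in> borel_measurable (lebesgue_on J)" using w by (simp add: weight_on_def)
  have 1: "(\<lambda>t. ennreal (w t)) \<in> borel_measurable (lebesgue_on J)"
    and 2: "(\<lambda>t. ennreal (w t powr (1 - conjugate_exponent p))) \<in> borel_measurable (lebesgue_on J)"
    by measurable
  have sub: "{a..b} \<subseteq> J" if "a \<in> J" "b \<in> J" for a b
    using mem_is_interval_1_I[OF iv that] by auto
  have "ennreal (1 / (c - a) powr p) * (\<integral>\<^sup>+ t\<in>{b..c}. ennreal (w t) \<partial>lebesgue) *
        ennreal_powr (\<integral>\<^sup>+ t\<in>{a..b}. ennreal (w t powr (1 - conjugate_exponent p)) \<partial>lebesgue) (p - 1)
      = ennreal (1 / (- a - (- c)) powr p) * (\<integral>\<^sup>+ t\<in>{- c..- b}. ennreal (w (- t)) \<partial>lebesgue) *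
        ennreal_powr (\<integral>\<^sup>+ t\<in>{- b..- a}. ennreal (w (- t) powr (1 - conjugate_exponent p)) \<partial>lebesgue) (p - 1)"
    if "a \<in> J" "b \<in> J" "c \<in> J" for a b c
    using set_nn_integral_reflect[OF 1 J sub[OF that(2,3)]] set_nn_integral_reflect[OF 2 J sub[OF that(1,2)]]
    by simp
  then show ?thesis
    unfolding Ap_minus_const_def Ap_plus_const_def im image_image
    by (intro SUP_cong refl) auto
qed

theorem maximal_minus_bounded_iff:
  assumes iv: "is_interval J" and cl: "closed J" and p: "1 < p" and w: "weight_on J w"
  shows "bounded_on_Lp p (weighted_measure J w) (maximal_minus_on J) \<longleftrightarrow> w \<in> Ap_minus p J"
proof -
  let ?J = "uminus ` J" and ?w = "\<lambda>x. w (- x)"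
  let ?M = "weighted_measure J w" and ?M' = "weighted_measure ?J ?w"
  have J: "J \<in> sets borel" using cl by simp
  note w' = weight_on_reflect[OF w J] and J' = borel_reflect[OF J]
  have "bounded_on_Lp p ?M (maximal_minus_on J) \<longleftrightarrow> bounded_on_Lp p ?M' (maximal_plus_on ?J)"
  proof
    assume "bounded_on_Lp p ?M (maximal_minus_on J)"
    then show "bounded_on_Lp p ?M' (maximal_plus_on ?J)"
    proof (rule bounded_on_Lp_reflect[OF w J, rotated])
      fix f assume "f \<in> Lp_functions p ?M'"
      then have "(\<lambda>s. f (- s)) \<in> borel_measurable (lebesgue_on J)"
        using measurable_reflect[of f ?J] by (simp add: Lp_functions_def)
      from maximal_minus_on_reflect[OF this J]
      show "maximal_plus_on ?J f = (\<lambda>t. maximal_minus_on J (\<lambda>s. f (- s)) (- t))" by (auto simp: fun_eq_iff)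
    qed
  next
    assume "bounded_on_Lp p ?M' (maximal_plus_on ?J)"
    then have "bounded_on_Lp p (weighted_measure (uminus ` ?J) (\<lambda>x. w (- (- x)))) (maximal_minus_on J)"
    proof (rule bounded_on_Lp_reflect[OF w' J', rotated])
      fix f assume "f \<in> Lp_functions p (weighted_measure (uminus ` ?J) (\<lambda>x. w (- (- x))))"
      then have "f \<in> borel_measurable (lebesgue_on J)" by (simp add: Lp_functions_def)
      from maximal_minus_on_reflect[OF this J]
      show "maximal_minus_on J f = (\<lambda>t. maximal_plus_on ?J (\<lambda>s. f (- s)) (- t))" by auto
    qed
    then show "bounded_on_Lp p ?M (maximal_minus_on J)" by simp
  qed
  also have "\<dots> \<longleftrightarrow> ?w \<in> Ap_plus p ?J"
    using iv cl p w' by (intro maximal_plus_bounded_iff) (auto intro: closed_negations)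
  also have "\<dots> \<longleftrightarrow> w \<in> Ap_minus p J"
    using w w' by (simp add: Ap_plus_def Ap_minus_def Ap_minus_const_reflect[OF iv w J])
  finally show ?thesis .
qed

section \<open>Half-lines\<close>

theorem theorem2p3:
  fixes p :: real
  assumes "1 < p"
  shows "(\<forall>w. weight_on real_minus w \<longrightarrow>
            (bounded_on_Lp p (weighted_measure real_minus w) (maximal_plus_on real_minus)
               \<longleftrightarrow> w \<in> Ap_plus p real_minus) \<and>
            (bounded_on_Lp p (weighted_measure real_minus w) (maximal_minus_on real_minus)
               \<longleftrightarrow> w \<in> Ap_minus p real_minus)) \<and>
         (\<forall>w. weight_on real_plus w \<longrightarrow>
            (bounded_on_Lp p (weighted_measure real_plus w) (maximal_plus_on real_plus)
               \<longleftrightarrow> w \<in> Ap_plus p real_plus) \<and>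
            (bounded_on_Lp p (weighted_measure real_plus w) (maximal_minus_on real_plus)
               \<longleftrightarrow> w \<in> Ap_minus p real_plus))"
  using assms by (simp add: maximal_plus_bounded_iff maximal_minus_bounded_iff is_interval_ic is_interval_ci)

end
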